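(* There is no connected mutation-finite quiver with real weights of rank $5$ having an arrow of weight $2\cos\frac{\pi m}{d}$ with integers $m,d$ such that $d>5$, $m\le d/2$ and $\gcd(m,d)=1$.
   Context: A quiver with real weights of rank $r$ on vertices $1,\dots,r$ is a real skew-symmetric $r\times r$ matrix $B=(b_{ij})$; if $b_{ij}>0$ there is an arrow $i\to j$ of weight $b_{ij}$, and vertices $i,j$ are joined iff $b_{ij}\neq 0$. It is connected if its underlying graph is connected. For a vertex $k$, the mutation $\mu_k$ gives $b'_{ij}=-b_{ij}$ if $k\in\{i,j\}$, and $b'_{ij}=b_{ij}+\frac{|b_{ik}|b_{kj}+b_{ik}|b_{kj}|}{2}$ otherwise. The mutation class of $Q$ is the set of quivers obtained from $Q$ by finite sequences of mutations (up to relabeling of vertices); $Q$ is mutation-finite if this set is finite. *)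

theory Defs
  imports "HOL-Analysis.Analysis"
begin

text \<open>
  A quiver with real weights of rank \<open>CARD('n)\<close> is identified with its exchange matrix
  \<open>B\<close>, where \<open>B $ i $ j\<close> is the entry \<open>b\<^sub>i\<^sub>j\<close>; the vertices are the elements of the index type.
\<close>

definition real_quiver :: "real^'n^'n \<Rightarrow> bool" where
  "real_quiver B \<longleftrightarrow> transpose B = - B"

definition has_arrow :: "real^'n^'n \<Rightarrow> 'n \<Rightarrow> 'n \<Rightarrow> real \<Rightarrow> bool" where
  "has_arrow B i j w \<longleftrightarrow> B $ i $ j > 0 \<and> B $ i $ j = w"

definition joined :: "real^'n^'n \<Rightarrow> 'n \<Rightarrow> 'n \<Rightarrow> bool" where
  "joined B i j \<longleftrightarrow> B $ i $ j \<noteq> 0"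

definition quiver_connected :: "real^'n^'n \<Rightarrow> bool" where
  "quiver_connected B \<longleftrightarrow> (\<forall>i j. (joined B)\<^sup>*\<^sup>* i j)"

definition mutation :: "'n \<Rightarrow> real^'n^'n \<Rightarrow> real^'n^'n" where
  "mutation k B = (\<chi> i j.
     if i = k \<or> j = k then - (B $ i $ j)
     else B $ i $ j + (\<bar>B $ i $ k\<bar> * B $ k $ j + B $ i $ k * \<bar>B $ k $ j\<bar>) / 2)"

inductive mutation_reachable :: "real^'n^'n \<Rightarrow> real^'n^'n \<Rightarrow> bool" for B where
  refl: "mutation_reachable B B"
| step: "mutation_reachable B C \<Longrightarrow> mutation_reachable B (mutation k C)"

definition relabel :: "('n \<Rightarrow> 'n) \<Rightarrow> real^'n^'n \<Rightarrow> real^'n^'n" where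
  "relabel p B = (\<chi> i j. B $ p i $ p j)"

definition relabeling_class :: "real^'n^'n \<Rightarrow> (real^'n^'n) set" where
  "relabeling_class B = {relabel p B | p. bij p}"

text \<open>
  Quivers up to relabeling of vertices are represented by their relabeling classes, so the
  mutation class is a set of such classes.
\<close>

definition mutation_class :: "real^'n^'n \<Rightarrow> (real^'n^'n) set set" where
  "mutation_class B = {relabeling_class C | C. mutation_reachable B C}"

definition mutation_finite :: "real^'n^'n \<Rightarrow> bool" where
  "mutation_finite B \<longleftrightarrow> finite (mutation_class B)"

end

theory Submission
  imports Defs "HOL-Number_Theory.Cong"
begin

text \<open>
  Give a rank 3 quiver with weights \<open>x, y, z\<close> signs such that \<open>xyz\<close> is positive exactly for an
  oriented cycle. Mutation then becomes the Vieta move \<open>y \<mapsto> xz - y\<close>, which preserves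
  \<open>C = x\<^sup>2 + y\<^sup>2 + z\<^sup>2 - xyz\<close>. For fixed \<open>x = 2 cos \<theta>\<close> the pair \<open>(y, z)\<close> is rotated by \<open>\<theta>\<close> along an
  ellipse, so finiteness forces \<open>\<theta>\<close> to be a rational multiple of \<open>\<pi>\<close>, and looking at the largest
  weight gives \<open>C \<le> 4\<close>. If some weight is \<open>2 cos (\<pi>m/d)\<close> in lowest terms with \<open>d \<ge> 6\<close>, then \<open>C = 4\<close>:
  all weights are cyclotomic integers, and applying a Galois automorphism to all of them
  yields another finite system. Take \<open>D\<close> to be the maximal denominator and conjugate to a weight
  \<open>2 cos (\<pi>/D)\<close>; for \<open>C < 4\<close> rotation produces the triple \<open>(2 cos (\<pi>/D), 0, 2 sin (\<pi>/2c))\<close> with \<open>c\<close> odd and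
  \<open>D/2 < c \<le> D\<close>, and some conjugate of it violates \<open>C < 4\<close>.

  For \<open>C = 4\<close> the rotations reach a double arrow: if \<open>x = 2 cos (\<pi>/n)\<close> is the largest weight below 2,
  there is a quiver in the class with \<open>1 \<Rightarrow> 2\<close> of weight 2 and arrows \<open>2 \<rightarrow> 3 \<rightarrow> 1\<close> of weight \<open>x\<close>.
  Maximality of \<open>x\<close> leaves few possibilities for the arrows joining a further vertex to this triangle,
  and for each way of attaching two further vertices at most three mutations produce a triple
  with \<open>C > 4\<close>, or with \<open>C \<noteq> 4\<close> although it contains the weight \<open>x\<close>.
\<close>

section \<open>Conjugation of roots of unity\<close>

text \<open>Finiteness enters only through \<open>vieta_system\<close>. Galois conjugation does not
  respect the order of the reals, so C < 4 is not visibly preserved. But 4 is rational, so C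
  distinct from 4 is preserved, and finiteness of the conjugate system bounds its constant by 4.
  Hence all conjugates of a system with C < 4 stay below 4, and one conjugate (2 cos (pi r/D), 0, 2
  sin (pi r/(2c))) with a constant of at least 4 is a contradiction. No number field is needed:
  conjugation replaces zeta by zeta^k in integer polynomials, which is well defined because
  vanishing at a root of unity passes to its coprime powers. The bound 6 comes from 2 sin (pi/D) <=
  1, needed for the bad conjugate when c = D, and from 2 cos (pi/6) = sqrt 3, which ensures that the
  largest weight below 2 again has denominator at least 6. Two outer vertices are considered because
  the constraints on a single one, \<open>attachment\<close>, leave nonzero possibilities.\<close>

definition ipoly :: "int poly \<Rightarrow> 'a::comm_ring_1 \<Rightarrow> 'a" where
  "ipoly p w = poly (map_poly of_int p) w"

lemma ipoly_0 [simp]: "ipoly 0 w = 0"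
  by (simp add: ipoly_def)

lemma ipoly_pCons [simp]: "ipoly (pCons a p) w = of_int a + w * ipoly p w"
  by (simp add: ipoly_def map_poly_pCons)

lemma ipoly_add [simp]: "ipoly (p + q) w = ipoly p w + ipoly q w"
  by (induction p q rule: poly_induct2) (simp_all add: algebra_simps)

lemma ipoly_smult [simp]: "ipoly (smult c p) w = of_int c * ipoly p w"
  by (induction p) (simp_all add: algebra_simps)

lemma ipoly_minus [simp]: "ipoly (- p) w = - ipoly p w"
  using ipoly_smult[of "-1" p w] by simp

lemma ipoly_diff [simp]: "ipoly (p - q) w = ipoly p w - ipoly q w"
  using ipoly_add[of p "- q" w] by simp

lemma ipoly_mult [simp]: "ipoly (p * q) w = ipoly p w * ipoly q w"
  by (induction p) (simp_all add: algebra_simps)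

lemma ipoly_1 [simp]: "ipoly 1 w = 1"
  by (simp add: one_pCons)

lemma ipoly_power [simp]: "ipoly (p ^ n) w = ipoly p w ^ n"
  by (induction n) simp_all

lemma ipoly_of_int [simp]: "ipoly (of_int c) w = of_int c"
  by (simp add: of_int_poly)

lemma ipoly_of_nat [simp]: "ipoly (of_nat c) w = of_nat c"
  by (metis ipoly_of_int of_int_of_nat_eq)

lemma ipoly_monom [simp]: "ipoly (monom c n) w = of_int c * w ^ n"
  by (induction n) (simp_all add: monom_Suc monom_0 algebra_simps)

section \<open>Frobenius congruence and minimal integer polynomials\<close>

lemma prime_dvd_add_power:
  fixes u v :: "'a::comm_ring_1"
  assumes "prime p"
  shows "of_nat p dvd (u + v) ^ p - u ^ p - v ^ p"
proof -
  have p0: "p > 0" using assms prime_gt_0_nat by blast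
  have "(u + v) ^ p = (\<Sum>k\<le>p. of_nat (p choose k) * u ^ k * v ^ (p - k))"
    by (rule binomial_ring)
  also have "{..p} = insert 0 (insert p {1..<p})"
    using p0 by auto
  also have "(\<Sum>k\<in>insert 0 (insert p {1..<p}). of_nat (p choose k) * u ^ k * v ^ (p - k))
     = v ^ p + (u ^ p + (\<Sum>k\<in>{1..<p}. of_nat (p choose k) * u ^ k * v ^ (p - k)))"
    using p0 by (subst sum.insert; simp)+
  finally have "(u + v) ^ p - u ^ p - v ^ p = (\<Sum>k\<in>{1..<p}. of_nat (p choose k) * u ^ k * v ^ (p - k))"
    by simp
  moreover have "of_nat p dvd (\<Sum>k\<in>{1..<p}. of_nat (p choose k) * u ^ k * v ^ (p - k))"
  proof (rule dvd_sum)
    fix k assume k: "k \<in> {1..<p}"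
    then have "p dvd p choose k"
      by (intro dvd_choose_prime) (use assms in auto)
    then have "(of_nat p :: 'a) dvd of_nat (p choose k)"
      by (auto simp: dvd_def)
    then show "(of_nat p :: 'a) dvd of_nat (p choose k) * u ^ k * v ^ (p - k)"
      by (simp add: mult.assoc)
  qed
  ultimately show ?thesis by simp
qed

lemma prime_dvd_power_diff:
  fixes a :: int
  assumes "prime p"
  shows "int p dvd a ^ p - a"
proof (induction a rule: int_induct[where k = 0])
  case base
  show ?case
    using prime_gt_0_nat[OF assms] by (simp add: power_0_left)
next
  case (step1 i)
  then show ?case
    using dvd_add[OF prime_dvd_add_power[OF assms, of i 1] step1(2)] by (simp add: algebra_simps)
next
  case (step2 i)
  then show ?case
    using dvd_diff[OF step2(2) prime_dvd_add_power[OF assms, of "i - 1" 1]] by (simp add: algebra_simps)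
qed

text \<open>Modulo p, taking p-th powers is additive and fixes integers, so g(X^p) and g(X)^p agree.
  That the error is p times an integer polynomial, and not just some number, is what later allows
  divisibility to be read off.\<close>

lemma ipoly_power_prime:
  assumes "prime p"
  shows "\<exists>h. \<forall>w::'a::comm_ring_1. ipoly g (w ^ p) = ipoly g w ^ p + of_nat p * ipoly h w"
proof (induction g)
  case 0
  have "(0::'a) ^ p = 0"
    using assms prime_gt_0_nat by (simp add: power_0_left)
  then show ?case
    by (intro exI[of _ 0]) simp
next
  case (pCons a g)
  then obtain h where h: "\<And>w::'a. ipoly g (w ^ p) = ipoly g w ^ p + of_nat p * ipoly h w"
    by blast
  obtain K where K: "([:a:] + pCons 0 g) ^ p - [:a:] ^ p - (pCons 0 g) ^ p = of_nat p * K"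
    using prime_dvd_add_power[OF assms, of "[:a:]" "pCons 0 g"] by (elim dvdE)
  obtain b where b: "a ^ p - a = int p * b"
    using prime_dvd_power_diff[OF assms, of a] by (elim dvdE)
  show ?case
  proof (intro exI allI)
    fix w :: 'a
    have "ipoly (([:a:] + pCons 0 g) ^ p - [:a:] ^ p - (pCons 0 g) ^ p) w = ipoly (of_nat p * K) w"
      by (simp only: K)
    then have "(of_int a + w * ipoly g w) ^ p - of_int a ^ p - (w * ipoly g w) ^ p = of_nat p * ipoly K w"
      by (simp del: add_pCons)
    then have 1: "(of_int a + w * ipoly g w) ^ p = of_int a ^ p + w ^ p * ipoly g w ^ p + of_nat p * ipoly K w"
      by (simp add: algebra_simps power_mult_distrib)
    have "(of_int (a ^ p - a) :: 'a) = of_int (int p * b)"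
      by (simp only: b)
    then have 2: "(of_int a :: 'a) ^ p = of_int a + of_nat p * of_int b"
      by (simp add: algebra_simps)
    show "ipoly (pCons a g) (w ^ p) = ipoly (pCons a g) w ^ p
        + of_nat p * ipoly (monom 1 p * h - K - [:b:]) w"
      by (simp add: 1 2 h algebra_simps)
  qed
qed

text \<open>Gauss's lemma: contents multiply, so for primitive \<open>r\<close> the whole factor
  \<open>c\<close> sits in the content of the cofactor and can be cancelled.\<close>

lemma primitive_dvd_smult:
  fixes r q :: "int poly"
  assumes "content r = 1" "c \<noteq> 0" "r dvd smult c q"
  shows "r dvd q"
proof -
  obtain t where t: "smult c q = r * t"
    using assms(3) by (elim dvdE)
  have "content t = content (smult c q)"
    by (simp add: t content_mult assms(1))
  then have "c dvd content t"
    by simp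
  then obtain t' where "t = [:c:] * t'"
    by (metis const_poly_dvd_iff_dvd_content dvdE)
  then have "smult c (q - r * t') = 0"
    by (simp add: t smult_diff_right)
  then show ?thesis
    using assms(2) by (simp add: smult_eq_0_iff)
qed

text \<open>The primitive part of a nonzero annihilator of least degree works: pseudo-division by it
  leaves no remainder by minimality, and Gauss's lemma cancels the factor introduced. Divisibility
  thus holds over the integers.\<close>

lemma exists_minimal_int_poly:
  fixes w :: complex
  assumes "P \<noteq> 0" "ipoly P w = 0"
  obtains f where "ipoly f w = 0" "degree f > 0" "\<And>Q. ipoly Q w = 0 \<Longrightarrow> f dvd Q"
    "\<And>Q. ipoly Q w = 0 \<Longrightarrow> degree Q < degree f \<Longrightarrow> Q = 0"
proof -
  define n where "n = (LEAST n. \<exists>Q. Q \<noteq> 0 \<and> ipoly Q w = 0 \<and> degree Q = n)"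
  have "\<exists>Q. Q \<noteq> 0 \<and> ipoly Q w = 0 \<and> degree Q = n"
    unfolding n_def by (rule LeastI_ex) (use assms in blast)
  then obtain q where q: "q \<noteq> 0" "ipoly q w = 0" "degree q = n"
    by blast
  have min: "Q = 0" if "ipoly Q w = 0" "degree Q < n" for Q
    using that not_less_Least[of "degree Q" "\<lambda>n. \<exists>Q. Q \<noteq> 0 \<and> ipoly Q w = 0 \<and> degree Q = n"]
    unfolding n_def by blast
  define f where "f = primitive_part q"
  have qf: "q = smult (content q) f"
    by (simp add: f_def)
  have c0: "content q \<noteq> 0"
    using q by simp
  have f: "ipoly f w = 0" "degree f = n" "content f = 1" "f \<noteq> 0"
  proof -
    have "ipoly q w = of_int (content q) * ipoly f w"
      by (subst qf) simp
    then show "ipoly f w = 0"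
      using q c0 by simp
  qed (use q in \<open>simp_all add: f_def\<close>)
  have dvd: "f dvd Q" if Q: "ipoly Q w = 0" for Q
  proof -
    obtain u v where uv: "pseudo_divmod Q f = (u, v)"
      by fastforce
    define c where "c = lead_coeff f ^ (Suc (degree Q) - degree f)"
    have c: "smult c Q = f * u + v" "v = 0 \<or> degree v < degree f"
      using pseudo_divmod[OF f(4) uv] by (auto simp: c_def)
    have "ipoly v w = ipoly (smult c Q - f * u) w"
      by (simp add: c)
    then have "ipoly v w = 0"
      by (simp add: Q f)
    then have "v = 0"
      using min c(2) f(2) by blast
    moreover have "c \<noteq> 0"
      using f(4) by (simp add: c_def)
    ultimately show ?thesis
      using primitive_dvd_smult[OF f(3), of c Q] c(1) by simp
  qed
  have "degree f > 0"
  proof (rule ccontr)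
    assume "\<not> degree f > 0"
    then obtain a where "f = [:a:]"
      by (meson degree_eq_zeroE not_gr_zero)
    then show False
      using f by simp
  qed
  then show ?thesis
    using that dvd f min by blast
qed

text \<open>
  Write \<open>X\<^sup>M - 1 = f g\<close> with \<open>f\<close> the minimal polynomial of \<open>w\<close>. If \<open>f\<close> does not vanish at \<open>w\<^sup>p\<close>, then
  \<open>g\<close> does, so \<open>p\<close> divides \<open>g(w)\<^sup>p\<close>; differentiating at \<open>w\<close> shows that \<open>p\<close> divides \<open>M\<^sup>p\<close>.
\<close>

theorem ipoly_root_of_unity_prime_power:
  fixes w :: complex
  assumes M: "M > 0" "w ^ M = 1" and p: "prime p" "\<not> p dvd M" and P: "ipoly P w = 0"
  shows "ipoly P (w ^ p) = 0"
proof -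
  define X where "X = (monom 1 M - 1 :: int poly)"
  have X: "ipoly X w = 0" "X \<noteq> 0"
  proof -
    show "ipoly X w = 0" by (simp add: X_def M)
    have "coeff X M = 1"
      using M by (simp add: X_def coeff_1)
    then show "X \<noteq> 0" by auto
  qed
  obtain f where f: "ipoly f w = 0" "degree f > 0" "\<And>Q. ipoly Q w = 0 \<Longrightarrow> f dvd Q"
    and min: "\<And>Q. ipoly Q w = 0 \<Longrightarrow> degree Q < degree f \<Longrightarrow> Q = 0"
    using exists_minimal_int_poly[OF X(2,1)] by metis
  obtain g where g: "X = f * g"
    using f(3)[OF X(1)] by (elim dvdE)
  have "degree X = M"
    unfolding X_def using M
    by (subst degree_add_eq_left[of "- 1", simplified]) (auto simp: degree_monom_eq)
  then have "lead_coeff X = 1"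
    using M by (simp add: X_def coeff_1)
  then have "lead_coeff f * lead_coeff g = 1"
    by (metis g lead_coeff_mult)
  \<comment> \<open>Pseudo-division by \<open>f\<close> therefore multiplies the dividend only by a
    unit, which cannot absorb p.\<close>
  then have lcf: "lead_coeff f dvd 1"
    by (metis dvdI)
  have "ipoly f (w ^ p) = 0"
  proof (rule ccontr)
    assume nz: "ipoly f (w ^ p) \<noteq> 0"
    have "(w ^ p) ^ M = (w ^ M) ^ p"
      by (simp add: mult.commute flip: power_mult)
    then have "ipoly X (w ^ p) = 0"
      by (simp add: X_def M)
    then have g0: "ipoly g (w ^ p) = 0"
      using nz by (simp add: g)
    obtain h where "\<And>w::complex. ipoly g (w ^ p) = ipoly g w ^ p + of_nat p * ipoly h w"
      using ipoly_power_prime[OF p(1), of g] by blast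
    then have gp: "ipoly g w ^ p = - of_nat p * ipoly h w"
      using g0 by (metis add_eq_0_iff2 mult_minus_left)
    have "pderiv X = smult (int M) (monom 1 (M - 1))"
      by (simp add: X_def pderiv_diff pderiv_monom smult_monom)
    then have "ipoly (pderiv (f * g)) w = ipoly (smult (int M) (monom 1 (M - 1))) w"
      by (simp only: g)
    then have "of_nat M * w ^ (M - 1) = ipoly (pderiv f) w * ipoly g w"
      by (simp add: pderiv_mult f mult.commute)
    moreover have "w * w ^ (M - 1) = 1"
      using M by (metis power_eq_if not_gr_zero)
    moreover have "of_nat M = of_nat M * w ^ (M - 1)  * w" if "w * w ^ (M - 1) = 1"
      using that by (simp add: mult.assoc mult.commute)
    ultimately have "of_nat M = w * ipoly (pderiv f) w * ipoly g w"
      by simp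
    then have "of_nat M ^ p = (w * ipoly (pderiv f) w) ^ p * (- of_nat p * ipoly h w)"
      by (simp only: gp power_mult_distrib)
    also have "\<dots> = of_nat p * ipoly (- (([:0,1:] * pderiv f) ^ p * h)) w"
      by simp
    finally obtain s where s: "of_nat M ^ p = of_nat p * ipoly s w"
      by blast
    obtain u v where uv: "pseudo_divmod s f = (u, v)"
      by fastforce
    define c where "c = lead_coeff f ^ (Suc (degree s) - degree f)"
    have f0: "f \<noteq> 0" using f(2) by auto
    have c: "smult c s = f * u + v" "v = 0 \<or> degree v < degree f" "c dvd 1"
      using pseudo_divmod[OF f0 uv] lcf by (auto simp: c_def power_abs)
    \<comment> \<open>\<open>Q\<close> expresses c (M^p - p s(w)) = 0 in degree below that of
      \<open>f\<close>, so it vanishes identically. Its constant coefficient turns the relation at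
      \<open>w\<close> into a divisibility of integers.\<close>
    define Q where "Q = [:c * int M ^ p:] - smult (int p) v"
    have "ipoly v w = of_int c * ipoly s w"
      using arg_cong[OF c(1), of "\<lambda>q. ipoly q w"] f by simp
    then have "ipoly Q w = of_int c * (of_nat M ^ p - of_nat p * ipoly s w)"
      by (simp add: Q_def algebra_simps)
    then have "ipoly Q w = 0"
      by (simp add: s)
    moreover have "degree Q < degree f"
      unfolding Q_def using c(2) f(2)
      by (intro degree_diff_less) (auto intro: le_less_trans[OF degree_smult_le])
    ultimately have "Q = 0"
      using min by blast
    then have "coeff Q 0 = 0"
      by simp
    then have "c * int M ^ p = int p * coeff v 0"
      by (simp add: Q_def)
    then have "int p dvd c * int M ^ p"
      by simp
    moreover have pp: "prime (int p)"
      using p(1) by simp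
    moreover have "\<not> int p dvd c"
      using pp dvd_trans[OF _ c(3)] not_prime_unit by blast
    ultimately have "int p dvd int M"
      using prime_dvd_mult_iff[OF pp] prime_dvd_power[OF pp] by blast
    then show False
      using p(2) by simp
  qed
  moreover obtain t where "P = f * t"
    using f(3)[OF P] dvdE by blast
  ultimately show ?thesis
    by simp
qed

lemma ipoly_root_of_unity_power:
  fixes w :: complex
  assumes "k > 0" and M: "M > 0" "w ^ M = 1" and "coprime k M" and P: "ipoly P w = 0"
  shows "ipoly P (w ^ k) = 0"
  using assms(1,4)
proof (induction k rule: prime_divisors_induct)
  case zero
  then show ?case by simp
next
  case (unit k)
  then show ?case using P by simp
next
  case (factor p k)
  have "(w ^ k) ^ M = (w ^ M) ^ k"
    by (simp add: mult.commute flip: power_mult)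
  then have *: "(w ^ k) ^ M = 1"
    by (simp add: M)
  have "\<not> p dvd M"
    using factor.prems(2) factor.hyps coprime_common_divisor[of "p * k" M p] by auto
  moreover have "ipoly P (w ^ k) = 0"
    using factor by simp
  ultimately show ?case
    using ipoly_root_of_unity_prime_power[OF M(1) * factor(1), of P]
    by (simp add: mult.commute flip: power_mult)
qed

text \<open>The power w^k is again an M-th root of unity, and raising it to an inverse of k modulo M
  gives back w; so the converse is an instance of the forward direction.\<close>

lemma ipoly_root_of_unity_power_iff:
  fixes w :: complex
  assumes "k > 0" and M: "M > 0" "w ^ M = 1" and k: "coprime k M"
  shows "ipoly P (w ^ k) = 0 \<longleftrightarrow> ipoly P w = 0"
proof
  assume 0: "ipoly P (w ^ k) = 0"
  obtain l where l: "[k * l = 1] (mod M)"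
    using cong_solve_coprime_nat[OF k] by auto
  have "coprime (k * l) M"
    using cong_imp_coprime[OF cong_sym[OF l]] by simp
  then have "coprime l M"
    by simp
  \<comment> \<open>For M = 1 the inverse \<open>l\<close> may be 0; adding M makes the exponent
    positive.\<close>
  then have cl: "coprime (l + M) M"
    by (metis coprime_iff_gcd_eq_1 gcd_add1)
  have "(w ^ k) ^ M = (w ^ M) ^ k"
    by (simp add: mult.commute flip: power_mult)
  then have "(w ^ k) ^ M = 1"
    by (simp add: M)
  then have "ipoly P ((w ^ k) ^ (l + M)) = 0"
    using ipoly_root_of_unity_power[OF _ M(1) _ cl 0] M(1) by simp
  moreover have "(w ^ k) ^ (l + M) = w ^ 1"
  proof -
    have "(w ^ k) ^ (l + M) = w ^ (k * l + M * k)"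
      by (simp add: algebra_simps flip: power_mult)
    also have "\<dots> = w ^ (k * l) * (w ^ M) ^ k"
      by (simp only: power_add power_mult)
    also have "w ^ (k * l) = w ^ ((k * l) mod M + M * ((k * l) div M))"
      by simp
    also have "\<dots> = w ^ (k * l mod M)"
      by (simp only: power_add power_mult M power_one mult_1_right)
    also have "\<dots> = w ^ (1 mod M)"
      using l by (simp add: cong_def)
    also have "\<dots> = w ^ 1"
      using M(2) by (cases "M = 1") simp_all
    finally show ?thesis by (simp add: M)
  qed
  ultimately show "ipoly P w = 0" by simp
qed (use ipoly_root_of_unity_power assms in blast)

section \<open>Finite systems of Markov triples\<close>

lemma cos_add_int_pi: "cos (u + pi * of_int t) = (if even t then cos u else - cos u)"
  by (simp add: cos_add cos_npi_int sin_npi_int)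

lemma sin_add_int_pi: "sin (u + pi * of_int t) = (if even t then sin u else - sin u)"
  by (simp add: sin_add cos_npi_int sin_npi_int)

lemma abs_cos_add_int_pi: "\<bar>cos (u + pi * of_int t)\<bar> = \<bar>cos u\<bar>"
  by (simp add: cos_add_int_pi)

lemma abs_sin_add_int_pi: "\<bar>sin (u + pi * of_int t)\<bar> = \<bar>sin u\<bar>"
  by (simp add: sin_add_int_pi)

text \<open>Modulo n, \<open>a\<close> lies between 1 and n - 1, where the cosine is monotone and
  extreme at the two ends. Hence 2 cos (pi/n) dominates every weight of denominator n > 1.\<close>

lemma abs_cos_rational_le:
  fixes a n :: int
  assumes "n > 0" "\<not> n dvd a"
  shows "\<bar>cos (pi * a / n)\<bar> \<le> cos (pi / n)"
proof -
  define b where "b = a mod n"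
  have "b \<noteq> 0" "0 \<le> b" "b < n"
    using assms by (simp_all add: b_def dvd_eq_mod_eq_0)
  then have b1: "1 \<le> real_of_int b" "real_of_int b \<le> n - 1"
    by linarith+
  have "a = b + n * (a div n)"
    by (simp add: b_def)
  then have "real_of_int a = real_of_int (b + n * (a div n))"
    by (rule arg_cong)
  then have "pi * a / n = pi * b / n + pi * of_int (a div n)"
    using assms(1) by (simp add: field_simps)
  then have eq: "\<bar>cos (pi * a / n)\<bar> = \<bar>cos (pi * b / n)\<bar>"
    by (simp only: abs_cos_add_int_pi)
  have le: "pi * 1 / n \<le> pi * b / n" "pi * b / n \<le> pi * (n - 1) / n"
    using b1 assms(1) by (intro divide_right_mono mult_left_mono; simp)+
  moreover have "pi * (n - 1) / n = pi - pi / n" "pi / n > 0"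
    using assms(1) by (simp_all add: field_simps)
  ultimately have "0 \<le> pi / n" "pi / n \<le> pi * b / n" "pi * b / n \<le> pi - pi / n" "pi - pi / n \<le> pi"
    by auto
  then have "cos (pi * b / n) \<le> cos (pi / n)" "cos (pi - pi / n) \<le> cos (pi * b / n)"
    by (meson cos_monotone_0_pi_le order_trans)+
  then show ?thesis
    unfolding eq by simp
qed

lemma exists_int_shift_near:
  fixes n :: int
  assumes "n > 0"
  shows "\<exists>j::int. \<bar>\<phi> + pi * j / n\<bar> \<le> pi / (2 * n)"
proof -
  define j where "j = round (- \<phi> * n / pi)"
  have "\<bar>of_int j - (- \<phi> * n / pi)\<bar> \<le> 1 / 2"
    unfolding j_def by (rule of_int_round_abs_le)
  then have "\<bar>\<phi> * n / pi + j\<bar> * (pi / n) \<le> 1 / 2 * (pi / n)"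
    using assms by (intro mult_right_mono) (auto simp: algebra_simps)
  moreover have "\<bar>\<phi> * n / pi + j\<bar> * (pi / n) = \<bar>(\<phi> * n / pi + j) * (pi / n)\<bar>"
    using assms by (simp add: abs_mult)
  moreover have "(\<phi> * n / pi + j) * (pi / n) = \<phi> + pi * j / n"
    using assms by (simp add: field_simps)
  ultimately have "\<bar>\<phi> + pi * j / n\<bar> \<le> 1 / 2 * (pi / n)"
    by metis
  then show ?thesis
    by (intro exI[of _ j]) simp
qed

lemma exists_int_shift_floor:
  fixes n :: int
  assumes "n > 0"
  shows "\<exists>j::int. \<psi> \<le> \<phi> + pi * j / n \<and> \<phi> + pi * j / n < \<psi> + pi / n"
proof -
  define j where "j = \<lceil>(\<psi> - \<phi>) * n / pi\<rceil>"
  have "(\<psi> - \<phi>) * n / pi \<le> j" "j < (\<psi> - \<phi>) * n / pi + 1"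
    unfolding j_def by linarith+
  then have "\<psi> - \<phi> \<le> j * (pi / n)" "j * (pi / n) < (\<psi> - \<phi>) + pi / n"
    using assms by (simp_all add: field_simps)
  then show ?thesis
    by (intro exI[of _ j]) (simp add: mult.commute)
qed

text \<open>The angle is taken in units of pi, and \<open>a\<close> may be any integer coprime to
  \<open>n\<close>, so x and -x share their denominator. The weight 0 has denominator 2, the weights
  2 and -2 have denominator 1.\<close>

definition denominator :: "real \<Rightarrow> int \<Rightarrow> bool" where
  "denominator x n \<longleftrightarrow> n > 0 \<and> (\<exists>a. coprime a n \<and> x = 2 * cos (pi * real_of_int a / real_of_int n))"

lemma denominatorE:
  assumes "denominator x n"
  obtains a where "n > 0" "coprime a n" "x = 2 * cos (pi * real_of_int a / real_of_int n)"
  using assms by (auto simp: denominator_def)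

lemma exists_denominator:
  assumes "x = 2 * cos (pi * real_of_int a / real_of_int n)" "n > 0"
  shows "\<exists>m. denominator x m \<and> m dvd n"
proof -
  define g where "g = gcd a n"
  have g: "g > 0"
    using assms(2) by (simp add: g_def)
  obtain b m where b: "a = b * g" "n = m * g" "coprime b m"
    using gcd_coprime_exists[of a n] g unfolding g_def by auto
  have "m > 0"
    using b g assms(2) by (simp add: zero_less_mult_iff)
  moreover have "x = 2 * cos (pi * real_of_int b / real_of_int m)"
    using g by (simp add: assms(1) b)
  ultimately show ?thesis
    using b by (auto simp: denominator_def)
qed

text \<open>Equal cosines have angles equal up to sign and multiples of 2 pi. Clearing denominators
  gives n | a m, hence n | m by coprimality, and the situation is symmetric.\<close>

lemma denominator_unique:
  assumes "denominator x n" "denominator x m"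
  shows "n = m"
proof -
  have *: "n dvd m" if n: "n > 0" "coprime a n" and m: "m > 0" "coprime b m"
    and eq: "cos (pi * real_of_int a / n) = cos (pi * real_of_int b / m)" for a b n m :: int
  proof -
    obtain k where k: "k \<in> \<int>" "pi * real_of_int a / n = pi * real_of_int b / m + 2 * k * pi
        \<or> pi * real_of_int a / n = - (pi * real_of_int b / m) + 2 * k * pi"
      using eq unfolding cos_eq by auto
    obtain l :: int where l: "k = of_int l"
      using k(1) by (auto elim: Ints_cases)
    have 0: "pi \<noteq> 0" by simp
    from k(2) have "real_of_int (a * m) = real_of_int (n * (b + 2 * l * m))
        \<or> real_of_int (a * m) = real_of_int (n * (- b + 2 * l * m))"
    proof (elim disjE)
      assume "pi * real_of_int a / n = pi * real_of_int b / m + 2 * k * pi"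
      then have "pi * (a / n) = pi * (b / m + 2 * k)"
        by (simp add: algebra_simps)
      then have "a / n = b / m + 2 * k"
        using 0 mult_left_cancel by blast
      then show ?thesis
        using n m by (simp add: l field_simps)
    next
      assume "pi * real_of_int a / n = - (pi * real_of_int b / m) + 2 * k * pi"
      then have "pi * (a / n) = pi * (- (b / m) + 2 * k)"
        by (simp add: algebra_simps)
      then have "a / n = - (b / m) + 2 * k"
        using 0 mult_left_cancel by blast
      then show ?thesis
        using n m by (simp add: l field_simps)
    qed
    then have "n dvd a * m"
      by (metis dvd_triv_left of_int_eq_iff)
    then show ?thesis
      using n(2) by (metis coprime_commute coprime_dvd_mult_right_iff)
  qed
  obtain a b where "n > 0" "coprime a n" "m > 0" "coprime b m"
    "cos (pi * real_of_int a / n) = cos (pi * real_of_int b / m)"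
    using assms by (auto simp: denominator_def)
  then have "n dvd m" "m dvd n"
    using *[of n a m b] *[of m b n a] by auto
  then show ?thesis
    using assms by (simp add: denominator_def zdvd_antisym_nonneg)
qed

lemma denominator_minus: "denominator x n \<Longrightarrow> denominator (- x) n"
proof -
  assume "denominator x n"
  then obtain a where a: "n > 0" "coprime a n" "x = 2 * cos (pi * real_of_int a / real_of_int n)"
    by (rule denominatorE)
  have "pi * real_of_int (a + n) / n = pi * real_of_int a / n + pi * of_int 1"
    using a(1) by (simp add: field_simps)
  then have "- x = 2 * cos (pi * real_of_int (a + n) / n)"
    by (simp only: cos_add_int_pi) (simp add: a(3))
  moreover have "coprime (a + n) n"
    using a(2) by (metis coprime_iff_gcd_eq_1 gcd_add1)
  ultimately show ?thesis
    using a(1) by (auto simp: denominator_def)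
qed

section \<open>Vieta sequences and finite Vieta systems\<close>

fun vieta_seq :: "real \<Rightarrow> real \<Rightarrow> real \<Rightarrow> nat \<Rightarrow> real" where
  "vieta_seq x y z 0 = y"
| "vieta_seq x y z (Suc 0) = z"
| "vieta_seq x y z (Suc (Suc k)) = x * vieta_seq x y z (Suc k) - vieta_seq x y z k"

text \<open>Stated without reference to quivers, because the Galois conjugate of a system is again a
  system although no quiver needs to stand behind it.\<close>

locale vieta_system =
  fixes S :: "(real \<times> real \<times> real) set" and C :: real
  assumes finite_S: "finite S"
    and rotate: "(x, y, z) \<in> S \<Longrightarrow> (y, z, x) \<in> S"
    and swap: "(x, y, z) \<in> S \<Longrightarrow> (x, z, y) \<in> S"
    and neg: "(x, y, z) \<in> S \<Longrightarrow> (x, - y, - z) \<in> S"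
    and move: "(x, y, z) \<in> S \<Longrightarrow> (x, z, x * z - y) \<in> S"
    and conn: "(x, y, z) \<in> S \<Longrightarrow> y \<noteq> 0 \<or> z \<noteq> 0"
    and markov: "(x, y, z) \<in> S \<Longrightarrow> x\<^sup>2 + y\<^sup>2 + z\<^sup>2 - x * y * z = C"
begin

lemma neg': "(x, y, z) \<in> S \<Longrightarrow> (- x, y, - z) \<in> S"
  by (rule rotate[OF rotate[OF neg[OF rotate]]])

lemma vieta_seq_in: "(x, y, z) \<in> S \<Longrightarrow> (x, vieta_seq x y z k, vieta_seq x y z (Suc k)) \<in> S"
  by (induction k) (auto dest: move)

lemma vieta_seq_recurs:
  assumes "(x, y, z) \<in> S"
  obtains i d where "d > 0" "vieta_seq x y z (i + d) = vieta_seq x y z i"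
    "vieta_seq x y z (Suc (i + d)) = vieta_seq x y z (Suc i)"
proof -
  let ?f = "\<lambda>k. (x, vieta_seq x y z k, vieta_seq x y z (Suc k))"
  have "\<not> inj ?f"
  proof
    assume "inj ?f"
    then have "infinite (range ?f)"
      by (rule range_inj_infinite)
    moreover have "range ?f \<subseteq> S"
      using vieta_seq_in[OF assms] by auto
    ultimately show False
      using finite_S finite_subset by blast
  qed
  then obtain i j where "i < j" "?f i = ?f j"
    by (metis (no_types, lifting) injI linorder_neqE_nat)
  then show ?thesis
    using that[of "j - i" i] by auto
qed

text \<open>For a and b with a + b = x and ab = 1, the combination u(k+1) - a u(k) of the Vieta
  sequence is geometric with ratio b. The sequence recurs, so b is a root of unity unless the
  combination vanishes, and x = b + 1/b.\<close>

lemma entry_denominator: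
  assumes "(x, y, z) \<in> S"
  shows "\<exists>n. denominator x n"
proof -
  define l :: complex where "l = (x + csqrt (x\<^sup>2 - 4)) / 2"
  define l' :: complex where "l' = (x - csqrt (x\<^sup>2 - 4)) / 2"
  have "l * l' = (x\<^sup>2 - (csqrt (x\<^sup>2 - 4))\<^sup>2) / 4"
    by (simp add: l_def l'_def field_simps power2_eq_square)
  then have ll: "l + l' = x" "l * l' = 1"
    by (simp_all add: l_def l'_def field_simps)
  let ?u = "\<lambda>k. complex_of_real (vieta_seq x y z k)"
  have rec: "?u (Suc (Suc k)) = (a + b) * ?u (Suc k) - ?u k" if "a + b = complex_of_real x" for a b :: complex and k
    by (simp add: that)
  obtain i d where d: "d > 0" "?u (i + d) = ?u i" "?u (Suc (i + d)) = ?u (Suc i)"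
    using vieta_seq_recurs[OF assms] by metis
  have root: "b ^ d = 1" if ab: "a + b = x" "a * b = 1" and nz: "complex_of_real z \<noteq> a * y" for a b :: complex
  proof -
    define v where "v = z - a * y"
    have v: "?u (Suc k) - a * ?u k = b ^ k * v" for k
    proof (induction k)
      case (Suc k)
      have "?u (Suc (Suc k)) - a * ?u (Suc k) = b * ?u (Suc k) - (a * b) * ?u k"
        by (simp only: rec[OF ab(1)] ab(2)) (simp add: algebra_simps)
      also have "\<dots> = b * (?u (Suc k) - a * ?u k)"
        by (simp only: right_diff_distrib mult_ac)
      finally show ?case
        by (simp only: Suc power_Suc mult.assoc)
    qed (simp add: v_def)
    have "b ^ (i + d) * v = b ^ i * v"
      by (simp only: v[symmetric] d)
    moreover have "v \<noteq> 0" "b \<noteq> 0"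
      using nz ab(2) by (auto simp: v_def)
    ultimately show ?thesis
      by (simp add: power_add)
  qed
  have "\<exists>a b. a + b = complex_of_real x \<and> a * b = 1 \<and> (\<exists>d>0. b ^ d = 1)"
  proof (cases "complex_of_real z \<noteq> l * y \<or> complex_of_real z \<noteq> l' * y")
    case True
    then show ?thesis
      using root[of l l'] root[of l' l] ll d(1) by (metis add.commute mult.commute)
  next
    case False
    \<comment> \<open>If both combinations vanish, then y is nonzero by \<open>conn\<close>, so the
      roots coincide and their square is their product 1.\<close>
    then have "(l - l') * y = 0"
      by (simp add: algebra_simps)
    moreover have "complex_of_real y \<noteq> 0"
      using False conn[OF assms] by auto
    ultimately have "l = l'"
      by simp
    then have "l' ^ 2 = 1"
      using ll(2) by (simp add: power2_eq_square)
    then show ?thesis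
      using ll by (intro exI[of _ l] exI[of _ l']) (auto intro!: exI[of _ 2])
  qed
  then obtain a b :: complex and e where ab: "a + b = x" "a * b = 1" "e > 0" "b ^ e = 1"
    by blast
  then have "b \<in> (\<lambda>k. cis (2 * pi * real k / real e)) ` {..<e}"
    using Complex.bij_betw_roots_unity[OF ab(3)] by (auto simp: bij_betw_def)
  then obtain k where k: "b = cis (2 * pi * real k / real e)"
    by blast
  have "a = a * (b * inverse b)"
    using ab(2) by (cases "b = 0") simp_all
  then have "a = inverse b"
    using ab(2) by (simp flip: mult.assoc)
  then have "a = cis (- (2 * pi * real k / real e))"
    by (simp add: k)
  then have "x = 2 * cos (pi * real_of_int (2 * int k) / real_of_int (int e))"
    using arg_cong[OF ab(1), of Re] by (simp add: k algebra_simps)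
  then show ?thesis
    using exists_denominator ab(3) by (metis of_nat_0_less_iff)
qed

text \<open>The sequence is R cos (phi + k theta) with theta = pi a/n. Since \<open>a\<close> is
  invertible modulo n, the multiples of theta reach every multiple of pi/n modulo pi, and a shift by
  pi is a sign change absorbed by \<open>neg\<close>. The relation between R and C is the invariant
  ellipse.\<close>

lemma rotation:
  fixes a n :: int
  assumes S: "(x, y, z) \<in> S" and x: "x = 2 * cos (pi * a / n)" and n: "n > 1" "coprime a n"
  obtains R \<phi> where "R \<ge> 0" "R\<^sup>2 * (4 - x\<^sup>2) = 4 * (C - x\<^sup>2)" "y = R * cos \<phi>"
    "\<And>j::int. (x, R * cos (\<phi> + pi * j / n), R * cos (\<phi> + pi * real_of_int (j + a) / n)) \<in> S"
proof -
  define \<theta> where "\<theta> = pi * a / n"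
  have s: "sin \<theta> \<noteq> 0"
  proof
    assume "sin \<theta> = 0"
    then obtain i :: int where "\<theta> = i * pi"
      using sin_zero_iff_int2 by auto
    then have "real_of_int a = real_of_int (i * n)"
      using n by (simp add: \<theta>_def field_simps)
    then have "n dvd a"
      by (metis dvd_triv_right of_int_eq_iff)
    then show False
      using n coprime_common_divisor[of a n n] by auto
  qed
  \<comment> \<open>Chosen so that y cos theta - B sin theta = z, which makes the next term of the
    sequence correct.\<close>
  define B where "B = (y * cos \<theta> - z) / sin \<theta>"
  define R where "R = sqrt (y\<^sup>2 + B\<^sup>2)"
  obtain \<phi> where \<phi>: "y = R * cos \<phi>" "B = R * sin \<phi>"
  proof (cases "R = 0")
    case True
    then have "y = 0" "B = 0"
      by (auto simp: R_def sum_power2_eq_zero_iff)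
    then show ?thesis using that[of 0] True by simp
  next
    case False
    have "R\<^sup>2 = y\<^sup>2 + B\<^sup>2"
      by (simp add: R_def)
    moreover have "R\<^sup>2 \<noteq> 0"
      using False by simp
    ultimately have "(y / R)\<^sup>2 + (B / R)\<^sup>2 = 1"
      by (metis add_divide_distrib divide_self power_divide)
    then obtain \<phi> where "y / R = cos \<phi>" "B / R = sin \<phi>"
      using sincos_total_2pi by metis
    then show ?thesis
      using that[of \<phi>] False by (simp add: field_simps)
  qed
  have seq: "vieta_seq x y z k = R * cos (\<phi> + real k * \<theta>)
      \<and> vieta_seq x y z (Suc k) = R * cos (\<phi> + real (Suc k) * \<theta>)" for k
  proof (induction k)
    case 0
    have "R * cos (\<phi> + \<theta>) = y * cos \<theta> - B * sin \<theta>"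
      by (simp add: cos_add \<phi> algebra_simps)
    also have "\<dots> = z"
      using s by (simp add: B_def)
    finally show ?case by (simp add: \<phi>(1))
  next
    case (Suc k)
    define t where "t = \<phi> + real (Suc k) * \<theta>"
    have t: "\<phi> + real k * \<theta> = t - \<theta>" "\<phi> + real (Suc (Suc k)) * \<theta> = t + \<theta>"
      by (simp_all add: t_def algebra_simps)
    have "vieta_seq x y z k = R * cos (t - \<theta>)" "vieta_seq x y z (Suc k) = R * cos t"
      using Suc t by (simp_all only: t_def)
    then have "vieta_seq x y z (Suc (Suc k)) = 2 * cos \<theta> * (R * cos t) - R * cos (t - \<theta>)"
      by (simp add: x \<theta>_def)
    also have "\<dots> = R * cos (t + \<theta>)"
      by (simp add: cos_add cos_diff algebra_simps)
    finally show ?case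
      using Suc by (simp only: t)
  qed
  have phases: "(x, R * cos (\<phi> + pi * j / n), R * cos (\<phi> + pi * real_of_int (j + a) / n)) \<in> S" for j :: int
  proof -
    \<comment> \<open>To shift the phase by pi j/n, the rotation is iterated k times with k
      congruent to j b modulo n.\<close>
    obtain b where b: "[a * b = 1] (mod n)"
      using cong_solve_coprime_int n by blast
    define k where "k = nat ((j * b) mod n)"
    have k: "int k = (j * b) mod n"
      using n by (simp add: k_def)
    have "[int k * a = j * (a * b)] (mod n)"
      unfolding k by (simp add: cong_def mod_mult_left_eq mult.assoc mult.commute[of a])
    also have "[j * (a * b) = j * 1] (mod n)"
      by (rule cong_scalar_left[OF b])
    finally obtain t where "int k * a = j + n * t"
      by (metis cong_iff_lin cong_sym mult.right_neutral mult.commute)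
    then have "real k * a = j + n * t"
      by (metis of_int_add of_int_mult of_int_of_nat_eq)
    then have kt: "real k * \<theta> = pi * j / n + pi * t"
      using n by (simp add: \<theta>_def field_simps)
    have e1: "\<phi> + real k * \<theta> = (\<phi> + pi * j / n) + pi * t"
      by (simp add: kt)
    have e2: "\<phi> + real (Suc k) * \<theta> = (\<phi> + pi * real_of_int (j + a) / n) + pi * t"
      using kt by (simp add: \<theta>_def algebra_simps add_divide_distrib)
    have in_S: "(x, R * cos ((\<phi> + pi * j / n) + pi * t), R * cos ((\<phi> + pi * real_of_int (j + a) / n) + pi * t)) \<in> S"
      using vieta_seq_in[OF S, of k] seq[of k] unfolding e1 e2 by simp
    show ?thesis
    proof (cases "even t")
      case True
      then show ?thesis
        using in_S by (simp only: cos_add_int_pi if_True)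
    next
      case False
      then show ?thesis
        using neg[OF in_S] by (simp only: cos_add_int_pi if_False) simp
    qed
  qed
  have "B * sin \<theta> = y * cos \<theta> - z"
    using s by (simp add: B_def)
  then have "R\<^sup>2 * (sin \<theta>)\<^sup>2 = y\<^sup>2 * (sin \<theta>)\<^sup>2 + (y * cos \<theta> - z)\<^sup>2"
    by (simp add: R_def distrib_right flip: power_mult_distrib)
  also have "\<dots> = y\<^sup>2 + z\<^sup>2 - (2 * cos \<theta>) * y * z"
    using sin_cos_squared_add[of \<theta>] by algebra
  also have "\<dots> = C - x\<^sup>2"
    using markov[OF S] by (simp add: x \<theta>_def)
  finally have "R\<^sup>2 * (4 - x\<^sup>2) = 4 * (C - x\<^sup>2)"
    by (simp add: x \<theta>_def[symmetric] sin_squared_eq power_mult_distrib algebra_simps)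
  moreover have "R \<ge> 0"
    by (simp add: R_def)
  ultimately show ?thesis
    using that[of R \<phi>] phases \<phi>(1) by blast
qed

lemma entry_abs_le_2:
  assumes "(x, y, z) \<in> S"
  shows "\<bar>x\<bar> \<le> 2"
proof -
  obtain t where "x = 2 * cos t"
    using entry_denominator[OF assms] by (auto simp: denominator_def)
  then show ?thesis
    using abs_cos_le_one[of t] by (simp add: abs_mult)
qed

text \<open>For x = 2 the Vieta recurrence produces an arithmetic progression, which takes finitely
  many values only if it is constant.\<close>

lemma markov_eq_4_of_entry_2:
  assumes "(2, y, z) \<in> S"
  shows "C = 4" "y = z"
proof -
  have seq: "vieta_seq 2 y z k = y + real k * (z - y) \<and> vieta_seq 2 y z (Suc k) = y + real (Suc k) * (z - y)" for k
    by (induction k) (auto simp: algebra_simps)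
  obtain i d where "d > 0" "vieta_seq 2 y z (i + d) = vieta_seq 2 y z i"
    using vieta_seq_recurs[OF assms] by metis
  then show "y = z"
    using seq[of "i + d"] seq[of i] by (simp add: algebra_simps)
  then show "C = 4"
    using markov[OF assms] by (simp add: power2_eq_square)
qed

lemma markov_eq_4_of_abs_entry_2:
  assumes "(x, y, z) \<in> S" "\<bar>x\<bar> = 2"
  shows "C = 4"
proof (cases "x = 2")
  case True
  then show ?thesis
    using assms markov_eq_4_of_entry_2(1) by blast
next
  case False
  then have "- x = 2"
    using assms(2) by linarith
  then show ?thesis
    using markov_eq_4_of_entry_2(1) neg'[OF assms(1)] by metis
qed

text \<open>If C > 4, rotation about the largest weight m, of denominator n, has amplitude R > 2.
  Some phase lies within pi/(2n) of 0 and gives a weight above 2 cos (pi/(2n)) >= 2 cos (pi/n) >=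
  m.\<close>

lemma markov_le_4:
  assumes "S \<noteq> {}"
  shows "C \<le> 4"
proof (rule ccontr)
  assume "\<not> C \<le> 4"
  then have C: "C > 4" by simp
  define m where "m = Max (fst ` S)"
  have fin: "finite (fst ` S)"
    using finite_S by simp
  have m: "m \<in> fst ` S"
    unfolding m_def by (rule Max_in) (use fin assms in auto)
  have max: "x \<le> m" if "(x, y, z) \<in> S" for x y z
    unfolding m_def by (rule Max_ge[OF fin]) (use that in force)
  obtain y z where myz: "(m, y, z) \<in> S"
    using m by auto
  have "m > 0"
  proof (cases "y = 0")
    case False
    then show ?thesis
      using max[OF rotate[OF myz]] max[OF neg'[OF rotate[OF myz]]] by linarith
  next
    case True
    then have "z \<noteq> 0" using conn[OF myz] by simp
    then show ?thesis
      using max[OF rotate[OF rotate[OF myz]]] max[OF neg'[OF rotate[OF rotate[OF myz]]]] by linarith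
  qed
  have m2: "\<bar>m\<bar> \<noteq> 2"
    using markov_eq_4_of_abs_entry_2[OF myz] C by auto
  obtain n where "denominator m n"
    using entry_denominator[OF myz] by blast
  then obtain a where a: "n > 0" "coprime a n" "m = 2 * cos (pi * real_of_int a / n)"
    by (rule denominatorE)
  have "n \<noteq> 1"
    using m2 a(3) by (auto simp: cos_npi_int split: if_splits)
  then have n: "n > 1" using a(1) by simp
  then have "\<not> n dvd a"
    using a(2) coprime_common_divisor[of a n n] by auto
  then have m_le: "m \<le> 2 * cos (pi / n)"
    using abs_cos_rational_le[OF a(1), of a] a(3) by linarith
  obtain R \<phi> where R: "R \<ge> 0" "R\<^sup>2 * (4 - m\<^sup>2) = 4 * (C - m\<^sup>2)"
    and phases: "\<And>j::int. (m, R * cos (\<phi> + pi * j / n), R * cos (\<phi> + pi * real_of_int (j + a) / n)) \<in> S"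
    using rotation[OF myz a(3) n a(2)] by metis
  have "m < 2"
    using entry_abs_le_2[OF myz] m2 by simp
  then have "m\<^sup>2 < 2\<^sup>2"
    using \<open>m > 0\<close> by (intro power_strict_mono) auto
  then have "m\<^sup>2 < 4"
    by simp
  then have "R > 2"
  proof -
    have "2\<^sup>2 * (4 - m\<^sup>2) < R\<^sup>2 * (4 - m\<^sup>2)"
      unfolding R(2) using C by simp
    then have "2\<^sup>2 < R\<^sup>2"
      by (rule mult_right_less_imp_less) (use \<open>m\<^sup>2 < 4\<close> in simp)
    then show ?thesis
      by (rule power2_less_imp_less) (rule R(1))
  qed
  obtain j :: int where j: "\<bar>\<phi> + pi * j / n\<bar> \<le> pi / (2 * n)"
    using exists_int_shift_near[OF a(1)] by blast
  have n2: "real_of_int n \<ge> 2"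
    using n by linarith
  have pn: "pi / (2 * n) \<le> pi / 4"
    using n2 by (intro divide_left_mono) auto
  have c: "cos (pi / (2 * n)) \<le> cos (\<phi> + pi * j / n)"
    using j pn cos_monotone_0_pi_le[of "\<bar>\<phi> + pi * j / n\<bar>" "pi / (2 * n)"] by auto
  have "cos (pi / n) \<le> cos (pi / (2 * n))"
    using n2 by (intro cos_monotone_0_pi_le) (auto simp: field_simps)
  moreover have "cos (pi / (2 * n)) > 0"
    using pn n2 by (intro cos_gt_zero) (auto simp: field_simps)
  ultimately have "cos (pi / n) \<le> cos (pi / (2 * n))" "cos (pi / (2 * n)) > 0"
    by simp_all
  then have "m < R * cos (\<phi> + pi * j / n)"
  proof -
    have "2 * cos (pi / (2 * n)) < R * cos (pi / (2 * n))"
      using \<open>R > 2\<close> \<open>cos (pi / (2 * n)) > 0\<close> by simp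
    also have "\<dots> \<le> R * cos (\<phi> + pi * j / n)"
      using c R(1) by (rule mult_left_mono)
    finally show ?thesis
      using m_le \<open>cos (pi / n) \<le> cos (pi / (2 * n))\<close> by linarith
  qed
  then show False
    using max[OF rotate[OF phases[of j]]] by simp
qed

end

section \<open>Galois conjugates of a finite system\<close>

lemma abs_sin_rational_ge:
  fixes i n r :: int
  assumes "n > 0" "0 \<le> r" "r \<le> i mod n" "i mod n \<le> n - r"
  shows "sin (pi * r / n) \<le> \<bar>sin (pi * i / n)\<bar>"
proof -
  define b where "b = i mod n"
  have rb: "r \<le> b" "b \<le> n - r"
    using assms(3,4) by (simp_all only: b_def)
  have "i = b + n * (i div n)"
    by (simp add: b_def)
  then have "real_of_int i = real_of_int (b + n * (i div n))"
    by (rule arg_cong)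
  then have "pi * i / n = pi * b / n + pi * of_int (i div n)"
    using assms(1) by (simp add: field_simps)
  then have eq: "\<bar>sin (pi * i / n)\<bar> = \<bar>sin (pi * b / n)\<bar>"
    by (simp only: abs_sin_add_int_pi)
  have n: "real_of_int n > 0"
    using assms(1) by simp
  have mono: "sin (pi * r / n) \<le> sin (pi * s / n)" if "r \<le> s" "2 * s \<le> n" for s :: int
  proof (rule sin_monotone_2pi_le)
    have "real_of_int (2 * s) \<le> real_of_int n"
      using that(2) by (simp only: of_int_le_iff)
    then have "real_of_int s / n \<le> 1 / 2"
      using n by (simp add: pos_divide_le_eq)
    then have "pi * (real_of_int s / n) \<le> pi * (1 / 2)"
      by (rule mult_left_mono) simp
    then show "pi * s / n \<le> pi / 2"
      by simp
    have "0 \<le> pi * r / n"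
      using n assms(2) by simp
    then show "- (pi / 2) \<le> pi * r / n"
      using pi_gt_zero by linarith
    have "real_of_int r / n \<le> real_of_int s / n"
      by (rule divide_right_mono) (use n that(1) in simp_all)
    then have "pi * (real_of_int r / n) \<le> pi * (real_of_int s / n)"
      by (rule mult_left_mono) simp
    then show "pi * r / n \<le> pi * s / n"
      by simp
  qed
  show ?thesis
  proof (cases "2 * b \<le> n")
    case True
    show ?thesis
      unfolding eq using mono[OF rb(1) True] by linarith
  next
    case False
    have "pi * b / n = pi - pi * real_of_int (n - b) / n"
      using n by (simp add: diff_divide_distrib right_diff_distrib)
    then have "sin (pi * b / n) = sin (pi * real_of_int (n - b) / n)"
      by (simp only: sin_pi_minus)
    moreover have "r \<le> n - b"
      using rb(2) by linarith
    moreover have "2 * (n - b) \<le> n"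
      using False by (simp add: algebra_simps)
    ultimately show ?thesis
      unfolding eq using mono[of "n - b"] by linarith
  qed
qed

text \<open>To \<open>b\<close> one adds D times the product of the primes dividing M but not b.
  Each prime divisor of M then divides exactly one of the two summands. Thus a conjugation
  prescribed modulo D extends to M-th roots of unity.\<close>

lemma exists_coprime_lift:
  fixes b D M :: nat
  assumes "coprime b D" "D > 0" "M > 0"
  shows "\<exists>k>0. [k = b] (mod D) \<and> coprime k M"
proof -
  define A where "A = {p. prime p \<and> p dvd M \<and> \<not> p dvd b}"
  have fin: "finite A"
    by (rule finite_subset[of _ "{..M}"]) (use assms(3) in \<open>auto simp: A_def dvd_imp_le\<close>)
  have A_pos: "\<Prod>A > 0"
    by (intro prod_pos) (auto simp: A_def prime_gt_0_nat)
  define k where "k = b + D * \<Prod>A"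
  have "k > 0"
    using assms(2) A_pos by (simp add: k_def)
  moreover have "[k = b] (mod D)"
    by (simp add: k_def cong_def)
  moreover have "coprime k M"
  proof (rule ccontr)
    assume "\<not> coprime k M"
    then have "gcd k M \<noteq> 1"
      by (simp add: coprime_iff_gcd_eq_1)
    then obtain p where p: "prime p" "p dvd gcd k M"
      using prime_factor_nat by blast
    then have p: "prime p" "p dvd k" "p dvd M"
      by auto
    show False
    proof (cases "p dvd b")
      case True
      then have "p dvd D * \<Prod>A"
        using p(2) by (simp add: k_def dvd_add_right_iff)
      moreover have "\<not> p dvd D"
        using True assms(1) p(1) coprime_common_divisor[of b D p] by auto
      ultimately have "p dvd \<Prod>A"
        using p(1) prime_dvd_mult_iff by blast
      then obtain q where "q \<in> A" "p dvd q"
        using prime_dvd_prod_iff[OF fin p(1), of id] by auto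
      then have "p = q"
        using p(1) primes_dvd_imp_eq by (auto simp: A_def)
      then have "p \<in> A"
        using \<open>q \<in> A\<close> by simp
      then show False
        using True by (simp add: A_def)
    next
      case False
      then have "p \<in> A"
        using p by (simp add: A_def)
      then have "p dvd \<Prod>A"
        using fin dvd_prod_eqI[of A p p id] by simp
      then show False
        using False p(2) by (simp add: k_def dvd_add_left_iff)
    qed
  qed
  ultimately show ?thesis by blast
qed

text \<open>Graph of the Galois automorphism zeta -> zeta^k on the real elements of Z[zeta], where
  zeta = cis (2 pi/M). A relation avoids choosing a representing polynomial; for k coprime to M it
  is single-valued and injective by \<open>conj_rel_unique\<close>.\<close>

definition conj_rel :: "nat \<Rightarrow> nat \<Rightarrow> real \<Rightarrow> real \<Rightarrow> bool" where
  "conj_rel M k u v \<longleftrightarrow> (\<exists>p. complex_of_real u = ipoly p (cis (2 * pi / M)) \<and>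
     complex_of_real v = ipoly p (cis (2 * pi / M) ^ k))"

lemma conj_relE:
  assumes "conj_rel M k u v"
  obtains p where "complex_of_real u = ipoly p (cis (2 * pi / M))"
    "complex_of_real v = ipoly p (cis (2 * pi / M) ^ k)"
  using assms unfolding conj_rel_def by blast

lemma conj_relI:
  assumes "complex_of_real u = ipoly p (cis (2 * pi / M))"
    "complex_of_real v = ipoly p (cis (2 * pi / M) ^ k)"
  shows "conj_rel M k u v"
  using assms unfolding conj_rel_def by blast

lemma conj_rel_of_int: "conj_rel M k (of_int c) (of_int c)"
  by (rule conj_relI[of _ "of_int c"]) simp_all

lemma conj_rel_add:
  assumes "conj_rel M k u v" "conj_rel M k u' v'"
  shows "conj_rel M k (u + u') (v + v')"
proof -
  obtain p where p: "complex_of_real u = ipoly p (cis (2 * pi / M))"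
    "complex_of_real v = ipoly p (cis (2 * pi / M) ^ k)"
    using assms(1) by (rule conj_relE)
  obtain q where q: "complex_of_real u' = ipoly q (cis (2 * pi / M))"
    "complex_of_real v' = ipoly q (cis (2 * pi / M) ^ k)"
    using assms(2) by (rule conj_relE)
  show ?thesis
    by (rule conj_relI[of _ "p + q"]) (simp_all add: p q)
qed

lemma conj_rel_mult:
  assumes "conj_rel M k u v" "conj_rel M k u' v'"
  shows "conj_rel M k (u * u') (v * v')"
proof -
  obtain p where p: "complex_of_real u = ipoly p (cis (2 * pi / M))"
    "complex_of_real v = ipoly p (cis (2 * pi / M) ^ k)"
    using assms(1) by (rule conj_relE)
  obtain q where q: "complex_of_real u' = ipoly q (cis (2 * pi / M))"
    "complex_of_real v' = ipoly q (cis (2 * pi / M) ^ k)"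
    using assms(2) by (rule conj_relE)
  show ?thesis
    by (rule conj_relI[of _ "p * q"]) (simp_all add: p q)
qed

lemma conj_rel_minus: "conj_rel M k u v \<Longrightarrow> conj_rel M k (- u) (- v)"
  using conj_rel_mult[OF conj_rel_of_int[of M k "-1"], of u v] by simp

lemma conj_rel_diff:
  assumes "conj_rel M k u v" "conj_rel M k u' v'"
  shows "conj_rel M k (u - u') (v - v')"
  using conj_rel_add[OF assms(1) conj_rel_minus[OF assms(2)]] by simp

lemma conj_rel_zero_iff:
  assumes "conj_rel M k u v" "M > 0" "k > 0" "coprime k M"
  shows "u = 0 \<longleftrightarrow> v = 0"
proof -
  obtain p where p: "complex_of_real u = ipoly p (cis (2 * pi / M))"
    "complex_of_real v = ipoly p (cis (2 * pi / M) ^ k)"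
    using assms(1) by (rule conj_relE)
  have "cis (2 * pi / M) ^ M = 1"
    using assms(2) by (simp add: Complex.DeMoivre)
  then have "ipoly p (cis (2 * pi / M) ^ k) = 0 \<longleftrightarrow> ipoly p (cis (2 * pi / M)) = 0"
    by (rule ipoly_root_of_unity_power_iff[OF assms(3,2) _ assms(4)])
  then show ?thesis
    unfolding p[symmetric] of_real_eq_0_iff by blast
qed

lemma conj_rel_unique:
  assumes "conj_rel M k u v" "conj_rel M k u' v'" "M > 0" "k > 0" "coprime k M"
  shows "u = u' \<longleftrightarrow> v = v'"
  using conj_rel_zero_iff[OF conj_rel_diff[OF assms(1,2)] assms(3-5)] by simp

lemma conj_rel_cos:
  fixes a n :: int
  assumes "n > 0" "2 * n dvd int M" "M > 0"
  shows "conj_rel M k (2 * cos (pi * a / n)) (2 * cos (pi * real_of_int (a * k) / n))"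
proof -
  obtain t where t: "int M = 2 * n * t"
    using assms(2) by (elim dvdE)
  \<comment> \<open>The sum zeta^(at) + zeta^(-at) needs a negative exponent; exponents are
    therefore reduced modulo M.\<close>
  define e where "e c = nat (c mod int M)" for c :: int
  have cis_e: "cis (2 * pi / M) ^ e c = cis (2 * pi * c / M)" for c :: int
  proof -
    have "int (e c) = c mod int M"
      using assms(3) by (simp add: e_def)
    then have "c = int (e c) + int M * (c div int M)"
      by simp
    then have "real_of_int c = real_of_int (int (e c) + int M * (c div int M))"
      by (rule arg_cong)
    then have "2 * pi * c / M = real (e c) * (2 * pi / M) + 2 * pi * of_int (c div int M)"
      using assms(3) by (simp add: field_simps)
    then have "cis (2 * pi * c / M) = cis (real (e c) * (2 * pi / M)) * cis (2 * pi * of_int (c div int M))"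
      by (simp only: cis_mult)
    also have "cis (2 * pi * of_int (c div int M)) = 1"
      by (simp add: cis_conv_exp exp_eq_1 mult.commute mult.left_commute)
    finally show ?thesis
      by (simp only: Complex.DeMoivre mult_1_right)
  qed
  have tM: "real_of_int t / real M = 1 / (2 * n)" "t \<noteq> 0"
  proof -
    have "real_of_int (int M) = real_of_int (2 * n * t)"
      by (simp only: t)
    moreover show "t \<noteq> 0"
      using t assms(3) by auto
    ultimately show "real_of_int t / real M = 1 / (2 * n)"
      using assms(1,3) by (simp add: field_simps)
  qed
  have ang: "2 * pi * real_of_int (c * t) / real M = pi * c / n" for c :: int
  proof -
    have "2 * pi * real_of_int (c * t) / real M = 2 * pi * c * (real_of_int t / real M)"
      by simp
    then show ?thesis
      by (simp add: tM(1))
  qed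
  have two_cos: "complex_of_real (2 * cos s) = cis s + cis (- s)" for s
    by (simp add: complex_eq_iff)
  show ?thesis
  proof (rule conj_relI)
    show "complex_of_real (2 * cos (pi * a / n))
        = ipoly (monom 1 (e (a * t)) + monom 1 (e (- a * t))) (cis (2 * pi / M))"
      unfolding two_cos ipoly_add ipoly_monom cis_e ang by simp
    have pw: "(cis (2 * pi / M) ^ k) ^ e (c * t) = cis (pi * real_of_int (c * k) / n)" for c :: int
    proof -
      have "(cis (2 * pi / M) ^ k) ^ e (c * t) = (cis (2 * pi / M) ^ e (c * t)) ^ k"
        by (simp add: mult.commute flip: power_mult)
      also have "\<dots> = cis (pi * real_of_int (c * k) / n)"
        unfolding cis_e ang by (simp add: Complex.DeMoivre mult.commute mult.left_commute)
      finally show ?thesis .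
    qed
    show "complex_of_real (2 * cos (pi * real_of_int (a * k) / n))
        = ipoly (monom 1 (e (a * t)) + monom 1 (e (- a * t))) (cis (2 * pi / M) ^ k)"
      unfolding two_cos ipoly_add ipoly_monom pw by simp
  qed
qed

definition vieta_conj :: "nat \<Rightarrow> nat \<Rightarrow> (real \<times> real \<times> real) set \<Rightarrow> (real \<times> real \<times> real) set" where
  "vieta_conj M k S = {(x', y', z'). \<exists>x y z. (x, y, z) \<in> S \<and>
     conj_rel M k x x' \<and> conj_rel M k y y' \<and> conj_rel M k z z'}"

text \<open>Divisibility by 2n makes a weight of denominator n a sum of M-th roots of unity. The
  bound \<open>D\<close> is carried along because conjugation preserves denominators.\<close>

definition common_denominator :: "nat \<Rightarrow> int \<Rightarrow> (real \<times> real \<times> real) set \<Rightarrow> bool" where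
  "common_denominator M D S \<longleftrightarrow>
     (\<forall>x y z n. (x, y, z) \<in> S \<longrightarrow> denominator x n \<longrightarrow> 2 * n dvd int M \<and> n \<le> D)"

context vieta_system begin

lemma conj_rel_exists:
  assumes "(x, y, z) \<in> S" "common_denominator M D S" "M > 0"
  shows "\<exists>x'. conj_rel M k x x'"
proof -
  obtain n where n: "denominator x n"
    using entry_denominator[OF assms(1)] by blast
  then obtain a where "n > 0" "x = 2 * cos (pi * real_of_int a / real_of_int n)"
    by (auto simp: denominator_def)
  then show ?thesis
    using conj_rel_cos[of n M k a] n assms unfolding common_denominator_def by blast
qed

lemma vieta_conj_exists:
  assumes "(x, y, z) \<in> S" "common_denominator M D S" "M > 0" "conj_rel M k x x'" "conj_rel M k y y'"
  shows "\<exists>z'. (x', y', z') \<in> vieta_conj M k S"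
  using assms conj_rel_exists[OF rotate[OF rotate[OF assms(1)]] assms(2,3)]
  unfolding vieta_conj_def by blast

text \<open>The moves and the Markov equation are integer polynomials in the entries, so they
  commute with conjugation; injectivity keeps nonzero entries nonzero. Denominators survive because
  k is coprime to them, and the integer 4 is its own conjugate.\<close>

lemma vieta_system_conj:
  assumes M: "M > 0" "common_denominator M D S" and k: "k > 0" "coprime k M" and "S \<noteq> {}"
  obtains C' where "vieta_system (vieta_conj M k S) C'" "C' = 4 \<longleftrightarrow> C = 4"
    "common_denominator M D (vieta_conj M k S)"
proof -
  obtain x0 y0 z0 where S0: "(x0, y0, z0) \<in> S"
    using \<open>S \<noteq> {}\<close> by auto
  obtain x0' y0' z0' where c0: "conj_rel M k x0 x0'" "conj_rel M k y0 y0'" "conj_rel M k z0 z0'"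
    using conj_rel_exists[OF S0 M(2,1)] conj_rel_exists[OF rotate[OF S0] M(2,1)]
      conj_rel_exists[OF rotate[OF rotate[OF S0]] M(2,1)] by blast
  have uniq: "v = v'" if "conj_rel M k u v" "conj_rel M k u v'" for u v v'
    using conj_rel_unique[OF that M(1) k] by simp
  have markov_rel: "conj_rel M k C (x'\<^sup>2 + y'\<^sup>2 + z'\<^sup>2 - x' * y' * z')"
    if "(x, y, z) \<in> S" "conj_rel M k x x'" "conj_rel M k y y'" "conj_rel M k z z'" for x y z x' y' z'
    unfolding markov[OF that(1), symmetric] power2_eq_square
    by (intro conj_rel_diff conj_rel_add conj_rel_mult that)
  define C' where "C' = x0'\<^sup>2 + y0'\<^sup>2 + z0'\<^sup>2 - x0' * y0' * z0'"
  have C': "conj_rel M k C C'"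
    unfolding C'_def by (rule markov_rel[OF S0 c0])
  have den: "denominator x' n" if d: "denominator x n" "(x, y, z) \<in> S" "conj_rel M k x x'" for x x' y z n
  proof -
    obtain a where a: "n > 0" "coprime a n" "x = 2 * cos (pi * real_of_int a / real_of_int n)"
      using d(1) by (rule denominatorE)
    have n: "2 * n dvd int M"
      using M(2) d by (auto simp: common_denominator_def)
    have "x' = 2 * cos (pi * real_of_int (a * k) / n)"
      using conj_rel_unique[OF conj_rel_cos[OF a(1) n M(1), of k a] d(3)[unfolded a(3)] M(1) k] by simp
    moreover have "coprime (int k) n"
      using k(2) dvd_mult_right[OF n] coprime_divisors[of "int k" "int k" n "int M"] by simp
    then have "coprime (a * k) n"
      using a(2) by simp
    ultimately show ?thesis
      using a(1) unfolding denominator_def by blast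
  qed
  have "vieta_system (vieta_conj M k S) C'"
  proof
    have sub: "vieta_conj M k S \<subseteq> (\<Union>(x, y, z)\<in>S. {(x', y', z'). conj_rel M k x x' \<and> conj_rel M k y y' \<and> conj_rel M k z z'})"
      by (auto simp: vieta_conj_def)
    have "finite {x'. conj_rel M k x x'}" for x
    proof (cases "\<exists>x'. conj_rel M k x x'")
      case True
      then obtain x' where "conj_rel M k x x'"
        by blast
      then have "{x'. conj_rel M k x x'} \<subseteq> {x'}"
        using uniq by auto
      then show ?thesis
        by (rule finite_subset) simp
    qed simp
    then have fin3: "finite {(x', y', z'). conj_rel M k x x' \<and> conj_rel M k y y' \<and> conj_rel M k z z'}" for x y z
      by simp
    show "finite (vieta_conj M k S)"
      by (rule finite_subset[OF sub]) (use finite_S fin3 in auto)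
    show "(y, z, x) \<in> vieta_conj M k S" if S: "(x, y, z) \<in> vieta_conj M k S" for x y z
    proof -
      obtain x1 y1 z1 where "(x1, y1, z1) \<in> S" "conj_rel M k x1 x" "conj_rel M k y1 y" "conj_rel M k z1 z"
        using S by (auto simp: vieta_conj_def)
      then show ?thesis
        using rotate[of x1 y1 z1] unfolding vieta_conj_def by auto
    qed
    show "(x, z, y) \<in> vieta_conj M k S" if S: "(x, y, z) \<in> vieta_conj M k S" for x y z
    proof -
      obtain x1 y1 z1 where "(x1, y1, z1) \<in> S" "conj_rel M k x1 x" "conj_rel M k y1 y" "conj_rel M k z1 z"
        using S by (auto simp: vieta_conj_def)
      then show ?thesis
        using swap[of x1 y1 z1] unfolding vieta_conj_def by auto
    qed
    show "(x, - y, - z) \<in> vieta_conj M k S" if S: "(x, y, z) \<in> vieta_conj M k S" for x y z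
    proof -
      obtain x1 y1 z1 where "(x1, y1, z1) \<in> S" "conj_rel M k x1 x" "conj_rel M k y1 y" "conj_rel M k z1 z"
        using S by (auto simp: vieta_conj_def)
      then show ?thesis
        using neg[of x1 y1 z1] conj_rel_minus[of M k y1 y] conj_rel_minus[of M k z1 z]
        by (auto simp: vieta_conj_def)
    qed
    show "(x, z, x * z - y) \<in> vieta_conj M k S" if S: "(x, y, z) \<in> vieta_conj M k S" for x y z
    proof -
      obtain x1 y1 z1 where "(x1, y1, z1) \<in> S" "conj_rel M k x1 x" "conj_rel M k y1 y" "conj_rel M k z1 z"
        using S by (auto simp: vieta_conj_def)
      then show ?thesis
        using move[of x1 y1 z1] conj_rel_diff[OF conj_rel_mult, of M k x1 x z1 z y1 y]
        unfolding vieta_conj_def by auto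
    qed
    show "y \<noteq> 0 \<or> z \<noteq> 0" if S: "(x, y, z) \<in> vieta_conj M k S" for x y z
    proof -
      obtain x1 y1 z1 where "(x1, y1, z1) \<in> S" "conj_rel M k y1 y" "conj_rel M k z1 z"
        using S by (auto simp: vieta_conj_def)
      then show ?thesis
        using conn[of x1 y1 z1] conj_rel_zero_iff[OF _ M(1) k] by metis
    qed
    show "x\<^sup>2 + y\<^sup>2 + z\<^sup>2 - x * y * z = C'" if S: "(x, y, z) \<in> vieta_conj M k S" for x y z
    proof -
      obtain x1 y1 z1 where "(x1, y1, z1) \<in> S" "conj_rel M k x1 x" "conj_rel M k y1 y" "conj_rel M k z1 z"
        using S by (auto simp: vieta_conj_def)
      from markov_rel[OF this] show ?thesis
        using uniq C' by blast
    qed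
  qed
  moreover have "C' = 4 \<longleftrightarrow> C = 4"
    using conj_rel_unique[OF C' conj_rel_of_int[of M k 4] M(1) k] by simp
  moreover have "common_denominator M D (vieta_conj M k S)"
    unfolding common_denominator_def
  proof (intro allI impI)
    fix x' y' z' n
    assume "(x', y', z') \<in> vieta_conj M k S" "denominator x' n"
    then obtain x y z where S: "(x, y, z) \<in> S" and "conj_rel M k x x'"
      by (auto simp: vieta_conj_def)
    obtain m where m: "denominator x m"
      using entry_denominator[OF S] by blast
    then have "denominator x' m"
      using den S \<open>conj_rel M k x x'\<close> by blast
    then have "m = n"
      using \<open>denominator x' n\<close> denominator_unique by blast
    then show "2 * n dvd int M \<and> n \<le> D"
      using M(2) S m unfolding common_denominator_def by blast
  qed
  ultimately show ?thesis
    using that by blast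
qed

end

section \<open>Systems with a weight of large denominator are Euclidean\<close>

text \<open>The left side is sin (pi/D). An odd r other than 1 and -1 modulo 2c has distance at
  least 3 from the multiples of 2c, so the right side is at least sin (3 pi/(2c)), and 1/D <= 1/c <=
  3/(2c).\<close>

lemma abs_sin_le_of_cong_1:
  fixes c D r :: nat
  assumes cD: "c \<ge> 3" "c \<le> D" and r: "odd r" "[r = 1] (mod D)"
    and nd: "\<not> 2 * int c dvd int r - 1" "\<not> 2 * int c dvd int r + 1"
  shows "\<bar>sin (pi * r / D)\<bar> \<le> \<bar>sin (pi * r / (2 * c))\<bar>"
proof -
  have D: "real D > 0"
    using cD by simp
  have "[int r = 1] (mod int D)"
    using r(2) by (metis cong_int_iff of_nat_1)
  then have "int D dvd int r - 1"
    by (simp add: cong_iff_dvd_diff)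
  then obtain t where "int r - 1 = int D * t"
    by (elim dvdE)
  then have "int r = 1 + int D * t"
    by simp
  then have "real_of_int (int r) = real_of_int (1 + int D * t)"
    by (rule arg_cong)
  then have "pi * r / D = pi / D + pi * of_int t"
    using D by (simp add: field_simps)
  then have "\<bar>sin (pi * r / D)\<bar> = \<bar>sin (pi / D)\<bar>"
    by (simp only: abs_sin_add_int_pi)
  also have "\<dots> = sin (pi / D)"
    using cD D by (intro abs_of_nonneg sin_ge_zero) (auto simp: field_simps)
  also have "\<dots> \<le> sin (pi * 3 / (2 * c))"
  proof (rule sin_monotone_2pi_le)
    have "1 / real D \<le> 1 / c"
      using cD by (intro divide_left_mono) auto
    also have "\<dots> \<le> 3 / (2 * c)"
      using cD by (simp add: field_simps)
    finally have "pi * (1 / real D) \<le> pi * (3 / (2 * c))"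
      by (rule mult_left_mono) simp
    then show "pi / D \<le> pi * 3 / (2 * c)"
      by simp
    have "3 / (2 * real c) \<le> 1 / 2"
      using cD by (simp add: field_simps)
    then have "pi * (3 / (2 * real c)) \<le> pi * (1 / 2)"
      by (rule mult_left_mono) simp
    then show "pi * 3 / (2 * c) \<le> pi / 2"
      by simp
    have "0 \<le> pi / D" by simp
    then show "- (pi / 2) \<le> pi / D"
      using pi_gt_zero by linarith
  qed
  also have "\<dots> \<le> \<bar>sin (pi * r / (2 * c))\<bar>"
  proof -
    define i where "i = int r mod (2 * int c)"
    have c0: "2 * int c > 0"
      using cD by simp
    have i: "0 \<le> i" "i < 2 * int c"
      using c0 by (simp_all add: i_def)
    have "2 * int c dvd int r - i"
      by (simp add: i_def minus_mod_eq_mult_div)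
    then obtain q where q: "int r = i + 2 * int c * q"
      by (metis dvdE add_diff_cancel_left' diff_add_cancel add.commute)
    have "odd i"
      using r(1) q by (metis dvd_add dvd_triv_left even_of_nat mult.assoc)
    moreover have "i \<noteq> 1"
      using nd(1) q by auto
    moreover have "i \<noteq> 2 * int c - 1"
    proof
      assume "i = 2 * int c - 1"
      then have "int r + 1 = 2 * int c * (q + 1)"
        using q by (simp add: algebra_simps)
      then show False
        using nd(2) by (metis dvd_triv_left)
    qed
    moreover have "i \<noteq> 2 * int c - 2" "i \<noteq> 0" "i \<noteq> 2"
      using \<open>odd i\<close> by auto
    ultimately have "3 \<le> i" "i \<le> 2 * int c - 3"
      using i by presburger+
    then show ?thesis
      using abs_sin_rational_ge[of "2 * int c" 3 "int r"] c0 by (simp add: i_def)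
  qed
  finally show ?thesis .
qed

text \<open>Such an r conjugates (2 cos (pi/D), 0, 2 sin (pi/(2c))) into a triple with 4 cos^2 (pi
  r/D) + 4 sin^2 (pi r/(2c)) >= 4. For c < D it is enough to find r congruent to 1 modulo D avoiding
  1 and -1 modulo 2c.\<close>

lemma exists_bad_residue:
  fixes c D :: nat
  assumes c: "odd c" "c \<le> D" "D < 2 * c" and D: "D \<ge> 6"
  shows "\<exists>r. coprime r (2 * c * D) \<and> \<bar>sin (pi * r / D)\<bar> \<le> \<bar>sin (pi * r / (2 * c))\<bar>"
proof (cases "c = D")
  case True
  \<comment> \<open>The two sines become 2 sin (pi/D) cos (pi/D) and cos (pi/D), so the claim
    reduces to 2 sin (pi/D) <= 1, that is D >= 6.\<close>
  define r where "r = D - 2"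
  have rD: "D = r + 2" "odd r"
    using D c(1) True by (auto simp: r_def)
  have "coprime r 2"
    using rD(2) by simp
  moreover have "coprime r D"
    using \<open>coprime r 2\<close> by (metis coprime_iff_gcd_eq_1 gcd_add2 rD(1))
  ultimately have "coprime r (2 * c * D)"
    using True by simp
  moreover have "\<bar>sin (pi * r / D)\<bar> \<le> \<bar>sin (pi * r / (2 * c))\<bar>"
  proof -
    have D0: "real D > 0" and r: "real r = real D - 2"
      using D by (simp_all add: r_def of_nat_diff)
    have "pi * r / D = pi - 2 * (pi / D)"
      using D0 by (simp add: r field_simps)
    then have 1: "sin (pi * r / D) = 2 * sin (pi / D) * cos (pi / D)"
      by (simp only: sin_pi_minus sin_double)
    have "pi * r / (2 * c) = pi / 2 - pi / D"
      using D0 by (simp add: r True field_simps)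
    then have 2: "sin (pi * r / (2 * c)) = cos (pi / D)"
      by (simp only: sin_cos_eq) simp
    have le: "pi / D \<le> pi / 6"
      using D by (intro divide_left_mono) auto
    have "0 \<le> sin (pi / D)" "sin (pi / D) \<le> sin (pi / 6)"
    proof -
      have "0 \<le> pi / D" by simp
      then show "0 \<le> sin (pi / D)"
        using le by (intro sin_ge_zero) linarith+
      show "sin (pi / D) \<le> sin (pi / 6)"
        using le \<open>0 \<le> pi / D\<close> by (intro sin_monotone_2pi_le) linarith+
    qed
    then have "0 \<le> 2 * sin (pi / D)" "2 * sin (pi / D) \<le> 1"
      by (simp_all add: sin_30)
    then have "2 * sin (pi / D) * \<bar>cos (pi / D)\<bar> \<le> 1 * \<bar>cos (pi / D)\<bar>"
      by (intro mult_right_mono) auto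
    then show ?thesis
      unfolding 1 2 using \<open>0 \<le> 2 * sin (pi / D)\<close> by (simp add: abs_mult)
  qed
  ultimately show ?thesis by blast
next
  case cD: False
  have c5: "c \<ge> 4"
    using D c(3) by linarith
  show ?thesis
  proof (cases "\<forall>p. prime p \<longrightarrow> p dvd c \<longrightarrow> p dvd D")
    case True
    \<comment> \<open>Here r - 1 = 2D is no multiple of 2c since c < D < 2c, and r + 1 = 2(D + 1) is
      none since D shares the prime divisors of c.\<close>
    define r where "r = 1 + 2 * D"
    have cop2D: "coprime r (2 * D)"
      unfolding r_def by (simp only: add.commute[of 1] coprime_add_one_left)
    have "coprime r c"
    proof (rule ccontr)
      assume "\<not> coprime r c"
      then have "gcd r c \<noteq> 1"
        by (simp add: coprime_iff_gcd_eq_1)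
      then obtain p where p: "prime p" "p dvd gcd r c"
        using prime_factor_nat by blast
      then have "p dvd r" "p dvd 2 * D"
        using True by auto
      then have "p dvd 1"
        using cop2D coprime_common_divisor by blast
      then show False
        using p(1) by simp
    qed
    then have "coprime r (2 * c * D)"
      using cop2D by simp
    moreover have "\<bar>sin (pi * r / D)\<bar> \<le> \<bar>sin (pi * r / (2 * c))\<bar>"
    proof (rule abs_sin_le_of_cong_1)
      show "[r = 1] (mod D)"
        unfolding r_def cong_def by (rule mod_mult_self1)
      show "\<not> 2 * int c dvd int r - 1"
      proof
        assume "2 * int c dvd int r - 1"
        then have "int c dvd int D"
          by (simp add: r_def)
        then obtain l where l: "D = c * l"
          by (auto elim: dvdE)
        have "c * l < c * 2"
          using l c(3) by simp
        then have "l = 0 \<or> l = 1"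
          by auto
        then show False
          using l cD D by auto
      qed
      show "\<not> 2 * int c dvd int r + 1"
      proof
        assume "2 * int c dvd int r + 1"
        moreover have "int r + 1 = 2 * int (D + 1)"
          by (simp add: r_def)
        ultimately obtain q where "2 * int (D + 1) = 2 * int c * q"
          by (metis dvdE)
        then have "int (D + 1) = int c * q"
          by simp
        then have "int c dvd int (D + 1)"
          by (rule dvdI)
        then have "c dvd D + 1"
          by (simp only: int_dvd_int_iff)
        obtain p where p: "prime p" "p dvd c"
          using c5 prime_factor_nat[of c] by auto
        then have "p dvd D" "p dvd D + 1"
          using True \<open>c dvd D + 1\<close> dvd_trans by blast+
        then have "p dvd 1"
          using dvd_add_right_iff[of p D 1] by simp
        then show False
          using p(1) by simp
      qed
    qed (use c c5 in \<open>auto simp: r_def\<close>)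
    ultimately show ?thesis by blast
  next
    case False
    then obtain p where p: "prime p" "p dvd c" "\<not> p dvd D"
      by blast
    define e where "e = multiplicity p c"
    define P where "P = p ^ e"
    obtain m where m: "c = P * m" "\<not> p dvd m"
    proof -
      have "c \<noteq> 0" "\<not> is_unit p"
        using c5 p(1) by auto
      then show ?thesis
        using multiplicity_decompose'[of c p] that unfolding P_def e_def by metis
    qed
    have "e > 0"
      using p c5 by (simp add: e_def prime_multiplicity_gt_zero_iff)
    have "odd P"
      using m c(1) by simp
    have "p \<noteq> 2"
      using p c(1) by auto
    have "coprime p (2 * m * D)"
    proof -
      have "\<not> p dvd 2"
        using p(1) \<open>p \<noteq> 2\<close> primes_dvd_imp_eq two_is_prime_nat by blast
      then have "\<not> p dvd 2 * m * D"
        using p m(2) by (simp add: prime_dvd_mult_iff)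
      then show ?thesis
        using p(1) prime_imp_coprime by blast
    qed
    then have cop: "coprime (2 * m * D) P"
      by (simp add: P_def coprime_commute)
    \<comment> \<open>Modulo \<open>P\<close>, the full power of p in c, r - 1 is 1 and r + 1 is 3.
      So only P = 3 could be harmful, and then m = 1 would follow, against c >= 4.\<close>
    obtain r where r: "[r = 1] (mod 2 * m * D)" "[r = 2] (mod P)"
      using binary_chinese_remainder_nat[OF cop] by blast
    have "coprime r (2 * m * D)"
      using cong_imp_coprime[OF cong_sym[OF r(1)]] by simp
    moreover have "coprime r P"
      using cong_imp_coprime[OF cong_sym[OF r(2)]] \<open>odd P\<close> by simp
    ultimately have "coprime r (2 * c * D)"
      by (simp add: m(1))
    moreover have "\<bar>sin (pi * r / D)\<bar> \<le> \<bar>sin (pi * r / (2 * c))\<bar>"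
    proof (rule abs_sin_le_of_cong_1)
      show "[r = 1] (mod D)"
        by (rule cong_dvd_modulus_nat[OF r(1)]) simp
      show "odd r"
        using \<open>coprime r (2 * m * D)\<close> by simp
      have rP: "int P dvd int r - 2"
      proof -
        have "[int r = int 2] (mod int P)"
          using r(2) by (simp only: cong_int_iff)
        then show ?thesis
          by (simp add: cong_iff_dvd_diff)
      qed
      have Pc: "int P dvd 2 * int c"
        by (simp add: m(1))
      have "P > 1"
        unfolding P_def using one_less_power[of p e] prime_gt_1_nat[OF p(1)] \<open>e > 0\<close> by simp
      show "\<not> 2 * int c dvd int r - 1"
      proof
        assume "2 * int c dvd int r - 1"
        then have "int P dvd (int r - 1) - (int r - 2)"
          using rP Pc dvd_trans dvd_diff by blast
        then show False
          using \<open>P > 1\<close> by simp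
      qed
      show "\<not> 2 * int c dvd int r + 1"
      proof
        assume a: "2 * int c dvd int r + 1"
        then have "int P dvd (int r + 1) - (int r - 2)"
          using rP Pc dvd_trans dvd_diff by blast
        then have "P dvd 3"
          using int_dvd_int_iff[of P 3] by simp
        then have "P \<le> 3"
          by (simp add: dvd_imp_le)
        have "int (2 * m) dvd int r - 1"
        proof -
          have "[r = 1] (mod 2 * m)"
            by (rule cong_dvd_modulus_nat[OF r(1)]) simp
          then have "[int r = int 1] (mod int (2 * m))"
            by (simp only: cong_int_iff)
          then show ?thesis
            by (simp add: cong_iff_dvd_diff)
        qed
        moreover have "int (2 * m) dvd 2 * int c"
          by (simp add: m(1))
        ultimately have "int (2 * m) dvd (int r + 1) - (int r - 1)"
          using a dvd_trans dvd_diff by blast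
        then have "m dvd 1"
          by simp
        then show False
          using m(1) \<open>P \<le> 3\<close> c5 by simp
      qed
    qed (use c c5 in auto)
    ultimately show ?thesis by blast
  qed
qed




context vieta_system begin

text \<open>Rotation about 2 cos (pi/D) yields two neighbouring entries of moduli R sin alpha and R
  sin beta with alpha + beta = pi/D and R < 2. The smaller one lies below the least possible nonzero
  weight, so it is 0. The Markov equation then bounds the remaining entry by |u| < 2 sin (pi/D),
  which forces |u| = 2 sin (pi/(2c)).\<close>

lemma spherical_normal_form:
  assumes C: "C < 4" and M: "common_denominator M D S" "even M"
    and D: "D \<ge> 6" "(2 * cos (pi / D), y, z) \<in> S"
  obtains u b c where "(2 * cos (pi / D), 0, u) \<in> S" "u = 2 * cos (pi * real_of_int b / real_of_int c)"
    "0 < c" "c \<le> D" "D < 2 * c" "odd c" "2 * c dvd int M"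
    "(c - 2 * b) mod (2 * c) = 1 \<or> (c - 2 * b) mod (2 * c) = 2 * c - 1"
proof -
  define w where "w = 2 * cos (pi / D)"
  have D0: "real_of_int D \<ge> 6"
    using D(1) by simp
  have piD: "0 < pi / D" "pi / D \<le> pi / 6"
    using D0 divide_left_mono[of 6 "real_of_int D" pi] by simp_all
  have cos_sin: "\<bar>cos (pi * real_of_int b / real_of_int c)\<bar> = \<bar>sin (pi * real_of_int (c - 2 * b) / real_of_int (2 * c))\<bar>"
    if "c > 0" for b c :: int
  proof -
    have "pi * real_of_int (c - 2 * b) / real_of_int (2 * c) = pi / 2 - pi * real_of_int b / real_of_int c"
      using that by (simp add: field_simps)
    then show ?thesis
      by (simp only: cos_sin_eq of_real_eq_id id_apply)
  qed
  \<comment> \<open>All denominators are at most D, so an angle different from pi/2 modulo pi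
    differs from it by at least pi/(2D).\<close>
  have lower: "2 * sin (pi / (2 * D)) \<le> \<bar>x\<bar>" if S: "(x, y, z) \<in> S" "x \<noteq> 0" for x y z
  proof -
    obtain c where c: "denominator x c"
      using entry_denominator[OF S(1)] by blast
    then obtain b where b: "c > 0" "x = 2 * cos (pi * real_of_int b / real_of_int c)"
      by (auto simp: denominator_def)
    have "c \<le> D"
      using M(1) S(1) c by (auto simp: common_denominator_def)
    define i where "i = (c - 2 * b) mod (2 * c)"
    have i: "0 \<le> i" "i < 2 * c"
      using b(1) by (simp_all add: i_def)
    have xs: "\<bar>x\<bar> = 2 * \<bar>sin (pi * real_of_int (c - 2 * b) / real_of_int (2 * c))\<bar>"
      by (simp only: b(2) abs_mult abs_numeral cos_sin[OF b(1)])
    have "i \<noteq> 0"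
    proof
      assume "i = 0"
      then obtain q where "c - 2 * b = 2 * c * q"
        by (auto simp: i_def mod_eq_0_iff_dvd elim: dvdE)
      then have "real_of_int (c - 2 * b) = real_of_int (2 * c) * real_of_int q"
        by (simp only: of_int_mult)
      then have "pi * real_of_int (c - 2 * b) / real_of_int (2 * c) = pi * of_int q"
        using b(1) by simp
      then show False
        using xs S(2) by (simp only: sin_npi_int)
    qed
    then have "sin (pi * real_of_int 1 / real_of_int (2 * c)) \<le> \<bar>sin (pi * real_of_int (c - 2 * b) / real_of_int (2 * c))\<bar>"
      using i b(1) unfolding i_def by (intro abs_sin_rational_ge; linarith)
    moreover have "sin (pi / (2 * D)) \<le> sin (pi / (2 * c))"
    proof (rule sin_monotone_2pi_le)
      show "pi / (2 * D) \<le> pi / (2 * c)"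
        using \<open>c \<le> D\<close> b(1) by (intro divide_left_mono) auto
      show "pi / (2 * c) \<le> pi / 2"
        using b(1) by (simp add: field_simps)
      have "0 \<le> pi / (2 * D)"
        using D0 by simp
      then show "- (pi / 2) \<le> pi / (2 * D)"
        using pi_gt_zero by linarith
    qed
    ultimately show ?thesis
      unfolding xs by simp
  qed
  have w2: "4 - w\<^sup>2 = (2 * sin (pi / D))\<^sup>2" "4 - w\<^sup>2 > 0"
  proof -
    show "4 - w\<^sup>2 = (2 * sin (pi / D))\<^sup>2"
      unfolding w_def power_mult_distrib sin_squared_eq by simp
    moreover have "sin (pi / D) > 0"
      using piD by (intro sin_gt_zero) linarith+
    then have "(2 * sin (pi / D))\<^sup>2 > 0"
      by simp
    ultimately show "4 - w\<^sup>2 > 0"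
      by linarith
  qed
  have wS: "(w, y, z) \<in> S"
    using D(2) by (simp add: w_def)
  have "w = 2 * cos (pi * real_of_int 1 / D)" "D > 1" "coprime 1 D"
    using D(1) by (simp_all add: w_def)
  then obtain R \<phi> where R: "R \<ge> 0" "R\<^sup>2 * (4 - w\<^sup>2) = 4 * (C - w\<^sup>2)" "y = R * cos \<phi>"
    and ph: "\<And>j::int. (w, R * cos (\<phi> + pi * j / D), R * cos (\<phi> + pi * real_of_int (j + 1) / D)) \<in> S"
    by (rule rotation[OF wS]) (rule that)
  have "R < 2"
  proof -
    have "R\<^sup>2 * (4 - w\<^sup>2) < 2\<^sup>2 * (4 - w\<^sup>2)"
      unfolding R(2) using C by simp
    then have "R\<^sup>2 < 2\<^sup>2"
      by (rule mult_right_less_imp_less) (use w2 in simp)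
    then show ?thesis
      by (rule power2_less_imp_less) simp
  qed
  \<comment> \<open>The phases \<open>j\<close> and \<open>j + 1\<close> enclose pi/2, at distances
    alpha and beta from it.\<close>
  obtain j :: int where j: "pi / 2 - pi / D \<le> \<phi> + pi * j / D" "\<phi> + pi * j / D < pi / 2 - pi / D + pi / D"
    using exists_int_shift_floor[of D "pi / 2 - pi / D" \<phi>] D(1) by fastforce
  define \<alpha> where "\<alpha> = pi / 2 - (\<phi> + pi * j / D)"
  define \<beta> where "\<beta> = pi / D - \<alpha>"
  have ab: "0 \<le> \<alpha>" "0 \<le> \<beta>" "\<alpha> + \<beta> = pi / D"
    using j unfolding \<alpha>_def \<beta>_def by linarith+
  have e1: "cos (\<phi> + pi * j / D) = sin \<alpha>"
    by (simp only: \<alpha>_def sin_diff sin_pi_half cos_pi_half mult_1 mult_zero_left diff_0_right)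
  have "\<phi> + pi * real_of_int (j + 1) / D = \<beta> + pi / 2"
    unfolding \<alpha>_def \<beta>_def by (simp add: add_divide_distrib distrib_left)
  then have e2: "cos (\<phi> + pi * real_of_int (j + 1) / D) = - sin \<beta>"
    by (simp add: cos_add)
  have in_S: "(w, R * sin \<alpha>, - (R * sin \<beta>)) \<in> S"
    using ph[of j] by (simp only: e1 e2 mult_minus_right)
  have zero: "R * sin \<alpha> = 0 \<or> R * sin \<beta> = 0"
  proof (rule ccontr)
    assume nz: "\<not> ?thesis"
    have l1: "2 * sin (pi / (2 * D)) \<le> \<bar>R * sin \<alpha>\<bar>"
      using lower[OF rotate[OF in_S]] nz by blast
    have l2: "2 * sin (pi / (2 * D)) \<le> \<bar>R * sin \<beta>\<bar>"
      using lower[OF rotate[OF rotate[OF in_S]]] nz by simp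
    have s0: "sin (pi / (2 * D)) > 0"
      using D0 by (intro sin_gt_zero) (auto simp: field_simps)
    have small: "\<bar>R * sin t\<bar> < 2 * sin (pi / (2 * D))" if "0 \<le> t" "t \<le> pi / (2 * D)" for t
    proof -
      have "pi / (2 * D) \<le> pi / 2"
        using D0 by (intro divide_left_mono) auto
      then have "sin t \<le> sin (pi / (2 * D))" "0 \<le> sin t"
        using that pi_gt_zero by (auto intro!: sin_monotone_2pi_le sin_ge_zero)
      then have "\<bar>R * sin t\<bar> \<le> R * sin (pi / (2 * D))"
        using R(1) by (simp add: abs_mult mult_left_mono)
      also have "\<dots> < 2 * sin (pi / (2 * D))"
        using s0 \<open>R < 2\<close> by simp
      finally show ?thesis .
    qed
    have "pi / (2 * D) + pi / (2 * D) = pi / D"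
      by (simp add: field_simps)
    then have "\<alpha> \<le> pi / (2 * D) \<or> \<beta> \<le> pi / (2 * D)"
      using ab by linarith
    then show False
      using small[of \<alpha>] small[of \<beta>] l1 l2 ab by linarith
  qed
  obtain u where u: "(w, 0, u) \<in> S"
  proof (cases "R * sin \<alpha> = 0")
    case True
    have "(w, 0, - (R * sin \<beta>)) \<in> S"
      using in_S by (simp only: True)
    then show ?thesis
      by (rule that)
  next
    case False
    then have "(w, R * sin \<alpha>, 0) \<in> S"
      using in_S zero by simp
    from swap[OF this] show ?thesis
      by (rule that)
  qed
  have "u \<noteq> 0"
    using conn[OF u] by simp
  have "u\<^sup>2 = C - w\<^sup>2"
    using markov[OF u] by simp
  then have "\<bar>u\<bar>\<^sup>2 < (2 * sin (pi / D))\<^sup>2"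
    using C w2(1) by simp
  then have "\<bar>u\<bar> < \<bar>2 * sin (pi / D)\<bar>"
    using abs_le_square_iff[of "2 * sin (pi / D)" "\<bar>u\<bar>"] by (simp add: not_le[symmetric])
  also have "\<bar>2 * sin (pi / D)\<bar> = 2 * sin (pi / D)"
    using piD pi_gt_zero by (intro abs_of_nonneg mult_nonneg_nonneg sin_ge_zero; linarith)
  finally have u_less: "\<bar>u\<bar> < 2 * sin (pi / D)" .
  have uS: "(u, w, 0) \<in> S"
    using rotate[OF rotate[OF u]] .
  obtain c where c: "denominator u c"
    using entry_denominator[OF uS] by blast
  then obtain b where b: "c > 0" "u = 2 * cos (pi * real_of_int b / real_of_int c)"
    by (auto simp: denominator_def)
  have cD: "c \<le> D" "2 * c dvd int M"
    using M(1) uS c unfolding common_denominator_def by blast+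
  define i where "i = (c - 2 * b) mod (2 * c)"
  have i: "0 \<le> i" "i < 2 * c"
    using b(1) by (simp_all add: i_def)
  have us: "\<bar>u\<bar> = 2 * \<bar>sin (pi * real_of_int (c - 2 * b) / real_of_int (2 * c))\<bar>"
    by (simp only: b(2) abs_mult abs_numeral cos_sin[OF b(1)])
  have "i \<noteq> 0"
  proof
    assume "i = 0"
    then obtain q where "c - 2 * b = 2 * c * q"
      by (auto simp: i_def mod_eq_0_iff_dvd elim: dvdE)
    then have "real_of_int (c - 2 * b) = real_of_int (2 * c) * real_of_int q"
      by (simp only: of_int_mult)
    then have "pi * real_of_int (c - 2 * b) / real_of_int (2 * c) = pi * of_int q"
      using b(1) by simp
    then show False
      using us \<open>u \<noteq> 0\<close> by (simp only: sin_npi_int)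
  qed
  \<comment> \<open>A distance of 2 or more would give |u| >= 2 sin (pi/c) >= 2 sin (pi/D).\<close>
  have not_mid: "\<not> (2 \<le> i \<and> i \<le> 2 * c - 2)"
  proof
    assume mid: "2 \<le> i \<and> i \<le> 2 * c - 2"
    then have "sin (pi * real_of_int 2 / real_of_int (2 * c)) \<le> \<bar>sin (pi * real_of_int (c - 2 * b) / real_of_int (2 * c))\<bar>"
      using b(1) unfolding i_def by (intro abs_sin_rational_ge; linarith)
    then have "2 * sin (pi / c) \<le> \<bar>u\<bar>"
      unfolding us by simp
    moreover have "sin (pi / D) \<le> sin (pi / c)"
    proof (rule sin_monotone_2pi_le)
      show "pi / D \<le> pi / c"
        using cD b(1) by (intro divide_left_mono) auto
      have "c \<ge> 2"
        using mid by linarith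
      then show "pi / c \<le> pi / 2"
        by (intro divide_left_mono) auto
      show "- (pi / 2) \<le> pi / D"
        using piD pi_gt_zero by linarith
    qed
    ultimately show False
      using u_less by linarith
  qed
  then have i_cases: "i = 1 \<or> i = 2 * c - 1"
    using i \<open>i \<noteq> 0\<close> by linarith
  \<comment> \<open>Since i is congruent to c - 2b modulo 2c, its parity is that of c.\<close>
  have "odd i"
    using i_cases by auto
  have "2 * c dvd (c - 2 * b) - i"
    by (simp add: i_def minus_mod_eq_mult_div)
  then have "even ((c - 2 * b) - i)"
    by (meson dvd_trans dvd_triv_left)
  then have "odd c"
    using \<open>odd i\<close> by simp
  have "sin (pi * real_of_int 1 / real_of_int (2 * c)) \<le> \<bar>sin (pi * real_of_int (c - 2 * b) / real_of_int (2 * c))\<bar>"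
    using i \<open>i \<noteq> 0\<close> b(1) unfolding i_def by (intro abs_sin_rational_ge; linarith)
  then have less: "sin (pi / (2 * c)) < sin (pi / D)"
    using u_less unfolding us by simp
  have "D < 2 * c"
  proof (rule ccontr)
    assume "\<not> D < 2 * c"
    then have "sin (pi / D) \<le> sin (pi / (2 * c))"
    proof (intro sin_monotone_2pi_le)
      show "pi / D \<le> pi / (2 * c)" if "\<not> D < 2 * c"
        using that b(1) by (intro divide_left_mono) auto
      show "pi / (2 * c) \<le> pi / 2"
        using b(1) by (simp add: field_simps)
      show "- (pi / 2) \<le> pi / D"
        using piD pi_gt_zero by linarith
    qed
    then show False
      using less by linarith
  qed
  with that[of u b c] u b cD \<open>odd c\<close> i_cases show ?thesis
    unfolding w_def i_def by blast
qed

end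



section \<open>The conjugate that violates C < 4\<close>

lemma abs_sin_cong:
  fixes k r n :: nat
  assumes "[k = r] (mod n)" "n > 0"
  shows "\<bar>sin (pi * k / n)\<bar> = \<bar>sin (pi * r / n)\<bar>"
proof -
  have "[int k = int r] (mod int n)"
    using assms(1) by (simp only: cong_int_iff)
  then obtain t where "int k = int r + int n * t"
    by (metis cong_iff_lin cong_sym)
  then have "real_of_int (int k) = real_of_int (int r + int n * t)"
    by (rule arg_cong)
  then have "pi * k / n = pi * r / n + pi * of_int t"
    using assms(2) by (simp add: field_simps)
  then show ?thesis
    by (simp only: abs_sin_add_int_pi)
qed

text \<open>By hypothesis b/c equals 1/2 plus or minus 1/(2c) up to an integer. Multiplying by an
  odd k keeps the half modulo 1, which exchanges cosine and sine.\<close>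

lemma abs_cos_half_shift:
  fixes b c :: int and k :: nat
  assumes "c > 0" "odd k" "(c - 2 * b) mod (2 * c) = 1 \<or> (c - 2 * b) mod (2 * c) = 2 * c - 1"
  shows "\<bar>cos (pi * real_of_int (b * k) / c)\<bar> = \<bar>sin (pi * k / (2 * c))\<bar>"
proof -
  define l where "l = (c - 2 * b) div (2 * c)"
  have l: "c - 2 * b = 2 * c * l + (c - 2 * b) mod (2 * c)"
    by (simp add: l_def)
  obtain e l' where e: "e = 1 \<or> e = -1" "c - 2 * b = 2 * c * l' + (e :: int)"
  proof (cases "(c - 2 * b) mod (2 * c) = 1")
    case True
    then show ?thesis
      using l that[of 1 l] by simp
  next
    case False
    then have "c - 2 * b = 2 * c * (l + 1) + (- 1)"
      using l assms(3) by (simp add: distrib_left)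
    then show ?thesis
      using that[of "-1" "l + 1"] by simp
  qed
  obtain q where q: "int k = 2 * q + 1"
    using assms(2) by (metis even_of_nat oddE)
  have "2 * (b * int k) = c * int k - 2 * c * (l' * int k) - e * int k"
    using arg_cong[OF e(2), of "\<lambda>t. t * int k"] by (simp add: algebra_simps)
  also have "\<dots> = c + 2 * c * q - 2 * c * (l' * int k) - e * int k"
    by (simp add: q algebra_simps)
  finally have "real_of_int (2 * (b * int k)) = real_of_int (c + 2 * c * q - 2 * c * (l' * int k) - e * int k)"
    by (rule arg_cong)
  then have "2 * real_of_int (b * int k) = c + 2 * c * real_of_int (q - l' * int k) - e * real k"
    by (simp add: algebra_simps)
  moreover have "pi * B / c = (pi / 2 - e * (pi * k / (2 * c))) + pi * Q"
    if "2 * B = c + 2 * c * Q - e * real k" for B Q :: real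
  proof -
    have B: "B = (c + 2 * c * Q - e * real k) / 2"
      using that by simp
    show ?thesis
      unfolding B using assms(1) by (simp add: field_simps)
  qed
  ultimately have "pi * real_of_int (b * int k) / c
      = (pi / 2 - e * (pi * k / (2 * c))) + pi * real_of_int (q - l' * int k)"
    by blast
  then have "\<bar>cos (pi * real_of_int (b * int k) / c)\<bar> = \<bar>cos (pi / 2 - e * (pi * k / (2 * c)))\<bar>"
    by (simp only: abs_cos_add_int_pi)
  also have "\<dots> = \<bar>sin (e * (pi * k / (2 * c)))\<bar>"
    by (simp only: cos_diff cos_pi_half sin_pi_half mult_zero_left mult_1 add_0_left)
  also have "\<dots> = \<bar>sin (pi * k / (2 * c))\<bar>"
    using e(1) by auto
  finally show ?thesis .
qed

context vieta_system begin

theorem markov_eq_4_of_denominator: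
  assumes "(x0, y0, z0) \<in> S" "denominator x0 d" "d \<ge> 6"
  shows "C = 4"
proof (rule ccontr)
  assume "C \<noteq> 4"
  define N where "N = {n. \<exists>x y z. (x, y, z) \<in> S \<and> denominator x n}"
  have "N \<subseteq> (\<lambda>x. THE n. denominator x n) ` fst ` S"
  proof
    fix n assume "n \<in> N"
    then obtain x y z where n: "(x, y, z) \<in> S" "denominator x n"
      by (auto simp: N_def)
    then have "(THE n. denominator x n) = n"
      using denominator_unique by blast
    then show "n \<in> (\<lambda>x. THE n. denominator x n) ` fst ` S"
      using n(1) by force
  qed
  then have finN: "finite N"
    by (rule finite_subset) (use finite_S in auto)
  define D where "D = Max N"
  have "d \<in> N"
    using assms by (auto simp: N_def)
  then have "D \<in> N" "d \<le> D"
    unfolding D_def using finN by (auto intro: Max_in)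
  then have D6: "D \<ge> 6"
    using assms(3) by linarith
  have Npos: "n > 0" if "n \<in> N" for n
    using that by (auto simp: N_def denominator_def)
  \<comment> \<open>Twice the product of all denominators, so that every entry of the system is a
    sum of M-th roots of unity.\<close>
  define M where "M = nat (2 * \<Prod>N)"
  have "\<Prod>N > 0"
    by (rule prod_pos) (rule Npos)
  then have M: "int M = 2 * \<Prod>N" "M > 0"
    by (simp_all add: M_def)
  have NM: "2 * n dvd int M" if "n \<in> N" for n
    unfolding M using that finN by (intro mult_dvd_mono dvd_prod_eqI) auto
  have cd: "common_denominator M D S"
    unfolding common_denominator_def
  proof (intro allI impI)
    fix x y z n assume "(x, y, z) \<in> S" "denominator x n"
    then have "n \<in> N"
      unfolding N_def by blast
    then show "2 * n dvd int M \<and> n \<le> D"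
      using NM finN by (simp add: D_def)
  qed
  have "int 2 dvd int M"
    using M(1) by simp
  then have evM: "even M"
    by (simp only: int_dvd_int_iff)
  obtain x y z where S: "(x, y, z) \<in> S" "denominator x D"
    using \<open>D \<in> N\<close> by (auto simp: N_def)
  then obtain a where a: "coprime a D" "x = 2 * cos (pi * real_of_int a / real_of_int D)"
    by (auto simp: denominator_def)
  \<comment> \<open>Conjugating by an inverse of \<open>a\<close> modulo D, lifted to a unit modulo
    M, sends \<open>x\<close> to 2 cos (pi/D) up to sign.\<close>
  obtain b where b: "[a * b = 1] (mod D)"
    using cong_solve_coprime_int[OF a(1)] by blast
  define b' where "b' = nat (b mod D)"
  have b': "int b' = b mod D"
    using D6 by (simp add: b'_def)
  have "coprime (a * b) D"
    using cong_imp_coprime[OF cong_sym[OF b]] by simp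
  then have "coprime b D"
    by simp
  moreover have "[b = b mod D] (mod D)"
    by (simp add: cong_def)
  ultimately have "coprime (b mod D) D"
    using cong_imp_coprime by blast
  then have "coprime (int b') (int (nat D))"
    using D6 by (simp add: b')
  then have cop_b': "coprime b' (nat D)"
    by (simp only: coprime_int_iff)
  obtain k where k: "k > 0" "[k = b'] (mod nat D)" "coprime k M"
    using exists_coprime_lift[OF cop_b' _ M(2)] D6 by auto
  have "[int k = int b'] (mod int (nat D))"
    using k(2) by (simp only: cong_int_iff)
  then have "[int k = b] (mod D)"
    using D6 by (simp add: b' cong_def)
  then have "[a * int k = a * b] (mod D)"
    by (rule cong_scalar_left)
  then have "[a * int k = 1] (mod D)"
    using b by (rule cong_trans)
  then have "D dvd a * int k - 1"
    by (simp add: cong_iff_dvd_diff)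
  then obtain t where t: "a * int k - 1 = D * t"
    by (elim dvdE)
  then have "a * int k = 1 + D * t"
    by simp
  then have "real_of_int (a * int k) = real_of_int (1 + D * t)"
    by (rule arg_cong)
  then have "pi * real_of_int (a * int k) / D = pi / D + pi * of_int t"
    using D6 by (simp add: field_simps)
  then have cos_ak: "cos (pi * real_of_int (a * int k) / D) = cos (pi / D)
      \<or> cos (pi * real_of_int (a * int k) / D) = - cos (pi / D)"
    by (simp only: cos_add_int_pi) simp
  have "S \<noteq> {}"
    using S by auto
  obtain C1 where S1: "vieta_system (vieta_conj M k S) C1" and "C1 = 4 \<longleftrightarrow> C = 4"
    and cd1: "common_denominator M D (vieta_conj M k S)"
    using vieta_system_conj[OF M(2) cd k(1,3) \<open>S \<noteq> {}\<close>] by metis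
  interpret V1: vieta_system "vieta_conj M k S" C1
    by (rule S1)
  have DM: "2 * D dvd int M"
    by (rule NM) fact
  have "conj_rel M k x (2 * cos (pi * real_of_int (a * int k) / D))"
    unfolding a(2) by (rule conj_rel_cos) (use D6 DM M(2) in auto)
  moreover obtain y1 where "conj_rel M k y y1"
    using conj_rel_exists[OF rotate[OF S(1)] cd M(2)] by blast
  ultimately obtain z1 where S1_el: "(2 * cos (pi * real_of_int (a * int k) / D), y1, z1) \<in> vieta_conj M k S"
    using vieta_conj_exists[OF S(1) cd M(2)] by blast
  obtain y2 z2 where w: "(2 * cos (pi / D), y2, z2) \<in> vieta_conj M k S"
    using cos_ak
  proof
    assume "cos (pi * real_of_int (a * int k) / D) = cos (pi / D)"
    then show ?thesis
      using S1_el that by simp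
  next
    assume "cos (pi * real_of_int (a * int k) / D) = - cos (pi / D)"
    then show ?thesis
      using V1.neg'[OF S1_el] that by simp
  qed
  have "C1 \<le> 4"
    by (rule V1.markov_le_4) (use w in auto)
  then have "C1 < 4"
    using \<open>C1 = 4 \<longleftrightarrow> C = 4\<close> \<open>C \<noteq> 4\<close> by linarith
  obtain u b c where u: "(2 * cos (pi / D), 0, u) \<in> vieta_conj M k S"
    "u = 2 * cos (pi * real_of_int b / real_of_int c)"
    and c: "0 < c" "c \<le> D" "D < 2 * c" "odd c" "2 * c dvd int M"
      "(c - 2 * b) mod (2 * c) = 1 \<or> (c - 2 * b) mod (2 * c) = 2 * c - 1"
    by (rule V1.spherical_normal_form[OF \<open>C1 < 4\<close> cd1 evM D6 w]) (rule that)
  define c' D' where "c' = nat c" and "D' = nat D"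
  have c': "int c' = c" "int D' = D"
    using c(1) D6 by (simp_all add: c'_def D'_def)
  have "odd (int c')" "int c' \<le> int D'" "int D' < int (2 * c')" "int 6 \<le> int D'"
    using c D6 by (simp_all add: c')
  then have "odd c'" "c' \<le> D'" "D' < 2 * c'" "6 \<le> D'"
    by (simp_all only: even_of_nat of_nat_le_iff of_nat_less_iff not_False_eq_True)
  then obtain r where r: "coprime r (2 * c' * D')" "\<bar>sin (pi * r / D')\<bar> \<le> \<bar>sin (pi * r / (2 * c'))\<bar>"
    using exists_bad_residue by blast
  have pos: "2 * c' * D' > 0"
  proof -
    have "0 < c'" "0 < D'"
      using \<open>6 \<le> D'\<close> \<open>D' < 2 * c'\<close> by linarith+
    then show ?thesis by simp
  qed
  obtain k' where k': "k' > 0" "[k' = r] (mod 2 * c' * D')" "coprime k' M"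
    using exists_coprime_lift[OF r(1) pos M(2)] by blast
  have "odd k'"
    using k'(3) evM by (metis coprime_common_divisor odd_one)
  obtain C2 where S2: "vieta_system (vieta_conj M k' (vieta_conj M k S)) C2" and "C2 = 4 \<longleftrightarrow> C1 = 4"
    using V1.vieta_system_conj[OF M(2) cd1 k'(1,3)] w by (metis emptyE)
  interpret V2: vieta_system "vieta_conj M k' (vieta_conj M k S)" C2
    by (rule S2)
  have "conj_rel M k' (2 * cos (pi * real_of_int 1 / D)) (2 * cos (pi * real_of_int (1 * int k') / D))"
    by (rule conj_rel_cos) (use D6 DM M(2) in auto)
  then have "conj_rel M k' (2 * cos (pi / D)) (2 * cos (pi * k' / D))"
    by simp
  moreover have "conj_rel M k' u (2 * cos (pi * real_of_int (b * int k') / c))"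
    unfolding u(2) by (rule conj_rel_cos) (use c M(2) in auto)
  moreover have "conj_rel M k' 0 0"
    using conj_rel_of_int[of M k' 0] by simp
  ultimately have el: "(2 * cos (pi * k' / D), 0, 2 * cos (pi * real_of_int (b * int k') / c))
      \<in> vieta_conj M k' (vieta_conj M k S)"
    using u(1) unfolding vieta_conj_def[of M k' "vieta_conj M k S"] by blast
  have "C2 \<le> 4"
    by (rule V2.markov_le_4) (use el in auto)
  then have "C2 < 4"
    using \<open>C2 = 4 \<longleftrightarrow> C1 = 4\<close> \<open>C1 < 4\<close> by linarith
  \<comment> \<open>With a middle entry 0 the constant is a sum of two squares; C2 < 4 then says the
    opposite of the choice of \<open>r\<close>.\<close>
  then have "(cos (pi * k' / D))\<^sup>2 + (cos (pi * real_of_int (b * int k') / c))\<^sup>2 < 1"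
    using V2.markov[OF el] by (simp add: power_mult_distrib)
  then have "\<bar>cos (pi * real_of_int (b * int k') / c)\<bar>\<^sup>2 < \<bar>sin (pi * k' / D)\<bar>\<^sup>2"
    by (simp add: sin_squared_eq)
  then have "\<bar>cos (pi * real_of_int (b * int k') / c)\<bar> < \<bar>sin (pi * k' / D)\<bar>"
    by (rule power2_less_imp_less) simp
  then have "\<bar>sin (pi * k' / (2 * c))\<bar> < \<bar>sin (pi * k' / D)\<bar>"
    by (simp only: abs_cos_half_shift[OF c(1) \<open>odd k'\<close> c(6)])
  moreover have "\<bar>sin (pi * k' / D')\<bar> = \<bar>sin (pi * r / D')\<bar>"
    by (rule abs_sin_cong[OF cong_dvd_modulus_nat[OF k'(2)]]) (use \<open>6 \<le> D'\<close> in auto)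
  moreover have "\<bar>sin (pi * k' / real (2 * c'))\<bar> = \<bar>sin (pi * r / real (2 * c'))\<bar>"
    by (rule abs_sin_cong[OF cong_dvd_modulus_nat[OF k'(2)]]) (use pos in auto)
  moreover have "real c' = c" "real D' = D"
    using c' by (metis of_int_of_nat_eq)+
  ultimately show False
    using r(2) by simp
qed

end

section \<open>Rank 3 subquivers\<close>

text \<open>With a, b, c the entries for i to j, j to k, k to i, equal signs mean an oriented
  triangle. The signed product is the term that turns the sum of squares into the mutation invariant
  \<open>mark\<close>.\<close>

definition cyc :: "real \<Rightarrow> real \<Rightarrow> real \<Rightarrow> real" where
  "cyc a b c = (if (a > 0 \<and> b > 0 \<and> c > 0) \<or> (a < 0 \<and> b < 0 \<and> c < 0)
     then \<bar>a\<bar> * \<bar>b\<bar> * \<bar>c\<bar> else - (\<bar>a\<bar> * \<bar>b\<bar> * \<bar>c\<bar>))"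

definition mark :: "real \<Rightarrow> real \<Rightarrow> real \<Rightarrow> real" where
  "mark a b c = a\<^sup>2 + b\<^sup>2 + c\<^sup>2 - cyc a b c"

definition two_nonzero :: "real \<Rightarrow> real \<Rightarrow> real \<Rightarrow> bool" where
  "two_nonzero a b c \<longleftrightarrow> (a \<noteq> 0 \<or> b \<noteq> 0) \<and> (b \<noteq> 0 \<or> c \<noteq> 0) \<and> (a \<noteq> 0 \<or> c \<noteq> 0)"

definition mutation_term :: "real \<Rightarrow> real \<Rightarrow> real" where
  "mutation_term p q = (\<bar>p\<bar> * q + p * \<bar>q\<bar>) / 2"

lemma mutation_term_simps:
  "p \<ge> 0 \<Longrightarrow> q \<ge> 0 \<Longrightarrow> mutation_term p q = p * q"
  "p \<le> 0 \<Longrightarrow> q \<le> 0 \<Longrightarrow> mutation_term p q = - (p * q)"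
  "p \<ge> 0 \<Longrightarrow> q \<le> 0 \<Longrightarrow> mutation_term p q = 0"
  "p \<le> 0 \<Longrightarrow> q \<ge> 0 \<Longrightarrow> mutation_term p q = 0"
  by (simp_all add: mutation_term_def)

lemma cyc_rotate: "cyc b c a = cyc a b c"
  by (auto simp: cyc_def mult_ac)

lemma cyc_reverse: "cyc (- a) (- c) (- b) = cyc a b c"
  by (auto simp: cyc_def mult_ac)

text \<open>The condition a c > 0 says that a path runs through vertex i, so mutation there changes
  b by the product. With s the sign of a, xz is ac or -ac and the fixed product makes y equal to sb
  or -sb accordingly; since s b' = s b - a c, the move matches b' up to that sign.\<close>

lemma cyc_vieta:
  assumes "a * c > 0" "\<bar>x\<bar> = \<bar>a\<bar>" "\<bar>y\<bar> = \<bar>b\<bar>" "\<bar>z\<bar> = \<bar>c\<bar>" "x * y * z = cyc a b c"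
    and b': "b' = b + mutation_term (- a) (- c)"
  shows "\<bar>x * z - y\<bar> = \<bar>b'\<bar>" "x * (x * z - y) * z = cyc (- a) b' (- c)"
proof -
  define s where "s = sgn a"
  have s: "s = 1 \<and> a > 0 \<and> c > 0 \<or> s = - 1 \<and> a < 0 \<and> c < 0"
    using assms(1) by (auto simp: s_def zero_less_mult_iff)
  have b'_eq: "b' = b - s * (a * c)"
    using s by (auto simp: b' mutation_term_def)
  have cyc1: "cyc a b c = a * c * (s * b)"
    using s by (auto simp: cyc_def abs_if mult_ac)
  have cyc2: "cyc (- a) b' (- c) = a * c * (- s * b')"
    using s by (auto simp: cyc_def abs_if mult_ac)
  have "\<bar>x * z\<bar> = \<bar>a * c\<bar>"
    using assms by (simp add: abs_mult)
  then have xz: "x * z = a * c \<or> x * z = - (a * c)"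
    by linarith
  have prod: "(x * z) * y = (a * c) * (s * b)"
    using assms(5) cyc1 by (simp add: mult_ac)
  have y: "x * z = a * c \<and> y = s * b \<or> x * z = - (a * c) \<and> y = - (s * b)"
    using xz
  proof
    assume "x * z = a * c"
    moreover from this have "(a * c) * y = (a * c) * (s * b)"
      using prod by simp
    then have "y = s * b"
      by (rule mult_left_cancel[THEN iffD1, rotated]) (use assms(1) in linarith)
    ultimately show ?thesis by blast
  next
    assume "x * z = - (a * c)"
    moreover from this have "(a * c) * (- y) = (a * c) * (s * b)"
      using prod by simp
    then have "- y = s * b"
      by (rule mult_left_cancel[THEN iffD1, rotated]) (use assms(1) in linarith)
    ultimately show ?thesis by (metis minus_minus)
  qed
  have ss: "s * s = 1"
    using s by auto
  have sb': "s * b' = s * b - a * c"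
    by (simp add: b'_eq algebra_simps) (metis ss mult.assoc mult.commute mult_1)
  have cases: "x * z = a * c \<and> x * z - y = - (s * b') \<or> x * z = - (a * c) \<and> x * z - y = s * b'"
    using y sb' by auto
  then have "x * z - y = - (s * b') \<or> x * z - y = s * b'"
    by blast
  moreover have "\<bar>s * b'\<bar> = \<bar>b'\<bar>"
    using s by auto
  ultimately show "\<bar>x * z - y\<bar> = \<bar>b'\<bar>"
    by auto
  have "x * (x * z - y) * z = (x * z) * (x * z - y)"
    by (simp add: mult_ac)
  also have "\<dots> = a * c * (- s * b')"
    using cases
  proof (elim disjE conjE)
    assume "x * z = a * c" "x * z - y = - (s * b')"
    then show ?thesis
      by (simp only: minus_mult_left)
  next
    assume "x * z = - (a * c)" "x * z - y = s * b'"
    then show ?thesis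
      by (simp only: minus_mult_left minus_mult_right[symmetric])
  qed
  finally show "x * (x * z - y) * z = cyc (- a) b' (- c)"
    using cyc2 by simp
qed

lemma cyc_source_sink:
  assumes "a * c < 0" "b * c \<le> 0"
  shows "cyc a (- b) (- c) = cyc a b c"
  using assms by (auto simp: cyc_def mult_less_0_iff mult_le_0_iff)

text \<open>Closure under reversal of all arrows allows the orientation of a triangle to be chosen
  freely.\<close>

locale mutation_closed =
  fixes Q :: "(real ^ 'n ^ 'n) set"
  assumes finite_Q: "finite Q"
    and skew: "B \<in> Q \<Longrightarrow> B $ j $ i = - B $ i $ j"
    and mutation_in: "B \<in> Q \<Longrightarrow> mutation k B \<in> Q"
    and uminus_in: "B \<in> Q \<Longrightarrow> - B \<in> Q"
begin

text \<open>The signs only record whether the triangle is oriented: every choice with product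
  \<open>cyc\<close> is allowed, which gives closure under \<open>neg\<close>.\<close>

definition triples :: "(real \<times> real \<times> real) set" where
  "triples = {(x, y, z). \<exists>B\<in>Q. \<exists>i j k. i \<noteq> j \<and> j \<noteq> k \<and> i \<noteq> k \<and>
     \<bar>x\<bar> = \<bar>B $ i $ j\<bar> \<and> \<bar>y\<bar> = \<bar>B $ j $ k\<bar> \<and> \<bar>z\<bar> = \<bar>B $ k $ i\<bar> \<and>
     x * y * z = cyc (B $ i $ j) (B $ j $ k) (B $ k $ i)}"

lemma triplesI:
  assumes "B \<in> Q" "i \<noteq> j" "j \<noteq> k" "i \<noteq> k"
    "\<bar>x\<bar> = \<bar>B $ i $ j\<bar>" "\<bar>y\<bar> = \<bar>B $ j $ k\<bar>" "\<bar>z\<bar> = \<bar>B $ k $ i\<bar>"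
    "x * y * z = cyc (B $ i $ j) (B $ j $ k) (B $ k $ i)"
  shows "(x, y, z) \<in> triples"
  using assms unfolding triples_def by blast

lemma triplesE:
  assumes "(x, y, z) \<in> triples"
  obtains B i j k where "B \<in> Q" "i \<noteq> j" "j \<noteq> k" "i \<noteq> k"
    "\<bar>x\<bar> = \<bar>B $ i $ j\<bar>" "\<bar>y\<bar> = \<bar>B $ j $ k\<bar>" "\<bar>z\<bar> = \<bar>B $ k $ i\<bar>"
    "x * y * z = cyc (B $ i $ j) (B $ j $ k) (B $ k $ i)"
  using assms unfolding triples_def by blast

lemma skew_diag: "B \<in> Q \<Longrightarrow> B $ i $ i = 0"
  using skew[of B i i] by simp

definition weights :: "real set" where
  "weights = {\<bar>B $ i $ j\<bar> | B i j. B \<in> Q}"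

lemma finite_weights: "finite weights"
proof -
  have "weights = (\<Union>B\<in>Q. \<Union>i. \<Union>j. {\<bar>B $ i $ j\<bar>})"
    by (auto simp: weights_def)
  then show ?thesis
    using finite_Q by simp
qed

lemma finite_triples: "finite triples"
proof -
  have fin: "finite {x. \<bar>x\<bar> \<in> weights}"
    by (rule finite_subset[of _ "weights \<union> uminus ` weights"])
      (use finite_weights in \<open>auto simp: abs_if image_iff split: if_splits\<close>,
        metis minus_minus)
  have "triples \<subseteq> {x. \<bar>x\<bar> \<in> weights} \<times> {x. \<bar>x\<bar> \<in> weights} \<times> {x. \<bar>x\<bar> \<in> weights}"
    unfolding triples_def weights_def by auto
  then show ?thesis
    by (rule finite_subset) (use fin in simp)
qed

lemma triples_rotate: "(x, y, z) \<in> triples \<Longrightarrow> (y, z, x) \<in> triples"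
proof (erule triplesE)
  fix B i j k
  assume "B \<in> Q" "i \<noteq> j" "j \<noteq> k" "i \<noteq> k"
    "\<bar>x\<bar> = \<bar>B $ i $ j\<bar>" "\<bar>y\<bar> = \<bar>B $ j $ k\<bar>" "\<bar>z\<bar> = \<bar>B $ k $ i\<bar>"
    "x * y * z = cyc (B $ i $ j) (B $ j $ k) (B $ k $ i)"
  then show ?thesis
    by (intro triplesI[of B j k i]) (simp_all add: cyc_rotate[of "B $ j $ k"] mult_ac)
qed

lemma triples_swap: "(x, y, z) \<in> triples \<Longrightarrow> (x, z, y) \<in> triples"
proof (erule triplesE)
  fix B i j k
  assume B: "B \<in> Q" "i \<noteq> j" "j \<noteq> k" "i \<noteq> k"
    "\<bar>x\<bar> = \<bar>B $ i $ j\<bar>" "\<bar>y\<bar> = \<bar>B $ j $ k\<bar>" "\<bar>z\<bar> = \<bar>B $ k $ i\<bar>"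
    "x * y * z = cyc (B $ i $ j) (B $ j $ k) (B $ k $ i)"
  have e: "B $ j $ i = - B $ i $ j" "B $ i $ k = - B $ k $ i" "B $ k $ j = - B $ j $ k"
    using skew B(1) by blast+
  show ?thesis
    by (rule triplesI[of B j i k]) (use B in \<open>simp_all add: e cyc_reverse mult_ac\<close>)
qed

lemma triples_neg: "(x, y, z) \<in> triples \<Longrightarrow> (x, - y, - z) \<in> triples"
  by (erule triplesE, rule triplesI) simp_all

lemma mutation_entry:
  "i \<noteq> k \<Longrightarrow> j \<noteq> k \<Longrightarrow> mutation k B $ i $ j = B $ i $ j + mutation_term (B $ i $ k) (B $ k $ j)"
  "mutation k B $ k $ j = - B $ k $ j"
  "mutation k B $ i $ k = - B $ i $ k"
  by (simp_all add: mutation_def mutation_term_def)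

text \<open>If a path runs through \<open>i\<close>, mutation at \<open>i\<close> is the Vieta move
  by \<open>cyc_vieta\<close>; if one of the two arrows at \<open>i\<close> is missing, the move is
  a mere sign change.\<close>

lemma triples_vieta:
  assumes "(x, y, z) \<in> triples"
  shows "(x, x * z - y, z) \<in> triples"
proof -
  have pos: "(x, x * z - y, z) \<in> triples"
    if B: "B \<in> Q" "i \<noteq> j" "j \<noteq> k" "i \<noteq> k"
      "\<bar>x\<bar> = \<bar>B $ i $ j\<bar>" "\<bar>y\<bar> = \<bar>B $ j $ k\<bar>" "\<bar>z\<bar> = \<bar>B $ k $ i\<bar>"
      "x * y * z = cyc (B $ i $ j) (B $ j $ k) (B $ k $ i)"
      and ac: "B $ i $ j * B $ k $ i > 0" for B i j k
  proof (rule triplesI[of "mutation i B" i j k])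
    have e: "B $ j $ i = - B $ i $ j" "B $ i $ k = - B $ k $ i"
      using skew B(1) by blast+
    have b': "mutation i B $ j $ k = B $ j $ k + mutation_term (- B $ i $ j) (- B $ k $ i)"
      using B by (simp add: mutation_entry e)
    note v = cyc_vieta[OF ac B(5-8) b']
    show "\<bar>x * z - y\<bar> = \<bar>mutation i B $ j $ k\<bar>"
      by (rule v(1))
    show "x * (x * z - y) * z = cyc (mutation i B $ i $ j) (mutation i B $ j $ k) (mutation i B $ k $ i)"
      unfolding mutation_entry(2,3) by (rule v(2))
    show "\<bar>x\<bar> = \<bar>mutation i B $ i $ j\<bar>" "\<bar>z\<bar> = \<bar>mutation i B $ k $ i\<bar>"
      unfolding mutation_entry(2,3) abs_minus_cancel by (rule B)+
    show "mutation i B \<in> Q" "i \<noteq> j" "j \<noteq> k" "i \<noteq> k"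
      using B mutation_in by blast+
  qed
  obtain B i j k where B: "B \<in> Q" "i \<noteq> j" "j \<noteq> k" "i \<noteq> k"
      "\<bar>x\<bar> = \<bar>B $ i $ j\<bar>" "\<bar>y\<bar> = \<bar>B $ j $ k\<bar>" "\<bar>z\<bar> = \<bar>B $ k $ i\<bar>"
      "x * y * z = cyc (B $ i $ j) (B $ j $ k) (B $ k $ i)"
    using assms by (rule triplesE)
  have e: "B $ j $ i = - B $ i $ j" "B $ i $ k = - B $ k $ i" "B $ k $ j = - B $ j $ k"
    using skew B(1) by blast+
  consider "B $ i $ j * B $ k $ i > 0" | "B $ i $ j * B $ k $ i = 0" | "B $ i $ j * B $ k $ i < 0"
    by linarith
  then show ?thesis
  proof cases
    case 1
    then show ?thesis
      using pos[OF B] by blast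
  next
    case 2
    then have xz: "x * z = 0"
      using B(5,7) by auto
    then have "x * y * z = 0" "x * (- y) * z = 0"
      by auto
    then have "(x, - y, z) \<in> triples"
      by (intro triplesI[of B i j k]) (use B in simp_all)
    then show ?thesis
      by (simp add: xz)
  next
    case 3
    \<comment> \<open>Now \<open>i\<close> is a source or sink of the triangle. So is one of
      \<open>k\<close> and \<open>j\<close>; mutating there keeps the three weights and reverses
      exactly one arrow at \<open>i\<close>, which creates a path through \<open>i\<close>.\<close>
    show ?thesis
    proof (cases "B $ j $ k * B $ k $ i \<le> 0")
      case True
      have 1: "mutation k B $ i $ j = B $ i $ j"
        using B(2-4) True by (auto simp: mutation_entry e mutation_term_def abs_if mult_le_0_iff)
      have "cyc (B $ i $ j) (- B $ j $ k) (- B $ k $ i) = cyc (B $ i $ j) (B $ j $ k) (B $ k $ i)"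
        by (rule cyc_source_sink[OF 3 True])
      then show ?thesis
        by (intro pos[OF mutation_in[OF B(1), of k] B(2-4)]) (use B(5-8) 3 in \<open>simp_all add: 1 mutation_entry(2,3)\<close>)
    next
      case False
      then have ba: "B $ j $ k * B $ i $ j \<le> 0"
        using 3 by (auto simp: mult_le_0_iff mult_less_0_iff)
      have 1: "mutation j B $ k $ i = B $ k $ i"
        using B(2-4) ba by (auto simp: mutation_entry e mutation_term_def abs_if mult_le_0_iff)
      have "cyc (- B $ i $ j) (- B $ j $ k) (B $ k $ i) = cyc (B $ i $ j) (B $ j $ k) (B $ k $ i)"
        using cyc_source_sink[of "B $ k $ i" "B $ i $ j" "B $ j $ k"] 3 ba
        by (auto simp: cyc_def mult_ac mult_le_0_iff mult_less_0_iff)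
      then show ?thesis
        by (intro pos[OF mutation_in[OF B(1), of j] B(2-4)]) (use B(5-8) 3 in \<open>simp_all add: 1 mutation_entry(2,3)\<close>)
    qed
  qed
qed

definition markov_triples :: "real \<Rightarrow> (real \<times> real \<times> real) set" where
  "markov_triples C = {(x, y, z). (x, y, z) \<in> triples \<and> two_nonzero x y z \<and> x\<^sup>2 + y\<^sup>2 + z\<^sup>2 - x * y * z = C}"

lemma vieta_system_markov_triples: "vieta_system (markov_triples C) C"
proof
  show "finite (markov_triples C)"
    by (rule finite_subset[OF _ finite_triples]) (auto simp: markov_triples_def)
  show "(y, z, x) \<in> markov_triples C" if S: "(x, y, z) \<in> markov_triples C" for x y z
    using S triples_rotate[of x y z] by (auto simp: markov_triples_def two_nonzero_def algebra_simps)
  show "(x, z, y) \<in> markov_triples C" if S: "(x, y, z) \<in> markov_triples C" for x y z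
    using S triples_swap[of x y z] by (auto simp: markov_triples_def two_nonzero_def algebra_simps)
  show "(x, - y, - z) \<in> markov_triples C" if S: "(x, y, z) \<in> markov_triples C" for x y z
    using S triples_neg[of x y z] by (auto simp: markov_triples_def two_nonzero_def)
  show "(x, z, x * z - y) \<in> markov_triples C" if S: "(x, y, z) \<in> markov_triples C" for x y z
  proof -
    have "x\<^sup>2 + z\<^sup>2 + (x * z - y)\<^sup>2 - x * z * (x * z - y) = x\<^sup>2 + y\<^sup>2 + z\<^sup>2 - x * y * z"
      by algebra
    moreover have "two_nonzero x z (x * z - y)"
      using S by (auto simp: markov_triples_def two_nonzero_def)
    ultimately show ?thesis
      using S triples_swap[OF triples_vieta, of x y z] by (simp add: markov_triples_def)
  qed
  show "y \<noteq> 0 \<or> z \<noteq> 0" if S: "(x, y, z) \<in> markov_triples C" for x y z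
    using S by (auto simp: markov_triples_def two_nonzero_def)
  show "x\<^sup>2 + y\<^sup>2 + z\<^sup>2 - x * y * z = C" if S: "(x, y, z) \<in> markov_triples C" for x y z
    using S by (simp add: markov_triples_def)
qed

lemma markov_triplesI:
  assumes "B \<in> Q" "i \<noteq> j" "j \<noteq> k" "i \<noteq> k" "two_nonzero (B $ i $ j) (B $ j $ k) (B $ k $ i)"
    and C: "mark (B $ i $ j) (B $ j $ k) (B $ k $ i) = C"
  shows "\<exists>z. (B $ i $ j, \<bar>B $ j $ k\<bar>, z) \<in> markov_triples C"
proof -
  let ?a = "B $ i $ j" and ?b = "B $ j $ k" and ?c = "B $ k $ i"
  obtain z where z: "\<bar>z\<bar> = \<bar>?c\<bar>" "?a * \<bar>?b\<bar> * z = cyc ?a ?b ?c"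
  proof (cases "?a * \<bar>?b\<bar> * ?c = cyc ?a ?b ?c")
    case False
    then have "?a * \<bar>?b\<bar> * - ?c = cyc ?a ?b ?c"
      by (auto simp: cyc_def abs_if split: if_splits)
    then show ?thesis
      using that[of "- ?c"] by simp
  qed (use that[of ?c] in simp)
  have "?a\<^sup>2 + \<bar>?b\<bar>\<^sup>2 + z\<^sup>2 = ?a\<^sup>2 + ?b\<^sup>2 + ?c\<^sup>2"
    using z(1) by (metis power2_abs)
  then have "(?a, \<bar>?b\<bar>, z) \<in> markov_triples C"
    using triplesI[OF assms(1-4), of ?a "\<bar>?b\<bar>" z] z assms(5) C
    by (auto simp: markov_triples_def mark_def two_nonzero_def)
  then show ?thesis by blast
qed

lemma mark_le_4:
  assumes "B \<in> Q" "i \<noteq> j" "j \<noteq> k" "i \<noteq> k" "two_nonzero (B $ i $ j) (B $ j $ k) (B $ k $ i)"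
  shows "mark (B $ i $ j) (B $ j $ k) (B $ k $ i) \<le> 4"
  using markov_triplesI[OF assms HOL.refl] vieta_system.markov_le_4[OF vieta_system_markov_triples] by blast

lemma mark_eq_4:
  assumes "B \<in> Q" "i \<noteq> j" "j \<noteq> k" "i \<noteq> k" "two_nonzero (B $ i $ j) (B $ j $ k) (B $ k $ i)"
    and "denominator (B $ i $ j) d" "d \<ge> 6"
  shows "mark (B $ i $ j) (B $ j $ k) (B $ k $ i) = 4"
  using markov_triplesI[OF assms(1-5) HOL.refl] assms(6,7)
    vieta_system.markov_eq_4_of_denominator[OF vieta_system_markov_triples] by blast

end

section \<open>The normal form of a Euclidean subquiver\<close>

context vieta_system begin

text \<open>For C = 4 the amplitude relation of \<open>rotation\<close> reads R^2 (4 - x^2) = 4 (4 -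
  x^2), and |x| < 2 because n > 1; hence R = 2.\<close>

lemma euclidean_phases:
  fixes a n :: int
  assumes C: "C = 4" and S: "(x, y, z) \<in> S" and x: "x = 2 * cos (pi * a / n)" and n: "n > 1" "coprime a n"
  obtains \<phi> where "y = 2 * cos \<phi>"
    "\<And>j::int. (x, 2 * cos (\<phi> + pi * j / n), 2 * cos (\<phi> + pi * real_of_int (j + a) / n)) \<in> S"
proof -
  obtain R \<phi> where R: "R \<ge> 0" "R\<^sup>2 * (4 - x\<^sup>2) = 4 * (C - x\<^sup>2)" "y = R * cos \<phi>"
    and ph: "\<And>j::int. (x, R * cos (\<phi> + pi * j / n), R * cos (\<phi> + pi * real_of_int (j + a) / n)) \<in> S"
    using S x n by (rule rotation) (rule that)
  have "\<not> n dvd a"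
    using n coprime_common_divisor[of a n n] by auto
  then have "\<bar>cos (pi * a / n)\<bar> \<le> cos (pi / n)"
    using abs_cos_rational_le n by simp
  also have "\<dots> < cos 0"
    using n by (intro cos_monotone_0_pi) (auto simp: field_simps)
  finally have "\<bar>x\<bar> < 2"
    by (simp add: x abs_mult)
  then have "\<bar>x\<bar>\<^sup>2 < 2\<^sup>2"
    by (intro power_strict_mono) auto
  then have "x\<^sup>2 < 2\<^sup>2"
    by simp
  then have "4 - x\<^sup>2 \<noteq> 0"
    by simp
  moreover have "R\<^sup>2 * (4 - x\<^sup>2) = 2\<^sup>2 * (4 - x\<^sup>2)"
    unfolding R(2) C by simp
  ultimately have "R\<^sup>2 = 2\<^sup>2"
    by (metis mult_right_cancel)
  then have "R = 2"
    using R(1) power2_eq_imp_eq by (metis zero_le_numeral)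
  then show ?thesis
    using that[of \<phi>] R(3) ph by simp
qed

text \<open>A phase within pi/(2n) of 0 gives a weight above m, which by maximality is 2, so that
  phase is exactly 0. All phases are then multiples of pi/n, and the phase next to 0 yields 2 cos
  (pi/n) <= m.\<close>

lemma euclidean_max:
  assumes C: "C = 4" and S: "(m, y, z) \<in> S" and n: "denominator m n" "n > 2" "m > 0"
    and max: "\<And>x y z. (x, y, z) \<in> S \<Longrightarrow> x < 2 \<Longrightarrow> x \<le> m"
  shows "m = 2 * cos (pi / n)" "(2, m, m) \<in> S" "\<exists>j::int. y = 2 * cos (pi * j / n)"
proof -
  obtain a where a: "n > 0" "coprime a n" "m = 2 * cos (pi * real_of_int a / n)"
    using n(1) by (rule denominatorE)
  have n1: "n > 1" using n by simp
  have n3: "real_of_int n \<ge> 3" using n(2) by simp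
  have "\<not> n dvd a"
    using n1 a(2) coprime_common_divisor[of a n n] by auto
  then have m_le: "m \<le> 2 * cos (pi / n)"
    using abs_cos_rational_le[OF a(1), of a] a(3) by linarith
  obtain \<phi> where \<phi>: "y = 2 * cos \<phi>"
    "\<And>j::int. (m, 2 * cos (\<phi> + pi * j / n), 2 * cos (\<phi> + pi * real_of_int (j + a) / n)) \<in> S"
    using C S a(3) n1 a(2) by (rule euclidean_phases) (rule that)
  obtain j :: int where j: "\<bar>\<phi> + pi * j / n\<bar> \<le> pi / (2 * n)"
    using exists_int_shift_near[OF a(1)] by blast
  have lt: "pi / (2 * n) < pi / n" "pi / n \<le> pi / 3" "0 < pi / (2 * n)"
    using n3 divide_left_mono[of 3 "real_of_int n" pi] by (simp_all add: field_simps)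
  have "cos (pi / n) < cos (pi / (2 * n))"
    using lt by (intro cos_monotone_0_pi) linarith+
  also have "cos (pi / (2 * n)) \<le> cos \<bar>\<phi> + pi * j / n\<bar>"
    using j lt by (intro cos_monotone_0_pi_le) linarith+
  also have "\<dots> = cos (\<phi> + pi * j / n)"
    by simp
  finally have "m < 2 * cos (\<phi> + pi * j / n)"
    using m_le by simp
  then have "\<not> 2 * cos (\<phi> + pi * j / n) < 2"
    using max[OF rotate[OF \<phi>(2)[of j]]] by fastforce
  then have cos1: "cos (\<phi> + pi * j / n) = 1"
    using cos_le_one[of "\<phi> + pi * j / n"] by linarith
  then have "(2, 2 * cos (\<phi> + pi * real_of_int (j + a) / n), m) \<in> S"
    using rotate[OF \<phi>(2)[of j]] by simp
  with markov_eq_4_of_entry_2(2)[OF this] show "(2, m, m) \<in> S"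
    by simp
  have "\<phi> + pi * j / n = 0"
  proof (rule ccontr)
    assume "\<phi> + pi * j / n \<noteq> 0"
    then have "cos \<bar>\<phi> + pi * j / n\<bar> < cos 0"
      using j lt by (intro cos_monotone_0_pi) linarith+
    then show False
      using cos1 by simp
  qed
  then have \<phi>_eq: "\<phi> = - (pi * j / n)"
    by simp
  then show "\<exists>j::int. y = 2 * cos (pi * j / n)"
    using \<phi>(1) by auto
  have "\<phi> + pi * real_of_int (j + 1) / n = pi / n"
    by (simp add: \<phi>_eq add_divide_distrib distrib_left)
  then have "(2 * cos (pi / n), 2 * cos (\<phi> + pi * real_of_int (j + 1 + a) / n), m) \<in> S"
    using rotate[OF \<phi>(2)[of "j + 1"]] by simp
  moreover have "cos (pi / n) < cos 0"
    using lt by (intro cos_monotone_0_pi) linarith+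
  ultimately have "2 * cos (pi / n) \<le> m"
    using max by fastforce
  then show "m = 2 * cos (pi / n)"
    using m_le by simp
qed

text \<open>Some phase lies in (0, pi/n], hence in (0, pi/6]. This forces the largest weight below 2
  to be at least sqrt 3.\<close>

lemma euclidean_large_entry:
  assumes C: "C = 4" and S: "(x, y, z) \<in> S" and n: "denominator x n" "n \<ge> 6"
  shows "\<exists>v y z. (v, y, z) \<in> S \<and> sqrt 3 \<le> v \<and> v < 2"
proof -
  obtain a where a: "n > 0" "coprime a n" "x = 2 * cos (pi * real_of_int a / n)"
    using n(1) by (rule denominatorE)
  have n1: "n > 1" using n by simp
  have n6: "real_of_int n \<ge> 6" using n(2) by simp
  have lt: "0 < pi / n" "pi / n \<le> pi / 6"
    using n6 divide_left_mono[of 6 "real_of_int n" pi] by simp_all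
  obtain \<phi> where \<phi>: "y = 2 * cos \<phi>"
    "\<And>j::int. (x, 2 * cos (\<phi> + pi * j / n), 2 * cos (\<phi> + pi * real_of_int (j + a) / n)) \<in> S"
    using C S a(3) n1 a(2) by (rule euclidean_phases) (rule that)
  have good: "sqrt 3 \<le> 2 * cos t \<and> 2 * cos t < 2" if "0 < t" "t \<le> pi / n" for t
  proof -
    have "cos (pi / 6) \<le> cos t"
      using that lt by (intro cos_monotone_0_pi_le) linarith+
    moreover have "cos t < cos 0"
      using that lt by (intro cos_monotone_0_pi) linarith+
    ultimately show ?thesis
      by (simp add: cos_30)
  qed
  obtain j :: int where j: "0 \<le> \<phi> + pi * j / n" "\<phi> + pi * j / n < 0 + pi / n"
    using exists_int_shift_floor[OF a(1), of 0 \<phi>] by blast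
  obtain j' :: int where "0 < \<phi> + pi * j' / n" "\<phi> + pi * j' / n \<le> pi / n"
  proof (cases "\<phi> + pi * j / n = 0")
    case True
    have "\<phi> + pi * real_of_int (j + 1) / n = (\<phi> + pi * j / n) + pi / n"
      by (simp add: add_divide_distrib distrib_left)
    then show ?thesis
      using that[of "j + 1"] True lt by simp
  next
    case False
    then show ?thesis
      using that[of j] j by simp
  qed
  then show ?thesis
    using good rotate[OF \<phi>(2)[of j']] by blast
qed

end

lemma quiver_connected_boundary:
  assumes "quiver_connected B" "u \<in> A" "v \<notin> A"
  shows "\<exists>i\<in>A. \<exists>j. j \<notin> A \<and> B $ i $ j \<noteq> 0"
proof (rule ccontr)
  assume none: "\<not> ?thesis"
  have "(joined B)\<^sup>*\<^sup>* u v"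
    using assms(1) by (simp add: quiver_connected_def)
  then have "v \<in> A"
    by (induction rule: rtranclp_induct) (use assms(2) none in \<open>auto simp: joined_def\<close>)
  then show False
    using assms(3) by simp
qed

text \<open>On a double arrow an oriented triangle has constant 4 + (b - c)^2, any other one 4 +
  (|b| + |c|)^2.\<close>

lemma mark_2_le_4:
  assumes "mark 2 b c \<le> 4"
  shows "b = c \<and> b \<ge> 0"
proof -
  have le: "b\<^sup>2 + c\<^sup>2 \<le> cyc 2 b c"
    using assms by (simp add: mark_def)
  show ?thesis
  proof (cases "b > 0 \<and> c > 0")
    case True
    then have "cyc 2 b c = 2 * b * c"
      by (simp add: cyc_def)
    then have "(b - c)\<^sup>2 \<le> 0"
      using le by (simp add: power2_diff)
    then show ?thesis
      using True by simp
  next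
    case False
    then have "cyc 2 b c = - (2 * \<bar>b\<bar> * \<bar>c\<bar>)"
      by (auto simp: cyc_def)
    moreover have "0 \<le> 2 * \<bar>b\<bar> * \<bar>c\<bar>"
      by simp
    ultimately have "b\<^sup>2 + c\<^sup>2 \<le> 0"
      using le by linarith
    then show ?thesis
      by (simp add: sum_power2_le_zero_iff)
  qed
qed

context mutation_closed begin

lemma exists_normal_form:
  fixes d :: int
  assumes connected: "\<And>B. B \<in> Q \<Longrightarrow> quiver_connected B" and card: "CARD('n) \<ge> 3"
    and B0: "B0 \<in> Q" "denominator (B0 $ i0 $ j0) d" "d \<ge> 6"
  obtains n x B i j k where "n \<ge> 6" "x = 2 * cos (pi / real_of_int n)" "denominator x n"
    "\<And>u v w. (u, v, w) \<in> markov_triples 4 \<Longrightarrow> u < 2 \<Longrightarrow> u \<le> x"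
    "B \<in> Q" "i \<noteq> j" "j \<noteq> k" "i \<noteq> k" "B $ i $ j = 2" "B $ j $ k = x" "B $ k $ i = x"
proof -
  interpret E: vieta_system "markov_triples 4" 4
    by (rule vieta_system_markov_triples)
  have nz: "B0 $ i0 $ j0 \<noteq> 0"
  proof
    assume "B0 $ i0 $ j0 = 0"
    moreover have "denominator 0 2"
      unfolding denominator_def by (intro conjI exI[of _ 1]) simp_all
    ultimately have "d = 2"
      using B0(2) denominator_unique by metis
    then show False
      using B0(3) by simp
  qed
  then have ij0: "i0 \<noteq> j0"
    using skew_diag[OF B0(1)] by auto
  have "card {i0, j0} \<noteq> CARD('n)"
    using card ij0 by simp
  then have "{i0, j0} \<noteq> UNIV"
    by metis
  then obtain v where "v \<notin> {i0, j0}"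
    by blast
  then obtain u k0 where k0: "u \<in> {i0, j0}" "k0 \<notin> {i0, j0}" "B0 $ u $ k0 \<noteq> 0"
    using quiver_connected_boundary[OF connected[OF B0(1)], of i0 "{i0, j0}" v] by blast
  have tn: "two_nonzero (B0 $ i0 $ j0) (B0 $ j0 $ k0) (B0 $ k0 $ i0)"
    using k0 nz skew[OF B0(1), of k0 i0] by (auto simp: two_nonzero_def)
  have dist: "j0 \<noteq> k0" "i0 \<noteq> k0"
    using k0 by auto
  obtain z0 where z0: "(B0 $ i0 $ j0, \<bar>B0 $ j0 $ k0\<bar>, z0) \<in> markov_triples 4"
    using markov_triplesI[OF B0(1) ij0 dist tn mark_eq_4[OF B0(1) ij0 dist tn B0(2,3)]] by blast
  obtain v0 y1 z1 where v0: "(v0, y1, z1) \<in> markov_triples 4" "sqrt 3 \<le> v0" "v0 < 2"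
    using E.euclidean_large_entry[OF HOL.refl z0 B0(2,3)] by blast
  define V where "V = {u \<in> fst ` markov_triples 4. u < 2}"
  have "finite V"
    using E.finite_S by (simp add: V_def)
  have "v0 \<in> V"
    unfolding V_def using v0 by force
  define m where "m = Max V"
  have "m \<in> V" "v0 \<le> m"
    unfolding m_def using \<open>finite V\<close> \<open>v0 \<in> V\<close> by (auto intro: Max_in)
  then obtain y z where m: "(m, y, z) \<in> markov_triples 4" "m < 2" "sqrt 3 \<le> m"
    using v0(2) by (auto simp: V_def)
  have max: "u \<le> m" if "(u, v, w) \<in> markov_triples 4" "u < 2" for u v w
    unfolding m_def using \<open>finite V\<close> by (rule Max_ge) (use that in \<open>force simp: V_def\<close>)
  obtain n where n: "denominator m n"
    using E.entry_denominator[OF m(1)] by blast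
  then obtain a where a: "n > 0" "coprime a n" "m = 2 * cos (pi * real_of_int a / n)"
    by (rule denominatorE)
  \<comment> \<open>Denominators 2 to 5 give weights below 2 cos (pi/6) = sqrt 3, and denominator 1
    only 2 and -2.\<close>
  have n6: "n \<ge> 6"
  proof (rule ccontr)
    assume "\<not> n \<ge> 6"
    then have n5: "n \<le> 5" by simp
    have m0: "m > 0"
      using m(3) real_sqrt_gt_zero[of 3] by linarith
    have "n \<noteq> 1"
      using a(3) m(2) m0 by (auto simp: cos_npi_int split: if_splits)
    then have n2: "n \<ge> 2" using a(1) by simp
    then have "\<not> n dvd a"
      using a(2) coprime_common_divisor[of a n n] by auto
    then have "m \<le> 2 * cos (pi / n)"
      using abs_cos_rational_le[OF a(1), of a] a(3) by linarith
    moreover have "cos (pi / n) < cos (pi / 6)"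
    proof (rule cos_monotone_0_pi)
      have "real_of_int n \<le> 5" "real_of_int n \<ge> 2"
        using n5 n2 by simp_all
      then have "pi / 5 \<le> pi / n" "pi / n \<le> pi / 2"
        by (intro divide_left_mono; simp)+
      then show "pi / 6 < pi / n" "pi / n \<le> pi"
        using pi_gt_zero by linarith+
    qed simp
    ultimately show False
      using m(3) by (simp add: cos_30)
  qed
  have "m > 0"
    using m(3) real_sqrt_gt_zero[of 3] by linarith
  have "n > 2" using n6 by simp
  have em: "m = 2 * cos (pi / n)" "(2, m, m) \<in> markov_triples 4"
    by (rule E.euclidean_max[OF HOL.refl m(1) n \<open>n > 2\<close> \<open>m > 0\<close>], rule max, assumption+)+
  have "(2, m, m) \<in> triples"
    using em(2) by (simp add: markov_triples_def)
  then obtain B i j k where B: "B \<in> Q" "i \<noteq> j" "j \<noteq> k" "i \<noteq> k"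
    "\<bar>2\<bar> = \<bar>B $ i $ j\<bar>" "\<bar>m\<bar> = \<bar>B $ j $ k\<bar>" "\<bar>m\<bar> = \<bar>B $ k $ i\<bar>"
    "2 * m * m = cyc (B $ i $ j) (B $ j $ k) (B $ k $ i)"
    by (rule triplesE)
  \<comment> \<open>A positive product means an oriented triangle; if it runs the wrong way,
    \<open>- B\<close> is taken.\<close>
  have "cyc (B $ i $ j) (B $ j $ k) (B $ k $ i) > 0"
    unfolding B(8)[symmetric] using \<open>m > 0\<close> by simp
  moreover have "0 \<le> \<bar>B $ i $ j\<bar> * \<bar>B $ j $ k\<bar> * \<bar>B $ k $ i\<bar>"
    by simp
  then have "\<not> 0 < - (\<bar>B $ i $ j\<bar> * \<bar>B $ j $ k\<bar> * \<bar>B $ k $ i\<bar>)"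
    by linarith
  ultimately have "B $ i $ j > 0 \<and> B $ j $ k > 0 \<and> B $ k $ i > 0
      \<or> B $ i $ j < 0 \<and> B $ j $ k < 0 \<and> B $ k $ i < 0"
    unfolding cyc_def by (auto split: if_splits)
  then show ?thesis
  proof
    assume "B $ i $ j > 0 \<and> B $ j $ k > 0 \<and> B $ k $ i > 0"
    then show ?thesis
      using B \<open>m > 0\<close> by (intro that[OF n6 em(1) n max B(1-4)]) auto
  next
    assume "B $ i $ j < 0 \<and> B $ j $ k < 0 \<and> B $ k $ i < 0"
    then show ?thesis
      using B \<open>m > 0\<close> by (intro that[OF n6 em(1) n max uminus_in[OF B(1)] B(2-4)]) auto
  qed
qed

end

locale normal_form = mutation_closed Q for Q :: "(real ^ 'n ^ 'n) set" +
  fixes x :: real and n :: int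
  assumes n6: "n \<ge> 6" and x_eq: "x = 2 * cos (pi / real_of_int n)" and x_den: "denominator x n"
    and x_max: "(u, v, w) \<in> markov_triples 4 \<Longrightarrow> u < 2 \<Longrightarrow> u \<le> x"
begin

lemma x_bounds: "x\<^sup>2 \<ge> 3" "x < 2" "x > 0"
proof -
  have "real_of_int n \<ge> 6"
    using n6 by simp
  then have n: "0 < pi / n" "pi / n \<le> pi / 6"
    using divide_left_mono[of 6 "real_of_int n" pi] by simp_all
  then have "cos (pi / 6) \<le> cos (pi / n)" "cos (pi / n) < cos 0"
    by (intro cos_monotone_0_pi_le cos_monotone_0_pi; linarith)+
  then have s: "sqrt 3 \<le> x" "x < 2"
    by (simp_all add: x_eq cos_30)
  then show "x < 2" by simp
  have "(sqrt 3)\<^sup>2 \<le> x\<^sup>2"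
    using s(1) by (intro power_mono) auto
  then show "x\<^sup>2 \<ge> 3" by simp
  have "0 < sqrt (3::real)" by simp
  then show "x > 0"
    using s(1) by linarith
qed

text \<open>The test applied to every triangle in the final case analysis: a weight x has
  denominator n >= 6 and thus demands the constant 4 exactly.\<close>

definition admissible :: "real \<Rightarrow> real \<Rightarrow> real \<Rightarrow> bool" where
  "admissible a b c \<longleftrightarrow> (two_nonzero a b c \<longrightarrow>
     mark a b c \<le> 4 \<and> (\<bar>a\<bar> = x \<or> \<bar>b\<bar> = x \<or> \<bar>c\<bar> = x \<longrightarrow> mark a b c = 4))"

lemma mark_rotate: "mark b c a = mark a b c"
  by (simp add: mark_def cyc_rotate)

lemma two_nonzero_rotate: "two_nonzero b c a = two_nonzero a b c"
  by (auto simp: two_nonzero_def)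

lemma admissible_triple:
  assumes "B \<in> Q" "i \<noteq> j" "j \<noteq> k" "i \<noteq> k"
  shows "admissible (B $ i $ j) (B $ j $ k) (B $ k $ i)"
  unfolding admissible_def
proof (intro impI conjI)
  assume tn: "two_nonzero (B $ i $ j) (B $ j $ k) (B $ k $ i)"
  then show "mark (B $ i $ j) (B $ j $ k) (B $ k $ i) \<le> 4"
    by (rule mark_le_4[OF assms])
  have den: "denominator t n" if "\<bar>t\<bar> = x" for t
    using that x_den denominator_minus[OF x_den] by (auto simp: abs_if split: if_splits)
  have dist: "j \<noteq> i" "k \<noteq> j" "k \<noteq> i"
    using assms by auto
  assume "\<bar>B $ i $ j\<bar> = x \<or> \<bar>B $ j $ k\<bar> = x \<or> \<bar>B $ k $ i\<bar> = x"
  then show "mark (B $ i $ j) (B $ j $ k) (B $ k $ i) = 4"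
  proof (elim disjE)
    assume "\<bar>B $ i $ j\<bar> = x"
    then show ?thesis
      by (intro mark_eq_4[OF assms tn _ n6] den)
  next
    assume "\<bar>B $ j $ k\<bar> = x"
    then have "mark (B $ j $ k) (B $ k $ i) (B $ i $ j) = 4"
      using assms tn by (intro mark_eq_4[OF _ _ _ _ _ _ n6] den) (auto simp: two_nonzero_rotate)
    then show ?thesis
      by (simp only: mark_rotate)
  next
    assume "\<bar>B $ k $ i\<bar> = x"
    then have "mark (B $ k $ i) (B $ i $ j) (B $ j $ k) = 4"
      using assms tn by (intro mark_eq_4[OF _ _ _ _ _ _ n6] den) (auto simp: two_nonzero_def)
    then show ?thesis
      by (simp only: mark_rotate)
  qed
qed

text \<open>The possible weights \<open>y\<close> to the ends of the double arrow and \<open>p\<close> to the apex of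
  the normal form, for a vertex outside of it.\<close>

definition attachment :: "real \<Rightarrow> real \<Rightarrow> bool" where
  "attachment y p \<longleftrightarrow> y \<ge> 0 \<and> (y = 0 \<and> p = 0 \<or> even n \<and> y\<^sup>2 = 4 - x\<^sup>2 \<and> p = 0 \<or>
     even n \<and> y = 0 \<and> p\<^sup>2 = 4 - x\<^sup>2 \<or> odd n \<and> y\<^sup>2 = 2 - x \<and> \<bar>p\<bar> = y)"

lemma double_arrow:
  assumes "B \<in> Q" "i \<noteq> j" "j \<noteq> v" "i \<noteq> v" "B $ i $ j = 2"
  shows "B $ j $ v = B $ v $ i \<and> B $ j $ v \<ge> 0"
proof (cases "B $ j $ v = 0 \<and> B $ v $ i = 0")
  case False
  then have "two_nonzero 2 (B $ j $ v) (B $ v $ i)"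
    by (auto simp: two_nonzero_def)
  then have "mark 2 (B $ j $ v) (B $ v $ i) \<le> 4"
    using mark_le_4[OF assms(1-4)] assms(5) by simp
  then show ?thesis
    by (rule mark_2_le_4)
qed simp

text \<open>The triangle on \<open>k\<close>, \<open>i\<close>, \<open>v\<close> contains the weight
  x and is not oriented, so x^2 + y^2 + p^2 + xy|p| = 4 unless y = p = 0. This gives y <= 2 sin
  (pi/n), while by \<open>euclidean_max\<close> y is 2 cos of a multiple of pi/n; few values
  remain.\<close>

lemma attachment_of_vertex:
  assumes B: "B \<in> Q" "i \<noteq> j" "j \<noteq> k" "i \<noteq> k" "B $ i $ j = 2" "B $ k $ i = x"
    and v: "v \<noteq> i" "v \<noteq> j" "v \<noteq> k"
  shows "attachment (B $ j $ v) (B $ k $ v)"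
proof -
  interpret E: vieta_system "markov_triples 4" 4
    by (rule vieta_system_markov_triples)
  define y p where "y = B $ j $ v" and "p = B $ k $ v"
  have y: "B $ v $ i = y" "y \<ge> 0"
    using double_arrow[of B i j v] B v by (auto simp: y_def)
  have iv: "B $ i $ v = - y"
    using skew[OF B(1), of i v] y(1) by simp
  have vk: "B $ v $ k = - p"
    using skew[OF B(1), of v k] by (simp add: p_def)
  have dist: "k \<noteq> i" "i \<noteq> v" "k \<noteq> v"
    using B v by auto
  show ?thesis
  proof (cases "y = 0 \<and> p = 0")
    case True
    then show ?thesis
      by (simp add: attachment_def y_def p_def)
  next
    case False
    then have tn: "two_nonzero (B $ k $ i) (B $ i $ v) (B $ v $ k)"
      using x_bounds(3) by (auto simp: two_nonzero_def iv vk B(6))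
    have mk: "mark (B $ k $ i) (B $ i $ v) (B $ v $ k) = 4"
      by (rule mark_eq_4[OF B(1) dist tn _ n6]) (simp add: B(6) x_den)
    then have "mark x (- y) (- p) = 4"
      by (simp only: B(6) iv vk)
    then have eq: "x\<^sup>2 + y\<^sup>2 + \<bar>p\<bar>\<^sup>2 + x * y * \<bar>p\<bar> = 4"
      using x_bounds(3) y(2) by (simp add: mark_def cyc_def)
    obtain z where z: "(x, y, z) \<in> markov_triples 4"
      using markov_triplesI[OF B(1) dist tn mk] y(2) by (auto simp: B(6) iv)
    have "n > 2" using n6 by simp
    have "\<exists>l::int. y = 2 * cos (pi * l / n)"
      by (rule E.euclidean_max(3)[OF HOL.refl z x_den \<open>n > 2\<close> x_bounds(3)]) (rule x_max)
    then obtain l :: int where l: "y = 2 * cos (pi * l / n)"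
      by blast
    \<comment> \<open>From here on \<open>i\<close> is the complementary angle in units of pi/(2n),
      so y = 2 |sin (pi i/(2n))|. Its parity is that of n, which separates the cases of
      \<open>attachment\<close>.\<close>
    define i where "i = (n - 2 * l) mod (2 * n)"
    have i: "0 \<le> i" "i < 2 * n"
      using n6 by (simp_all add: i_def)
    have n0: "real_of_int n > 0"
      using n6 by simp
    have "pi * real_of_int (n - 2 * l) / real_of_int (2 * n) = pi / 2 - pi * l / n"
      using n0 by (simp add: field_simps)
    then have y_sin: "y = 2 * \<bar>sin (pi * real_of_int (n - 2 * l) / real_of_int (2 * n))\<bar>"
      using y(2) unfolding l by (simp add: sin_diff)
    have x_sin: "4 - x\<^sup>2 = (2 * sin (pi / n))\<^sup>2"
      unfolding x_eq power_mult_distrib sin_squared_eq by simp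
    have "pi / n \<le> pi / 6" "0 < pi / n"
      using n6 divide_left_mono[of 6 "real_of_int n" pi] by simp_all
    then have small: "0 < pi / n" "pi / n \<le> pi / 6" "3 * pi / (2 * n) \<le> pi / 2" "pi / n < 3 * pi / (2 * n)"
      using n0 by (simp_all add: field_simps)
    have sin_n: "sin (pi / n) > 0"
      using small by (intro sin_gt_zero) linarith+
    have "0 \<le> x * y * \<bar>p\<bar>" "0 \<le> \<bar>p\<bar>\<^sup>2"
      using x_bounds(3) y(2) by simp_all
    then have "y\<^sup>2 \<le> (2 * sin (pi / n))\<^sup>2"
      using eq x_sin by linarith
    then have y_le: "y \<le> 2 * sin (pi / n)"
      by (rule power2_le_imp_le) (use sin_n in simp)
    have "\<not> (3 \<le> i \<and> i \<le> 2 * n - 3)"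
    proof
      assume "3 \<le> i \<and> i \<le> 2 * n - 3"
      then have "sin (pi * real_of_int 3 / real_of_int (2 * n)) \<le> \<bar>sin (pi * real_of_int (n - 2 * l) / real_of_int (2 * n))\<bar>"
        using n6 unfolding i_def by (intro abs_sin_rational_ge; linarith)
      then have "2 * sin (3 * pi / (2 * n)) \<le> y"
        unfolding y_sin by (simp add: mult.commute)
      moreover have "sin (pi / n) < sin (3 * pi / (2 * n))"
        using small pi_gt_zero by (intro sin_monotone_2pi; linarith)
      ultimately show False
        using y_le by linarith
    qed
    then have i_cases: "i = 0 \<or> i = 1 \<or> i = 2 \<or> i = 2 * n - 1 \<or> i = 2 * n - 2"
      using i by linarith
    have "n - 2 * l = i + 2 * n * ((n - 2 * l) div (2 * n))"
      by (simp add: i_def)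
    then obtain q where q: "n - 2 * l = i + 2 * n * q"
      by blast
    have par: "even n \<longleftrightarrow> even i"
      using arg_cong[OF q, of even] by simp
    have "pi * real_of_int (n - 2 * l) / real_of_int (2 * n) = pi * real_of_int (i + 2 * n * q) / real_of_int (2 * n)"
      by (simp only: q)
    also have "\<dots> = pi * i / (2 * n) + pi * of_int q"
      using n0 by (simp add: field_simps)
    finally have y_i: "y = 2 * \<bar>sin (pi * i / (2 * n))\<bar>"
      unfolding y_sin by (simp only: abs_sin_add_int_pi)
    have refl_i: "\<bar>sin (pi * real_of_int (2 * n - m) / (2 * n))\<bar> = \<bar>sin (pi * m / (2 * n))\<bar>" for m :: int
    proof -
      have "pi * real_of_int (2 * n - m) / (2 * n) = pi - pi * m / (2 * n)"
        using n0 by (simp add: field_simps)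
      then show ?thesis
        by (simp only: sin_pi_minus)
    qed
    have y_cases: "even n \<and> y = 0 \<or> even n \<and> y\<^sup>2 = 4 - x\<^sup>2 \<or> odd n \<and> y\<^sup>2 = 2 - x"
    proof -
      have 1: "y\<^sup>2 = 2 - x" if "y = 2 * \<bar>sin (pi * real_of_int 1 / (2 * n))\<bar>"
      proof -
        have "cos (pi / n) = cos (2 * (pi / (2 * n)))"
          by simp
        then have "x = 2 - 4 * (sin (pi / (2 * n)))\<^sup>2"
          unfolding x_eq cos_double_sin by simp
        then show ?thesis
          unfolding that by (simp add: power_mult_distrib)
      qed
      have 2: "y\<^sup>2 = 4 - x\<^sup>2" if "y = 2 * \<bar>sin (pi * real_of_int 2 / (2 * n))\<bar>"
        unfolding that x_sin by (simp add: power_mult_distrib)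
      from i_cases show ?thesis
      proof (elim disjE)
        assume "i = 0"
        then show ?thesis using y_i par by simp
      next
        assume "i = 1"
        then show ?thesis using y_i par 1 by simp
      next
        assume "i = 2"
        then show ?thesis using y_i par 2 by simp
      next
        assume ii: "i = 2 * n - 1"
        then have "odd n" using par by simp
        moreover have "y = 2 * \<bar>sin (pi * real_of_int 1 / (2 * n))\<bar>"
          unfolding y_i ii by (simp only: refl_i)
        ultimately show ?thesis using 1 by blast
      next
        assume ii: "i = 2 * n - 2"
        then have "even n" using par by simp
        moreover have "y = 2 * \<bar>sin (pi * real_of_int 2 / (2 * n))\<bar>"
          unfolding y_i ii by (simp only: refl_i)
        ultimately show ?thesis using 2 by blast
      qed
    qed
    have "attachment y p"
      using y_cases
    proof (elim disjE conjE)
      assume "even n" "y = 0"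
      then show ?thesis
        using eq by (simp add: attachment_def)
    next
      assume e: "even n" "y\<^sup>2 = 4 - x\<^sup>2"
      then have "\<bar>p\<bar>\<^sup>2 + x * y * \<bar>p\<bar> = 0"
        using eq by simp
      then have "\<bar>p\<bar>\<^sup>2 = 0"
        using \<open>0 \<le> x * y * \<bar>p\<bar>\<close> \<open>0 \<le> \<bar>p\<bar>\<^sup>2\<close> by linarith
      then show ?thesis
        using e y(2) by (simp add: attachment_def)
    next
      assume o: "odd n" "y\<^sup>2 = 2 - x"
      \<comment> \<open>For y^2 = 2 - x the quadratic equation for |p| has the roots y and -y (1 +
        x), the second one negative.\<close>
      have "(\<bar>p\<bar> - y) * (\<bar>p\<bar> + y * (1 + x)) = (\<bar>p\<bar>\<^sup>2 + x * y * \<bar>p\<bar>) - y\<^sup>2 * (1 + x)"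
        by (simp only: power2_eq_square algebra_simps)
      also have "\<bar>p\<bar>\<^sup>2 + x * y * \<bar>p\<bar> = 4 - x\<^sup>2 - y\<^sup>2"
        using eq by linarith
      also have "4 - x\<^sup>2 - y\<^sup>2 - y\<^sup>2 * (1 + x) = 0"
        unfolding o(2) by (simp add: power2_eq_square algebra_simps)
      finally have "(\<bar>p\<bar> - y) * (\<bar>p\<bar> + y * (1 + x)) = 0" .
      moreover have "y > 0"
        using o(2) y(2) x_bounds(2) by (cases "y = 0") auto
      then have "\<bar>p\<bar> + y * (1 + x) > 0"
        using x_bounds(3) by (intro add_nonneg_pos mult_pos_pos) auto
      ultimately have "\<bar>p\<bar> = y"
        by simp
      then show ?thesis
        using o y(2) by (simp add: attachment_def)
    qed
    then show ?thesis
      by (simp add: y_def p_def)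
  qed
qed

end

section \<open>Extending the normal form by two vertices\<close>

context normal_form begin

text \<open>The entries above the diagonal are arguments, so that mutations act on explicit
  expressions. In use, 1 and 2 bound the double arrow, 3 is the apex, and 4 and 5 are the further
  vertices.\<close>

definition quiv where
  "quiv b12 b13 b14 b15 b23 b24 b25 b34 b35 b45 \<longleftrightarrow>
     (\<exists>B\<in>Q. \<exists>v1 v2 v3 v4 v5. distinct [v1, v2, v3, v4, v5] \<and>
        B $ v1 $ v2 = b12 \<and> B $ v1 $ v3 = b13 \<and> B $ v1 $ v4 = b14 \<and> B $ v1 $ v5 = b15 \<and>
        B $ v2 $ v3 = b23 \<and> B $ v2 $ v4 = b24 \<and> B $ v2 $ v5 = b25 \<and>
        B $ v3 $ v4 = b34 \<and> B $ v3 $ v5 = b35 \<and> B $ v4 $ v5 = b45)"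

lemma quivI:
  assumes "B \<in> Q" "distinct [v1, v2, v3, v4, v5]"
    "B $ v1 $ v2 = b12" "B $ v1 $ v3 = b13" "B $ v1 $ v4 = b14" "B $ v1 $ v5 = b15"
    "B $ v2 $ v3 = b23" "B $ v2 $ v4 = b24" "B $ v2 $ v5 = b25"
    "B $ v3 $ v4 = b34" "B $ v3 $ v5 = b35" "B $ v4 $ v5 = b45"
  shows "quiv b12 b13 b14 b15 b23 b24 b25 b34 b35 b45"
  using assms unfolding quiv_def by blast

lemma quivE:
  assumes "quiv b12 b13 b14 b15 b23 b24 b25 b34 b35 b45"
  obtains B v1 v2 v3 v4 v5 where "B \<in> Q" "distinct [v1, v2, v3, v4, v5]"
    "B $ v1 $ v2 = b12" "B $ v1 $ v3 = b13" "B $ v1 $ v4 = b14" "B $ v1 $ v5 = b15"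
    "B $ v2 $ v3 = b23" "B $ v2 $ v4 = b24" "B $ v2 $ v5 = b25"
    "B $ v3 $ v4 = b34" "B $ v3 $ v5 = b35" "B $ v4 $ v5 = b45"
    "B $ v2 $ v1 = - b12" "B $ v3 $ v1 = - b13" "B $ v4 $ v1 = - b14" "B $ v5 $ v1 = - b15"
    "B $ v3 $ v2 = - b23" "B $ v4 $ v2 = - b24" "B $ v5 $ v2 = - b25"
    "B $ v4 $ v3 = - b34" "B $ v5 $ v3 = - b35" "B $ v5 $ v4 = - b45"
proof -
  obtain B v1 v2 v3 v4 v5 where B: "B \<in> Q" "distinct [v1, v2, v3, v4, v5]"
    "B $ v1 $ v2 = b12" "B $ v1 $ v3 = b13" "B $ v1 $ v4 = b14" "B $ v1 $ v5 = b15"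
    "B $ v2 $ v3 = b23" "B $ v2 $ v4 = b24" "B $ v2 $ v5 = b25"
    "B $ v3 $ v4 = b34" "B $ v3 $ v5 = b35" "B $ v4 $ v5 = b45"
    using assms unfolding quiv_def by blast
  note s = skew[OF B(1)]
  show ?thesis
    by (rule that[OF B]; subst s; simp only: B(3-12))
qed

lemma quiv_mut1:
  assumes "quiv b12 b13 b14 b15 b23 b24 b25 b34 b35 b45"
  shows "quiv (- b12) (- b13) (- b14) (- b15)
    (b23 + mutation_term (- b12) b13) (b24 + mutation_term (- b12) b14) (b25 + mutation_term (- b12) b15)
    (b34 + mutation_term (- b13) b14) (b35 + mutation_term (- b13) b15) (b45 + mutation_term (- b14) b15)"
  using assms
proof (rule quivE)
  fix B v1 v2 v3 v4 v5
  assume B: "B \<in> Q" "distinct [v1, v2, v3, v4, v5]"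
    and e: "B $ v1 $ v2 = b12" "B $ v1 $ v3 = b13" "B $ v1 $ v4 = b14" "B $ v1 $ v5 = b15"
    "B $ v2 $ v3 = b23" "B $ v2 $ v4 = b24" "B $ v2 $ v5 = b25"
    "B $ v3 $ v4 = b34" "B $ v3 $ v5 = b35" "B $ v4 $ v5 = b45"
    "B $ v2 $ v1 = - b12" "B $ v3 $ v1 = - b13" "B $ v4 $ v1 = - b14" "B $ v5 $ v1 = - b15"
    "B $ v3 $ v2 = - b23" "B $ v4 $ v2 = - b24" "B $ v5 $ v2 = - b25"
    "B $ v4 $ v3 = - b34" "B $ v5 $ v3 = - b35" "B $ v5 $ v4 = - b45"
  show ?thesis
    by (rule quivI[OF mutation_in[OF B(1), of v1] B(2)]; insert B(2); simp add: mutation_entry e; auto simp: mutation_entry e)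
qed

lemma quiv_mut3:
  assumes "quiv b12 b13 b14 b15 b23 b24 b25 b34 b35 b45"
  shows "quiv (b12 + mutation_term b13 (- b23)) (- b13)
    (b14 + mutation_term b13 b34) (b15 + mutation_term b13 b35) (- b23)
    (b24 + mutation_term b23 b34) (b25 + mutation_term b23 b35) (- b34) (- b35)
    (b45 + mutation_term (- b34) b35)"
  using assms
proof (rule quivE)
  fix B v1 v2 v3 v4 v5
  assume B: "B \<in> Q" "distinct [v1, v2, v3, v4, v5]"
    and e: "B $ v1 $ v2 = b12" "B $ v1 $ v3 = b13" "B $ v1 $ v4 = b14" "B $ v1 $ v5 = b15"
    "B $ v2 $ v3 = b23" "B $ v2 $ v4 = b24" "B $ v2 $ v5 = b25"
    "B $ v3 $ v4 = b34" "B $ v3 $ v5 = b35" "B $ v4 $ v5 = b45"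
    "B $ v2 $ v1 = - b12" "B $ v3 $ v1 = - b13" "B $ v4 $ v1 = - b14" "B $ v5 $ v1 = - b15"
    "B $ v3 $ v2 = - b23" "B $ v4 $ v2 = - b24" "B $ v5 $ v2 = - b25"
    "B $ v4 $ v3 = - b34" "B $ v5 $ v3 = - b35" "B $ v5 $ v4 = - b45"
  show ?thesis
    by (rule quivI[OF mutation_in[OF B(1), of v3] B(2)]; insert B(2); simp add: mutation_entry e; auto simp: mutation_entry e)
qed

lemma quiv_mut4:
  assumes "quiv b12 b13 b14 b15 b23 b24 b25 b34 b35 b45"
  shows "quiv (b12 + mutation_term b14 (- b24)) (b13 + mutation_term b14 (- b34)) (- b14)
    (b15 + mutation_term b14 b45) (b23 + mutation_term b24 (- b34)) (- b24)
    (b25 + mutation_term b24 b45) (- b34) (b35 + mutation_term b34 b45) (- b45)"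
  using assms
proof (rule quivE)
  fix B v1 v2 v3 v4 v5
  assume B: "B \<in> Q" "distinct [v1, v2, v3, v4, v5]"
    and e: "B $ v1 $ v2 = b12" "B $ v1 $ v3 = b13" "B $ v1 $ v4 = b14" "B $ v1 $ v5 = b15"
    "B $ v2 $ v3 = b23" "B $ v2 $ v4 = b24" "B $ v2 $ v5 = b25"
    "B $ v3 $ v4 = b34" "B $ v3 $ v5 = b35" "B $ v4 $ v5 = b45"
    "B $ v2 $ v1 = - b12" "B $ v3 $ v1 = - b13" "B $ v4 $ v1 = - b14" "B $ v5 $ v1 = - b15"
    "B $ v3 $ v2 = - b23" "B $ v4 $ v2 = - b24" "B $ v5 $ v2 = - b25"
    "B $ v4 $ v3 = - b34" "B $ v5 $ v3 = - b35" "B $ v5 $ v4 = - b45"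
  show ?thesis
    by (rule quivI[OF mutation_in[OF B(1), of v4] B(2)]; insert B(2); simp add: mutation_entry e; auto simp: mutation_entry e)
qed

lemma quiv_mut5:
  assumes "quiv b12 b13 b14 b15 b23 b24 b25 b34 b35 b45"
  shows "quiv (b12 + mutation_term b15 (- b25)) (b13 + mutation_term b15 (- b35))
    (b14 + mutation_term b15 (- b45)) (- b15) (b23 + mutation_term b25 (- b35))
    (b24 + mutation_term b25 (- b45)) (- b25) (b34 + mutation_term b35 (- b45)) (- b35) (- b45)"
  using assms
proof (rule quivE)
  fix B v1 v2 v3 v4 v5
  assume B: "B \<in> Q" "distinct [v1, v2, v3, v4, v5]"
    and e: "B $ v1 $ v2 = b12" "B $ v1 $ v3 = b13" "B $ v1 $ v4 = b14" "B $ v1 $ v5 = b15"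
    "B $ v2 $ v3 = b23" "B $ v2 $ v4 = b24" "B $ v2 $ v5 = b25"
    "B $ v3 $ v4 = b34" "B $ v3 $ v5 = b35" "B $ v4 $ v5 = b45"
    "B $ v2 $ v1 = - b12" "B $ v3 $ v1 = - b13" "B $ v4 $ v1 = - b14" "B $ v5 $ v1 = - b15"
    "B $ v3 $ v2 = - b23" "B $ v4 $ v2 = - b24" "B $ v5 $ v2 = - b25"
    "B $ v4 $ v3 = - b34" "B $ v5 $ v3 = - b35" "B $ v5 $ v4 = - b45"
  show ?thesis
    by (rule quivI[OF mutation_in[OF B(1), of v5] B(2)]; insert B(2); simp add: mutation_entry e; auto simp: mutation_entry e)
qed

lemma quiv_swap45:
  assumes "quiv b12 b13 b14 b15 b23 b24 b25 b34 b35 b45"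
  shows "quiv b12 b13 b15 b14 b23 b25 b24 b35 b34 (- b45)"
  using assms
proof (rule quivE)
  fix B v1 v2 v3 v4 v5
  assume B: "B \<in> Q" "distinct [v1, v2, v3, v4, v5]"
    and e: "B $ v1 $ v2 = b12" "B $ v1 $ v3 = b13" "B $ v1 $ v4 = b14" "B $ v1 $ v5 = b15"
    "B $ v2 $ v3 = b23" "B $ v2 $ v4 = b24" "B $ v2 $ v5 = b25"
    "B $ v3 $ v4 = b34" "B $ v3 $ v5 = b35" "B $ v5 $ v4 = - b45"
  show ?thesis
    by (rule quivI[OF B(1), of v1 v2 v3 v5 v4]) (use B e in auto)
qed

text \<open>Reversing all arrows and exchanging the ends of the double arrow fixes the triangle and
  the weights y, and negates p and q. It halves the sign cases.\<close>

lemma quiv_reverse12: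
  assumes "quiv b12 b13 b14 b15 b23 b24 b25 b34 b35 b45"
  shows "quiv b12 (- b23) (- b24) (- b25) (- b13) (- b14) (- b15) (- b34) (- b35) (- b45)"
  using assms
proof (rule quivE)
  fix B v1 v2 v3 v4 v5
  assume B: "B \<in> Q" "distinct [v1, v2, v3, v4, v5]"
    and e: "B $ v1 $ v3 = b13" "B $ v1 $ v4 = b14" "B $ v1 $ v5 = b15"
    "B $ v2 $ v3 = b23" "B $ v2 $ v4 = b24" "B $ v2 $ v5 = b25"
    "B $ v3 $ v4 = b34" "B $ v3 $ v5 = b35" "B $ v4 $ v5 = b45" "B $ v2 $ v1 = - b12"
  show ?thesis
    by (rule quivI[OF uminus_in[OF B(1)], of v2 v1 v3 v4 v5]) (use B e in auto)
qed

lemma quiv_admissible: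
  assumes "quiv b12 b13 b14 b15 b23 b24 b25 b34 b35 b45"
  shows "admissible b12 b25 (- b15)" "admissible b13 b35 (- b15)"
    "admissible b23 b35 (- b25)" "admissible b34 b45 (- b35)"
proof -
  obtain B v1 v2 v3 v4 v5 where B: "B \<in> Q" "distinct [v1, v2, v3, v4, v5]"
    and e: "B $ v1 $ v2 = b12" "B $ v1 $ v3 = b13" "B $ v1 $ v4 = b14" "B $ v1 $ v5 = b15"
    "B $ v2 $ v3 = b23" "B $ v2 $ v4 = b24" "B $ v2 $ v5 = b25"
    "B $ v3 $ v4 = b34" "B $ v3 $ v5 = b35" "B $ v4 $ v5 = b45"
    "B $ v5 $ v1 = - b15" "B $ v5 $ v2 = - b25" "B $ v5 $ v3 = - b35"
    using assms by (rule quivE)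
  show "admissible b12 b25 (- b15)"
    using admissible_triple[OF B(1), of v1 v2 v5] B(2) by (simp add: e)
  show "admissible b13 b35 (- b15)"
    using admissible_triple[OF B(1), of v1 v3 v5] B(2) by (simp add: e)
  show "admissible b23 b35 (- b25)"
    using admissible_triple[OF B(1), of v2 v3 v5] B(2) by (simp add: e)
  show "admissible b34 b45 (- b35)"
    using admissible_triple[OF B(1), of v3 v4 v5] B(2) by (simp add: e)
qed

end

section \<open>Exclusion of each pair of attachments\<close>

lemma mutation_term_pos:
  assumes "s \<ge> 0"
  shows "mutation_term s q \<ge> 0" "mutation_term (- s) q \<le> 0"
    "mutation_term s q - mutation_term (- s) q = s * \<bar>q\<bar>"
  using assms by (cases "q \<ge> 0"; simp add: mutation_term_simps mult_le_0_iff mult_nonneg_nonpos)+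

lemma mark_neg_2_le_4:
  assumes "mark (- 2) b c \<le> 4"
  shows "b = c \<and> b \<le> 0"
proof -
  have "cyc 2 (- c) (- b) = cyc (- 2) b c"
    by (auto simp: cyc_def)
  then have "mark 2 (- c) (- b) \<le> 4"
    using assms by (simp add: mark_def)
  then show ?thesis
    using mark_2_le_4 by fastforce
qed

context normal_form begin

lemma admissible_neg_2:
  assumes "admissible (- 2) b c"
  shows "b = c \<and> b \<le> 0"
proof (cases "b = 0 \<and> c = 0")
  case False
  then have "two_nonzero (- 2) b c"
    by (auto simp: two_nonzero_def)
  then show ?thesis
    using assms mark_neg_2_le_4 unfolding admissible_def by blast
qed simp

lemma admissible_x:
  assumes "admissible a b c" "\<bar>a\<bar> = x" "b \<noteq> 0 \<or> c \<noteq> 0"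
  shows "mark a b c = 4"
proof -
  have "a \<noteq> 0"
    using assms(2) x_bounds(3) by auto
  then have "two_nonzero a b c"
    using assms(3) by (auto simp: two_nonzero_def)
  then show ?thesis
    using assms(1,2) unfolding admissible_def by blast
qed

lemma square_one:
  fixes t s :: real
  assumes "x\<^sup>2 + (s * t)\<^sup>2 = 4" "s\<^sup>2 = 4 - x\<^sup>2"
  shows "t = 1 \<or> t = - 1"
proof -
  have "x\<^sup>2 < 2\<^sup>2"
    using x_bounds by (intro power_strict_mono) auto
  then have "s\<^sup>2 \<noteq> 0"
    using assms(2) by simp
  moreover have "s\<^sup>2 * t\<^sup>2 = s\<^sup>2 * 1"
    using assms unfolding power_mult_distrib by linarith
  ultimately have "t\<^sup>2 = 1"
    using mult_left_cancel by blast
  then show ?thesis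
    by (simp add: power2_eq_1_iff)
qed

text \<open>Mutating at the apex and then at vertex 4 reverses the double arrow.\<close>

lemma no_attachment_to_double_arrow:
  assumes q: "quiv 2 (- x) (- s) (- y) x s y 0 p q"
    and s: "s > 0" "s\<^sup>2 = 4 - x\<^sup>2" and y: "y \<ge> 0" and nz: "y \<noteq> 0 \<or> p \<noteq> 0 \<or> q \<noteq> 0"
  shows False
proof -
  note x = x_bounds
  define y1 y2 where "y1 = y - mutation_term (- x) p" and "y2 = y + mutation_term x p"
  have y12: "y1 \<ge> 0" "y2 \<ge> 0" "y1 + y2 = 2 * y + x * \<bar>p\<bar>"
    using mutation_term_pos[of x p] x(3) y unfolding y1_def y2_def by linarith+
  have "mutation_term (- x) (- x) = - (x * x)" "mutation_term t 0 = 0" "mutation_term 0 t = 0" for t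
    using x(3) by (simp_all add: mutation_term_def)
  then have q3: "quiv (2 - x * x) x (- s) (- y1) (- x) s y2 0 (- p) q"
    using quiv_mut3[OF q] by (simp add: y1_def y2_def)
  define z1 z2 where "z1 = y1 - mutation_term (- s) q" and "z2 = y2 + mutation_term s q"
  have z12: "z1 \<ge> 0" "z2 \<ge> 0" "z1 + z2 = 2 * y + x * \<bar>p\<bar> + s * \<bar>q\<bar>"
    using mutation_term_pos[of s q] s(1) y12 unfolding z1_def z2_def by linarith+
  have "x * \<bar>p\<bar> \<ge> 0" "s * \<bar>q\<bar> \<ge> 0" "p \<noteq> 0 \<Longrightarrow> x * \<bar>p\<bar> > 0" "q \<noteq> 0 \<Longrightarrow> s * \<bar>q\<bar> > 0"
    using x(3) s(1) by simp_all
  then have "z1 + z2 > 0"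
    using z12(3) y nz by linarith
  have "s * s = 4 - x * x"
    using s(2) by (simp add: power2_eq_square)
  then have rev: "2 - x * x + mutation_term (- s) (- s) = - 2"
    using s by (simp add: mutation_term_simps)
  \<comment> \<open>The apex turns 2 into 2 - x^2, and vertex 4 subtracts s^2 = 4 - x^2. Balance
    against -2 needs \<open>z1\<close> and \<open>z2\<close> nonpositive, but both are nonnegative
    with positive sum.\<close>
  have "admissible (- 2) z2 z1"
    using quiv_admissible(1)[OF quiv_mut4[OF q3]] unfolding rev z1_def z2_def by simp
  then show False
    using admissible_neg_2[of z2 z1] z12 \<open>z1 + z2 > 0\<close> by linarith
qed

text \<open>Mutation at 4 turns the arrow of weight x between 1 and 3 into a double one, as x + t^2
  = 2. Vertex 5 must be balanced against it too, which forces all its weights to vanish.\<close>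

lemma no_attachment_odd:
  assumes q: "quiv 2 (- x) (- t) (- y) x t y t p q"
    and t: "t > 0" "t\<^sup>2 = 2 - x" and y: "attachment y p" and n: "odd n"
    and nz: "y \<noteq> 0 \<or> p \<noteq> 0 \<or> q \<noteq> 0"
  shows False
proof -
  note x = x_bounds
  have "t * t = 2 - x"
    using t(2) by (simp add: power2_eq_square)
  then have "- x + mutation_term (- t) (- t) = - 2"
    using t by (simp add: mutation_term_simps)
  then have "admissible (- 2) (p + mutation_term t q) (y - mutation_term (- t) q)"
    using quiv_admissible(2)[OF quiv_mut4[OF q]] by simp
  then have eq: "p + mutation_term t q = y - mutation_term (- t) q" "p + mutation_term t q \<le> 0"
    using admissible_neg_2 by blast+
  have y0: "y \<ge> 0"
    using y by (simp add: attachment_def)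
  show False
  proof (cases "q < 0")
    case True
    then have "- mutation_term (- t) q > 0"
      using t(1) by (simp add: mutation_term_simps mult_pos_neg)
    then show False
      using eq y0 by linarith
  next
    case False
    then have "mutation_term (- t) q = 0" "mutation_term t q = t * q"
      using t(1) by (simp_all add: mutation_term_simps)
    then have "y = 0" "p + t * q = 0"
      using eq y0 by simp_all
    then show False
      using y n nz t(1) by (auto simp: attachment_def)
  qed
qed


lemma mutation_term_0: "mutation_term t 0 = 0" "mutation_term 0 t = 0"
  by (simp_all add: mutation_term_def)

text \<open>Mutating at 4, the triangle 1, 3, 5 has weights x, s q, 0 and forces q = 1. Mutating
  instead at 3, 1, 4, the triangle 2, 3, 5 has weights x, 0, x s; its constant is 4 = x^2 + s^2 only
  for x = 1.\<close>

lemma no_pendant: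
  assumes q: "quiv 2 (- x) 0 0 x 0 0 s 0 q" and s: "s > 0" "s\<^sup>2 = 4 - x\<^sup>2" and q0: "q > 0"
  shows False
proof -
  note x = x_bounds
  have xx: "x * x \<ge> 3" and ss: "s * s = 4 - x * x"
    using x(1) s(2) by (simp_all add: power2_eq_square)
  have "mutation_term s q = s * q"
    using s q0 by (simp add: mutation_term_simps)
  then have "admissible (- x) (s * q) 0"
    using quiv_admissible(2)[OF quiv_mut4[OF q]] by (simp add: mutation_term_0)
  then have "mark (- x) (s * q) 0 = 4"
    using admissible_x[of "- x" "s * q" 0] s q0 x by simp
  then have "x\<^sup>2 + (s * q)\<^sup>2 = 4"
    by (simp add: mark_def cyc_def)
  then have q1: "q = 1"
    using square_one[of s q] s q0 by auto
  have "quiv (2 - x * x) x 0 0 (- x) (x * s) 0 (- s) 0 1"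
    using quiv_mut3[OF q] x s by (simp add: mutation_term_0 mutation_term_simps q1)
  from quiv_mut1[OF this]
  have "quiv (x * x - 2) (- x) 0 0 (x * (x * x - 3)) (x * s) 0 (- s) 0 1"
    using x xx by (simp add: mutation_term_0 mutation_term_simps algebra_simps)
  from quiv_mut4[OF this]
  have "quiv (x * x - 2) (- x) 0 0 (x * (x * x - 3) + x * s * s) (- (x * s)) (x * s) s 0 (- 1)"
    using x s by (simp add: mutation_term_0 mutation_term_simps)
  \<comment> \<open>The weight between 2 and 3 returns to x because s^2 = 4 - x^2, so the constant 4
    becomes compulsory for the triangle 2, 3, 5.\<close>
  moreover have "x * (x * x - 3) + x * s * s = x"
    using ss by (simp add: mult.assoc) (simp add: algebra_simps)
  ultimately have "admissible x 0 (- (x * s))"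
    using quiv_admissible(3) by metis
  then have "mark x 0 (- (x * s)) = 4"
    using admissible_x[of x 0 "- (x * s)"] s x by simp
  then have "x\<^sup>2 + (s * x)\<^sup>2 = 4"
    by (simp add: mark_def cyc_def mult.commute)
  then have "x = 1"
    using square_one[of s x] s x by auto
  then show False
    using xx by simp
qed

text \<open>The mutations of \<open>no_pendant\<close> apply: the first forces q = 0, the other
  three make the triangle 2, 3, 5 a non-oriented one with weights x, s, x s, whose constant exceeds
  x^2 + s^2 = 4.\<close>

lemma no_twin_apex:
  assumes q: "quiv 2 (- x) 0 0 x 0 0 s s q" and s: "s > 0" "s\<^sup>2 = 4 - x\<^sup>2" and q0: "q \<ge> 0"
  shows False
proof -
  note x = x_bounds
  have xx: "x * x \<ge> 3" and ss: "s * s = 4 - x * x"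
    using x(1) s(2) by (simp_all add: power2_eq_square)
  have "mutation_term s q = s * q"
    using s q0 by (simp add: mutation_term_simps)
  then have "s + mutation_term s q = s * (1 + q)"
    by (simp add: distrib_left)
  then have "admissible (- x) (s * (1 + q)) 0"
    using quiv_admissible(2)[OF quiv_mut4[OF q]] by (simp add: mutation_term_0)
  then have "mark (- x) (s * (1 + q)) 0 = 4"
    using admissible_x[of "- x" "s * (1 + q)" 0] s q0 x by simp
  then have "x\<^sup>2 + (s * (1 + q))\<^sup>2 = 4"
    by (simp add: mark_def cyc_def)
  then have q1: "q = 0"
    using square_one[of s "1 + q"] s q0 by auto
  have "quiv (2 - x * x) x 0 0 (- x) (x * s) (x * s) (- s) (- s) 0"
    using quiv_mut3[OF q] x s by (simp add: mutation_term_0 mutation_term_simps q1)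
  from quiv_mut1[OF this]
  have "quiv (x * x - 2) (- x) 0 0 (x * (x * x - 3)) (x * s) (x * s) (- s) (- s) 0"
    using x xx by (simp add: mutation_term_0 mutation_term_simps algebra_simps)
  from quiv_mut4[OF this]
  have "quiv (x * x - 2) (- x) 0 0 (x * (x * x - 3) + x * s * s) (- (x * s)) (x * s) s (- s) 0"
    using x s by (simp add: mutation_term_0 mutation_term_simps)
  moreover have "x * (x * x - 3) + x * s * s = x"
    using ss by (simp add: mult.assoc) (simp add: algebra_simps)
  ultimately have "admissible x (- s) (- (x * s))"
    using quiv_admissible(3) by metis
  then have "mark x (- s) (- (x * s)) = 4"
    using admissible_x[of x "- s" "- (x * s)"] s x by simp
  moreover have "cyc x (- s) (- (x * s)) = - (x * s * (x * s))"
    using s x by (simp add: cyc_def)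
  ultimately have "x\<^sup>2 + s\<^sup>2 + (x * s)\<^sup>2 + x * s * (x * s) = 4"
    by (simp add: mark_def)
  moreover have "x * s * (x * s) > 0" "(x * s)\<^sup>2 \<ge> 0"
    using s x by simp_all
  ultimately show False
    using s(2) by linarith
qed

text \<open>For q <= 0, mutations at 3 and 4 lead to a quadratic condition solved only by q = s^2
  and q = 2, both positive. For q > 0, mutation at 4 leaves q = 1, which reduces to
  \<open>no_pendant\<close>, and q = 2.\<close>

lemma no_opposite_apex:
  assumes q: "quiv 2 (- x) 0 0 x 0 0 s (- s) q" and s: "s > 0" "s\<^sup>2 = 4 - x\<^sup>2"
  shows False
proof -
  note x = x_bounds
  have xx: "x * x \<ge> 3" and ss: "s * s = 4 - x * x"
    using x(1) s(2) by (simp_all add: power2_eq_square)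
  have q3: "quiv (2 - x * x) x 0 (- (x * s)) (- x) (x * s) 0 (- s) s (q - s * s)"
    using quiv_mut3[OF q] x s by (simp add: mutation_term_0 mutation_term_simps)
  show False
  proof (cases "q \<le> 0")
    case True
    \<comment> \<open>After the mutations at 3 and 4 the weight between 3 and 5 is
      \<open>s * u\<close>. Subtracting x^2 + s^2 = 4 from the Markov equation leaves (u - 1)(u + 1
      - x^2) = 0.\<close>
    define u where "u = 1 + q - s * s"
    have "q - s * s \<le> 0"
      using True s by (simp add: order_trans[OF True])
    then have "s + mutation_term (- s) (q - s * s) = s * u"
      using s by (simp add: mutation_term_simps u_def algebra_simps)
    then have adm: "admissible x (s * u) (x * s)"
      using quiv_admissible(2)[OF quiv_mut4[OF q3]] by (simp add: mutation_term_0)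
    then have "mark x (s * u) (x * s) = 4"
      using admissible_x[of x "s * u" "x * s"] s x by simp
    moreover have "cyc x (s * u) (x * s) = x * (s * u) * (x * s)"
      using s x by (auto simp: cyc_def abs_mult zero_less_mult_iff)
    ultimately have "x\<^sup>2 + (s * u)\<^sup>2 + (x * s)\<^sup>2 - x * (s * u) * (x * s) = 4"
      by (simp add: mark_def)
    moreover have "s\<^sup>2 * ((u - 1) * (u + 1 - x * x)) = (s * u)\<^sup>2 + (x * s)\<^sup>2 - x * (s * u) * (x * s) - s\<^sup>2"
      by (simp add: power2_eq_square algebra_simps)
    ultimately have "s\<^sup>2 * ((u - 1) * (u + 1 - x * x)) = 0"
      using s(2) by linarith
    then have "u = 1 \<or> u = x * x - 1"
      using s by auto
    moreover have "s * s > 0"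
      using s by simp
    ultimately show False
      using True ss by (auto simp: u_def)
  next
    case False
    have "mutation_term s q = s * q"
      using s False by (simp add: mutation_term_simps)
    then have "- s + mutation_term s q = s * (q - 1)"
      by (simp add: right_diff_distrib)
    then have "admissible (- x) (s * (q - 1)) 0"
      using quiv_admissible(2)[OF quiv_mut4[OF q]] by (simp add: mutation_term_0)
    then have "mark (- x) (s * (q - 1)) 0 = 4" if "q \<noteq> 1"
      using admissible_x[of "- x" "s * (q - 1)" 0] that s x by simp
    then have "x\<^sup>2 + (s * (q - 1))\<^sup>2 = 4" if "q \<noteq> 1"
      using that by (simp add: mark_def cyc_def)
    then have "q = 1 \<or> q = 2"
      using square_one[of s "q - 1"] s False by force
    then show False
    proof
      assume q1: "q = 1"
      have "quiv 2 (- x) 0 0 x 0 0 (- s) 0 (- 1)"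
        using quiv_mut4[OF q] s by (simp add: mutation_term_0 mutation_term_simps q1)
      from quiv_reverse12[OF this] show False
        using no_pendant[of s 1] s by simp
    next
      \<comment> \<open>After mutations at 3 and 1 the triangle 3, 4, 5 is not oriented and has
        constant 4 + 2 s^2 (2 - s^2)(3 - s^2), which exceeds 4 as s^2 <= 1.\<close>
      assume q2: "q = 2"
      have S1: "s * s \<le> 1"
        using xx ss by linarith
      have "mutation_term (- x) (- (x * s)) = - (x * (x * s))"
        "mutation_term (x * x - 2) (- (x * s)) = 0"
        using s x xx by (simp_all add: mutation_term_simps)
      then have "admissible (- s) (2 - s * s) (x * (x * s) - s)"
        using quiv_admissible(4)[OF quiv_mut1[OF q3]] by (simp add: mutation_term_0 q2)
      moreover have "x * (x * s) - s = s * (x * x - 1)"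
        by (simp add: algebra_simps)
      ultimately have adm: "admissible (- s) (2 - s * s) (s * (x * x - 1))"
        by simp
      moreover have "two_nonzero (- s) (2 - s * s) (s * (x * x - 1))"
        using s xx S1 by (auto simp: two_nonzero_def)
      ultimately have le: "mark (- s) (2 - s * s) (s * (x * x - 1)) \<le> 4"
        unfolding admissible_def by blast
      have "cyc (- s) (2 - s * s) (s * (x * x - 1)) = - (s * (2 - s * s) * (s * (x * x - 1)))"
        using s xx S1 by (simp add: cyc_def abs_mult)
      then have "mark (- s) (2 - s * s) (s * (x * x - 1))
          = s\<^sup>2 + (2 - s * s)\<^sup>2 + (s * (3 - s * s))\<^sup>2 + s * (2 - s * s) * (s * (3 - s * s))"
        using ss by (simp add: mark_def)
      also have "\<dots> = 4 + 2 * (s * s * ((2 - s * s) * (3 - s * s)))"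
        by (simp add: power2_eq_square algebra_simps)
      finally have "s * s * ((2 - s * s) * (3 - s * s)) \<le> 0"
        using le by simp
      moreover have "s * s * ((2 - s * s) * (3 - s * s)) > 0"
        using s S1 by (intro mult_pos_pos) auto
      ultimately show False by simp
    qed
  qed
qed

lemma no_apex:
  assumes q: "quiv 2 (- x) 0 (- y) x 0 y s p q" and s: "s > 0" "s\<^sup>2 = 4 - x\<^sup>2" and n: "even n"
    and y: "attachment y p" and nz: "y \<noteq> 0 \<or> p \<noteq> 0 \<or> q \<noteq> 0"
  shows False
proof -
  consider "y = 0" "p = 0" | "y > 0" "y\<^sup>2 = 4 - x\<^sup>2" "p = 0" | "y = 0" "p\<^sup>2 = 4 - x\<^sup>2"
    using y n unfolding attachment_def by fastforce
  then show False
  proof cases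
    case 1
    show False
    proof (cases "q > 0")
      case True
      then show False
        using no_pendant q s 1 by simp
    next
      case False
      \<comment> \<open>Vertex 5 meets at most vertex 4 here, so mutating at 5 merely changes the
        sign of q.\<close>
      have "quiv 2 (- x) 0 0 x 0 0 s 0 (- q)"
        using quiv_mut5[OF q] by (simp add: 1 mutation_term_0)
      then show False
        using no_pendant[of s "- q"] s False nz 1 by simp
    qed
  next
    case 2
    have "quiv 2 (- x) (- y) 0 x y 0 0 s (- q)"
      using quiv_swap45[OF q] by (simp add: 2)
    then show False
      using no_attachment_to_double_arrow[of y 0 s "- q"] 2 s by simp
  next
    case 3
    then have "p = s \<or> p = - s"
      using s(2) by (simp add: power2_eq_iff[symmetric])
    then show False
    proof
      assume p: "p = s"
      show False
      proof (cases "q \<ge> 0")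
        case True
        then show False
          using no_twin_apex[of s q] q s 3 p by simp
      next
        case False
        then show False
          using no_twin_apex[of s "- q"] quiv_swap45[OF q] s 3 p by simp
      qed
    next
      assume "p = - s"
      then show False
        using no_opposite_apex[of s q] q s 3 by simp
    qed
  qed
qed

lemma no_quiver:
  assumes q: "quiv 2 (- x) (- y4) (- y5) x y4 y5 p4 p5 q"
    and att: "attachment y4 p4" "attachment y5 p5"
    and nz: "y4 \<noteq> 0 \<or> p4 \<noteq> 0" "y5 \<noteq> 0 \<or> p5 \<noteq> 0 \<or> q \<noteq> 0"
  shows False
proof -
  have y5: "y5 \<ge> 0"
    using att(2) by (simp add: attachment_def)
  have att5: "attachment y5 (- p5)"
    using att(2) by (simp add: attachment_def)
  have rev: "quiv 2 (- x) (- y4) (- y5) x y4 y5 (- p4) (- p5) (- q)"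
    using quiv_reverse12[OF q] by simp
  consider "y4 > 0" "y4\<^sup>2 = 4 - x\<^sup>2" "p4 = 0" | "even n" "y4 = 0" "p4\<^sup>2 = 4 - x\<^sup>2"
    | "odd n" "y4 > 0" "y4\<^sup>2 = 2 - x" "\<bar>p4\<bar> = y4"
    using att(1) nz(1) unfolding attachment_def by fastforce
  then show False
  proof cases
    case 1
    then show False
      using no_attachment_to_double_arrow[of y4 y5 p5 q] q y5 nz(2) by simp
  next
    case 2
    show False
    proof (cases "p4 > 0")
      case True
      then show False
        using no_apex[of y5 p4 p5 q] q 2 att(2) nz(2) by simp
    next
      case False
      then show False
        using no_apex[of y5 "- p4" "- p5" "- q"] rev 2 att5 nz by simp
    qed
  next
    case 3
    show False
    proof (cases "p4 = y4")
      case True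
      then show False
        using no_attachment_odd[of y4 y5 p5 q] q 3 att(2) nz(2) by simp
    next
      case False
      then have "p4 = - y4"
        using 3 by linarith
      then show False
        using no_attachment_odd[of y4 y5 "- p5" "- q"] rev 3 att5 nz(2) by simp
    qed
  qed
qed

end

section \<open>From the mutation class to a finite closed set of matrices\<close>

lemma real_quiver_iff: "real_quiver B \<longleftrightarrow> (\<forall>i j. B $ j $ i = - B $ i $ j)"
  unfolding real_quiver_def vec_eq_iff transpose_def by simp

lemma mutation_uminus: "mutation k (- B) = - mutation k B"
proof -
  have "\<bar>- p\<bar> * - q + - p * \<bar>- q\<bar> = - (\<bar>p\<bar> * q + p * \<bar>q\<bar>)" for p q :: real
    by simp
  then show ?thesis
    by (simp add: vec_eq_iff mutation_def minus_divide_left)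
qed

lemma real_quiver_mutation:
  assumes "real_quiver B"
  shows "real_quiver (mutation k B)"
  unfolding real_quiver_iff
proof (intro allI)
  fix i j
  have "B $ j $ i = - B $ i $ j" "B $ j $ k = - B $ k $ j" "B $ k $ i = - B $ i $ k"
    using assms unfolding real_quiver_iff by blast+
  moreover have "a' + (\<bar>b'\<bar> * c' + b' * \<bar>c'\<bar>) / 2 = - (a + (\<bar>c\<bar> * b + c * \<bar>b\<bar>) / 2)"
    if "a' = - a" "b' = - b" "c' = - c" for a b c a' b' c' :: real
    unfolding that abs_minus_cancel by (simp add: field_simps)
  ultimately show "mutation k B $ j $ i = - mutation k B $ i $ j"
    unfolding mutation_def vec_lambda_beta by presburger
qed

lemma mutation_reachable_real_quiver:
  "mutation_reachable B C \<Longrightarrow> real_quiver B \<Longrightarrow> real_quiver C"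
  by (induction rule: mutation_reachable.induct) (simp_all add: real_quiver_mutation)

text \<open>An edge can disappear only if both its ends are joined to k, and the edges at k survive,
  so a path through k replaces it.\<close>

lemma quiver_connected_mutation:
  assumes "quiver_connected B"
  shows "quiver_connected (mutation k B)"
proof -
  have edge: "(joined (mutation k B))\<^sup>*\<^sup>* i j" if "joined B i j" for i j
  proof (cases "joined (mutation k B) i j")
    case False
    then have ij: "i \<noteq> k" "j \<noteq> k"
      using that by (simp_all add: joined_def mutation_def split: if_splits)
    have "B $ i $ k \<noteq> 0 \<and> B $ k $ j \<noteq> 0"
    proof (rule ccontr)
      assume "\<not> ?thesis"
      then have "mutation k B $ i $ j = B $ i $ j"
        using ij by (auto simp: mutation_def)
      then show False
        using that False by (simp add: joined_def)
    qed
    then have "joined (mutation k B) i k" "joined (mutation k B) k j"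
      by (simp_all add: joined_def mutation_def)
    then show ?thesis
      by (rule rtranclp.rtrancl_into_rtrancl[OF r_into_rtranclp])
  qed (rule r_into_rtranclp)
  have "(joined (mutation k B))\<^sup>*\<^sup>* i j" if "(joined B)\<^sup>*\<^sup>* i j" for i j
    using that
  proof (induction rule: rtranclp_induct)
    case (step u v)
    then show ?case
      using rtranclp_trans[OF step(3) edge[OF step(2)]] by simp
  qed simp
  then show ?thesis
    using assms by (simp add: quiver_connected_def)
qed

lemma mutation_reachable_connected:
  "mutation_reachable B C \<Longrightarrow> quiver_connected B \<Longrightarrow> quiver_connected C"
  by (induction rule: mutation_reachable.induct) (simp_all add: quiver_connected_mutation)

text \<open>A relabeling class is finite because there are finitely many vertex permutations; so
  finiteness up to relabeling bounds the matrices themselves.\<close>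

lemma finite_mutation_reachable:
  fixes B :: "real ^ 'n ^ 'n"
  assumes "mutation_finite B"
  shows "finite {C. mutation_reachable B C}"
proof (rule finite_subset)
  have "C \<in> relabeling_class C" for C :: "real ^ 'n ^ 'n"
    unfolding relabeling_class_def
    by (intro CollectI exI[of _ id]) (simp add: relabel_def vec_eq_iff)
  then show "{C. mutation_reachable B C} \<subseteq> \<Union> (mutation_class B)"
    unfolding mutation_class_def by blast
  have "finite (relabeling_class C)" for C :: "real ^ 'n ^ 'n"
    by (rule finite_subset[of _ "range (\<lambda>p. relabel p C)"]) (auto simp: relabeling_class_def)
  then show "finite (\<Union> (mutation_class B))"
    using assms unfolding mutation_finite_def mutation_class_def by auto
qed

theorem theorem3p8:
  shows "\<not> (\<exists>(B :: real^5^5) (m :: int) (d :: int).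
            real_quiver B \<and> quiver_connected B \<and> mutation_finite B \<and>
            d > 5 \<and> real_of_int m \<le> real_of_int d / 2 \<and> gcd m d = 1 \<and>
            (\<exists>i j. has_arrow B i j (2 * cos (pi * real_of_int m / real_of_int d))))"
proof (intro notI, elim exE conjE)
  fix B :: "real^5^5" and m d :: int and i0 j0
  assume B: "real_quiver B" "quiver_connected B" "mutation_finite B" and d: "d > 5" "gcd m d = 1"
    and arrow: "has_arrow B i0 j0 (2 * cos (pi * real_of_int m / real_of_int d))"
  \<comment> \<open>Negatives are added to allow reversal of all arrows; mutation commutes with
    negation, so the set stays closed.\<close>
  define Q where "Q = {C. mutation_reachable B C} \<union> uminus ` {C. mutation_reachable B C}"
  have Q_cases: "mutation_reachable B C \<or> mutation_reachable B (- C)" if "C \<in> Q" for C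
    using that by (auto simp: Q_def)
  interpret mutation_closed Q
  proof
    show "finite Q"
      unfolding Q_def using finite_mutation_reachable[OF B(3)] by simp
    show "C $ j $ i = - C $ i $ j" if "C \<in> Q" for C i j
    proof -
      have "real_quiver C \<or> real_quiver (- C)"
        using Q_cases[OF that] mutation_reachable_real_quiver[OF _ B(1)] by blast
      then have "C $ j $ i = - C $ i $ j \<or> (- C) $ j $ i = - ((- C) $ i $ j)"
        unfolding real_quiver_iff by blast
      then show ?thesis
        by auto
    qed
    show "mutation k C \<in> Q" if "C \<in> Q" for k C
    proof -
      have "mutation_reachable B (mutation k C) \<or> mutation_reachable B (- mutation k C)"
        using Q_cases[OF that] mutation_reachable.step[of B C k] mutation_reachable.step[of B "- C" k]
        by (auto simp: mutation_uminus)
      then show ?thesis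
      proof
        assume "mutation_reachable B (- mutation k C)"
        then have "- (- mutation k C) \<in> uminus ` {C. mutation_reachable B C}"
          by (intro imageI CollectI)
        then show ?thesis
          by (simp add: Q_def)
      qed (simp add: Q_def)
    qed
    show "- C \<in> Q" if "C \<in> Q" for C
      using that unfolding Q_def by auto
  qed
  have connected: "quiver_connected C" if "C \<in> Q" for C
  proof -
    have "joined (- C) = joined C"
      by (simp add: joined_def fun_eq_iff)
    then have "quiver_connected (- C) \<longleftrightarrow> quiver_connected C"
      by (simp add: quiver_connected_def)
    then show ?thesis
      using Q_cases[OF that] mutation_reachable_connected[OF _ B(2)] by blast
  qed
  have "CARD(5) \<ge> 3"
    by simp
  moreover have "B \<in> Q"
    by (simp add: Q_def mutation_reachable.refl)
  moreover have "denominator (B $ i0 $ j0) d"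
    using arrow d by (auto simp: has_arrow_def denominator_def coprime_iff_gcd_eq_1)
  moreover have "d \<ge> 6"
    using d(1) by simp
  ultimately obtain n x C i j k where n: "n \<ge> 6" "x = 2 * cos (pi / real_of_int n)" "denominator x n"
      "\<And>u v w. (u, v, w) \<in> markov_triples 4 \<Longrightarrow> u < 2 \<Longrightarrow> u \<le> x"
    and C: "C \<in> Q" "i \<noteq> j" "j \<noteq> k" "i \<noteq> k" "C $ i $ j = 2" "C $ j $ k = x" "C $ k $ i = x"
    by (rule exists_normal_form[rotated 1]) (rule that, assumption+, rule connected)
  interpret normal_form Q x n
    by unfold_locales (fact n)+
  have outside: "\<exists>v. v \<notin> A" if "card A < 5" for A :: "5 set"
  proof (rule ccontr)
    assume "\<not> ?thesis"
    then have "A = UNIV" by blast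
    then show False
      using that by simp
  qed
  have "card {i, j, k} < 5"
    using card_length[of "[i, j, k]"] by simp
  \<comment> \<open>Connectedness supplies \<open>v\<close> joined to the triangle, and then
    \<open>w\<close> joined to the triangle or to \<open>v\<close>: the nonvanishing hypotheses of
    \<open>no_quiver\<close>.\<close>
  then obtain v where v: "v \<notin> {i, j, k}" "\<exists>u\<in>{i, j, k}. C $ u $ v \<noteq> 0"
    using outside quiver_connected_boundary[OF connected[OF C(1)], of i "{i, j, k}"] by blast
  have "card {i, j, k, v} < 5"
    using card_length[of "[i, j, k, v]"] by simp
  then obtain w where w: "w \<notin> {i, j, k, v}" "\<exists>u\<in>{i, j, k, v}. C $ u $ w \<noteq> 0"
    using outside quiver_connected_boundary[OF connected[OF C(1)], of i "{i, j, k, v}"] by blast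
  have dist: "v \<noteq> i" "v \<noteq> j" "v \<noteq> k" "w \<noteq> i" "w \<noteq> j" "w \<noteq> k" "w \<noteq> v"
    using v(1) w(1) by auto
  have dv: "C $ j $ v = C $ v $ i" "C $ j $ w = C $ w $ i"
    using double_arrow[of C i j v] double_arrow[of C i j w] C dist by auto
  have iv: "C $ i $ v = - C $ j $ v" "C $ i $ w = - C $ j $ w" "C $ i $ k = - x"
    using skew[OF C(1), of i v] skew[OF C(1), of i w] skew[OF C(1), of i k] dv C(7) by simp_all
  show False
  proof (rule no_quiver)
    show "quiv 2 (- x) (- C $ j $ v) (- C $ j $ w) x (C $ j $ v) (C $ j $ w) (C $ k $ v) (C $ k $ w) (C $ v $ w)"
      by (rule quivI[OF C(1), of i j k v w]) (use C dist iv in auto)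
    show "attachment (C $ j $ v) (C $ k $ v)" "attachment (C $ j $ w) (C $ k $ w)"
      by (rule attachment_of_vertex[of C i j k]; use C dist in simp)+
    show "C $ j $ v \<noteq> 0 \<or> C $ k $ v \<noteq> 0"
      using v(2) iv by auto
    show "C $ j $ w \<noteq> 0 \<or> C $ k $ w \<noteq> 0 \<or> C $ v $ w \<noteq> 0"
      using w(2) iv by auto
  qed
qed

end
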